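(* Every totally disconnected locally compact group is isomorphic, as a topological group, to an open subgroup of some C$^\ast$-simple locally compact group.
   Context: For a locally compact group $H$ with a left Haar measure, the reduced group C$^\ast$-algebra $\mathrm{C}^\ast_{\mathrm r}(H)$ is the operator norm closure of $C_c(H)$ acting on $L^2(H)$ by convolution (the integrated form of the left regular representation). $H$ is called C$^\ast$-simple if $\mathrm{C}^\ast_{\mathrm r}(H)$ is simple, i.e. has no closed two-sided ideals other than $0$ and itself. *)

theory Defs
  imports "HOL-Analysis.Analysis" "HOL-Algebra.Group"
begin

section \<open>Locally compact groups\<close>

definition topological_group :: "('a, 'm) monoid_scheme \<Rightarrow> 'a topology \<Rightarrow> bool" where
  "topological_group G X \<longleftrightarrow>
     group G \<and> topspace X = carrier G \<and>
     continuous_map (prod_topology X X) X (\<lambda>(x, y). x \<otimes>\<^bsub>G\<^esub> y) \<and>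
     continuous_map X X (\<lambda>x. inv\<^bsub>G\<^esub> x)"

definition locally_compact_group :: "('a, 'm) monoid_scheme \<Rightarrow> 'a topology \<Rightarrow> bool" where
  "locally_compact_group G X \<longleftrightarrow>
     topological_group G X \<and> Hausdorff_space X \<and> locally_compact_space X"

definition totally_disconnected_space :: "'a topology \<Rightarrow> bool" where
  "totally_disconnected_space X \<longleftrightarrow> (\<forall>S. connectedin X S \<longrightarrow> (\<exists>a. S \<subseteq> {a}))"

definition tdlc_group :: "('a, 'm) monoid_scheme \<Rightarrow> 'a topology \<Rightarrow> bool" where
  "tdlc_group G X \<longleftrightarrow> locally_compact_group G X \<and> totally_disconnected_space X"

definition isomorphic_to_open_subgroup ::
    "('a, 'm) monoid_scheme \<Rightarrow> 'a topology \<Rightarrow> ('b, 'n) monoid_scheme \<Rightarrow> 'b topology \<Rightarrow> bool" where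
  "isomorphic_to_open_subgroup G X H Y \<longleftrightarrow>
     (\<exists>U. subgroup U H \<and> openin Y U \<and>
       (\<exists>\<phi>. \<phi> \<in> iso G (H\<lparr>carrier := U\<rparr>) \<and> homeomorphic_map X (subtopology Y U) \<phi>))"


section \<open>Left Haar measures\<close>

text \<open>
  No countability is assumed of the group, so regularity is the usual one for Radon measures:
  outer regularity on Borel sets, inner regularity on open sets.
\<close>

definition left_haar_measure :: "('a, 'm) monoid_scheme \<Rightarrow> 'a topology \<Rightarrow> 'a measure \<Rightarrow> bool" where
  "left_haar_measure G X M \<longleftrightarrow>
     space M = topspace X \<and>
     sets M = sigma_sets (topspace X) {U. openin X U} \<and>
     emeasure M (space M) \<noteq> 0 \<and>
     (\<forall>K. compactin X K \<longrightarrow> emeasure M K < \<infinity>) \<and>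
     (\<forall>A\<in>sets M. emeasure M A = (INF U\<in>{U. openin X U \<and> A \<subseteq> U}. emeasure M U)) \<and>
     (\<forall>U. openin X U \<longrightarrow> emeasure M U = (SUP K\<in>{K. compactin X K \<and> K \<subseteq> U}. emeasure M K)) \<and>
     (\<forall>g\<in>carrier G. \<forall>A\<in>sets M. emeasure M ((\<lambda>x. g \<otimes>\<^bsub>G\<^esub> x) ` A) = emeasure M A)"


section \<open>Bounded operators on the space of square-integrable functions\<close>

text \<open>
  Vectors are square-integrable functions rather than their classes modulo almost everywhere
  equality; accordingly, vectors are compared by \<open>AE\<close>, and two operators are regarded as equal
  if they agree almost everywhere on every vector.  A bounded linear operator in the sense
  below respects almost everywhere equality, because \<open>L2_norm\<close> vanishes exactly on
  functions that are zero almost everywhere.  Values of operators outside \<open>L2_space M\<close> are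
  irrelevant.
\<close>

definition L2_space :: "'a measure \<Rightarrow> ('a \<Rightarrow> complex) set" where
  "L2_space M = {f \<in> borel_measurable M. integrable M (\<lambda>x. (cmod (f x))\<^sup>2)}"

definition L2_norm :: "'a measure \<Rightarrow> ('a \<Rightarrow> complex) \<Rightarrow> real" where
  "L2_norm M f = sqrt (LINT x|M. (cmod (f x))\<^sup>2)"

type_synonym 'a operator = "('a \<Rightarrow> complex) \<Rightarrow> ('a \<Rightarrow> complex)"

definition op_add :: "'a operator \<Rightarrow> 'a operator \<Rightarrow> 'a operator" where
  "op_add S T = (\<lambda>f x. S f x + T f x)"

definition op_scale :: "complex \<Rightarrow> 'a operator \<Rightarrow> 'a operator" where
  "op_scale c T = (\<lambda>f x. c * T f x)"

definition op_diff :: "'a operator \<Rightarrow> 'a operator \<Rightarrow> 'a operator" where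
  "op_diff S T = (\<lambda>f x. S f x - T f x)"

definition bounded_operators :: "'a measure \<Rightarrow> 'a operator set" where
  "bounded_operators M = {T.
     (\<forall>f\<in>L2_space M. T f \<in> L2_space M) \<and>
     (\<forall>f\<in>L2_space M. \<forall>g\<in>L2_space M. AE x in M. T (\<lambda>y. f y + g y) x = T f x + T g x) \<and>
     (\<forall>c. \<forall>f\<in>L2_space M. AE x in M. T (\<lambda>y. c * f y) x = c * T f x) \<and>
     (\<exists>C. \<forall>f\<in>L2_space M. L2_norm M (T f) \<le> C * L2_norm M f)}"

definition op_norm :: "'a measure \<Rightarrow> 'a operator \<Rightarrow> real" where
  "op_norm M T = Sup {L2_norm M (T f) | f. f \<in> L2_space M \<and> L2_norm M f \<le> 1}"

definition op_closure :: "'a measure \<Rightarrow> 'a operator set \<Rightarrow> 'a operator set" where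
  "op_closure M \<A> =
     {T \<in> bounded_operators M. \<forall>\<epsilon>>0. \<exists>S\<in>\<A>. op_norm M (op_diff T S) < \<epsilon>}"

definition zero_operators :: "'a measure \<Rightarrow> 'a operator set" where
  "zero_operators M = {T \<in> bounded_operators M. \<forall>f\<in>L2_space M. AE x in M. T f x = 0}"


section \<open>The reduced group C*-algebra and C*-simplicity\<close>

definition compactly_supported :: "'a topology \<Rightarrow> ('a \<Rightarrow> complex) set" where
  "compactly_supported X =
     {f. continuous_map X euclidean f \<and> compactin X (X closure_of {x \<in> topspace X. f x \<noteq> 0})}"

text \<open>
  For compactly supported continuous \<open>f\<close> and square-integrable \<open>g\<close> the convolution integral
  converges at every point and is continuous there, so no exceptional null set is involved.
\<close>

definition convolution_operator ::
    "('a, 'm) monoid_scheme \<Rightarrow> 'a measure \<Rightarrow> ('a \<Rightarrow> complex) \<Rightarrow> 'a operator" where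
  "convolution_operator G M f = (\<lambda>g x. LINT y|M. f y * g (inv\<^bsub>G\<^esub> y \<otimes>\<^bsub>G\<^esub> x))"

definition reduced_cstar_algebra ::
    "('a, 'm) monoid_scheme \<Rightarrow> 'a topology \<Rightarrow> 'a measure \<Rightarrow> 'a operator set" where
  "reduced_cstar_algebra G X M =
     op_closure M (convolution_operator G M ` compactly_supported X)"

text \<open>
  Norm-closed sets of operators are automatically saturated with respect to the identification
  of operators agreeing almost everywhere, so closed ideals below correspond to closed ideals of
  the algebra obtained after that identification, and the zero ideal is \<open>zero_operators M\<close>.
\<close>

definition closed_two_sided_ideal :: "'a measure \<Rightarrow> 'a operator set \<Rightarrow> 'a operator set \<Rightarrow> bool" where
  "closed_two_sided_ideal M \<A> I \<longleftrightarrow>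
     I \<subseteq> \<A> \<and> I \<noteq> {} \<and>
     (\<forall>S\<in>I. \<forall>T\<in>I. op_add S T \<in> I) \<and>
     (\<forall>c. \<forall>T\<in>I. op_scale c T \<in> I) \<and>
     (\<forall>S\<in>\<A>. \<forall>T\<in>I. S \<circ> T \<in> I \<and> T \<circ> S \<in> I) \<and>
     \<A> \<inter> op_closure M I \<subseteq> I"

definition simple_operator_algebra :: "'a measure \<Rightarrow> 'a operator set \<Rightarrow> bool" where
  "simple_operator_algebra M \<A> \<longleftrightarrow>
     (\<forall>I. closed_two_sided_ideal M \<A> I \<longrightarrow> I = zero_operators M \<or> I = \<A>)"

text \<open>
  A left Haar measure exists and is unique up to a positive scalar, and rescaling it does not
  change the algebra; the existential form keeps the notion from being vacuous.
\<close>

definition cstar_simple :: "('a, 'm) monoid_scheme \<Rightarrow> 'a topology \<Rightarrow> bool" where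
  "cstar_simple G X \<longleftrightarrow>
     (\<exists>M. left_haar_measure G X M \<and> simple_operator_algebra M (reduced_cstar_algebra G X M))"


section \<open>Where overgroups live\<close>

text \<open>
  HOL cannot quantify existentially over types, so an overgroup of a group with elements
  of type \<open>'a\<close> needs a fixed type of elements.  This one is infinite, also for finite \<open>'a\<close>,
  and has room for semidirect products of a group on \<open>'a\<close> with a group of words whose
  letters are indexed by countably many copies of a family of cosets.  Only the underlying set
  is provided; the group and its topology remain arbitrary.
\<close>

type_synonym 'a overgroup_element = "('a set \<times> nat) list \<times> 'a"

end

theory Submission
  imports Defs
begin

text \<open>
  Let \<open>F\<close> be the free product of groups of order two indexed by the pairs of a subset of \<open>G\<close> with open
  stabiliser under left translation and a natural number.  The group \<open>G\<close> permutes these subsets, and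
  as the stabilisers are open, \<open>F \<rtimes> G\<close> with \<open>F\<close> discrete is a locally compact group containing \<open>G\<close>
  as an open subgroup.

  Let \<open>K\<close> be a compact open subgroup of \<open>G\<close>.  The generators \<open>t\<^sub>n = (K, n)\<close> commute with \<open>K\<close>, and
  conjugation by them moves every compact set disjoint from \<open>K\<close> around so freely that the averaging
  argument of Powers applies: the averages of \<open>\<lambda>(t\<^sub>n) x \<lambda>(t\<^sub>n)\<close> over many \<open>n\<close>, compressed by the
  projection \<open>p\<^sub>K\<close> onto the left \<open>K\<close>-invariant functions, converge in norm to a multiple of \<open>p\<^sub>K\<close>.
  Hence a nonzero closed ideal contains \<open>p\<^sub>K\<close> for all small \<open>K\<close>, and these form an approximate unit.

  As \<open>F \<rtimes> G\<close> has a base of compact open subgroups, a Haar measure comes from counting cosets, and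
  convolution operators are handled through locally constant functions.  No Fubini theorem is
  needed, which matters as the measure need not be \<open>\<sigma>\<close>-finite and multiplication need not be
  measurable for the product \<open>\<sigma>\<close>-algebra.
\<close>

section \<open>Topological groups with a base of compact open subgroups\<close>

text \<open>As the group may be nondiscrete, translation operators need not lie in its reduced
  algebra, which need not carry a finite trace either, so the argument of Powers is run inside the
  corners cut out by the p_K. This is why the letters \<open>(K, n)\<close> must commute with K:
  conjugation by t_n then preserves the corner, and the part of a function supported on K acts there
  as a scalar, its integral. The remaining part has compact support off K. Only finitely many words,
  hence finitely many indices n, occur in that support, and generators of larger index meet no
  cancellation; the countably many copies serve this purpose. Averaging m conjugates leaves an error
  of order 1/sqrt m. The scalar in the limit is a coefficient of T at the indicator of K and may
  vanish for a nonzero T. It is made nonzero by shrinking K and multiplying T on both sides by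
  convolution operators, so the argument works with the ideal operations alone and takes no
  adjoints. Admitting all subsets with open stabiliser as letters lets one group F serve every K at
  once.\<close>

locale top_group = group G for G :: "('a, 'm) monoid_scheme" (structure) +
  fixes X :: "'a topology"
  assumes topological_group: "topological_group G X"
    and Hausdorff: "Hausdorff_space X"
begin

definition compact_open :: "'a set \<Rightarrow> bool" where
  "compact_open C \<longleftrightarrow> compactin X C \<and> openin X C"

definition compact_open_subgroup :: "'a set \<Rightarrow> bool" where
  "compact_open_subgroup K \<longleftrightarrow> subgroup K G \<and> compact_open K"

lemma topspace_eq [simp]: "topspace X = carrier G"
  using topological_group by (simp add: topological_group_def)

lemma inv_mult_cancel [simp]:
  assumes "a \<in> carrier G" "x \<in> carrier G"
  shows "inv a \<otimes> (a \<otimes> x) = x" "a \<otimes> (inv a \<otimes> x) = x" 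
    "x \<otimes> inv a \<otimes> a = x" "x \<otimes> a \<otimes> inv a = x"
  using assms by (simp_all add: m_assoc[symmetric]) (simp_all add: m_assoc)

lemma continuous_map_mult:
  assumes "continuous_map Z X f" "continuous_map Z X g"
  shows "continuous_map Z X (\<lambda>z. f z \<otimes> g z)"
proof -
  have "continuous_map (prod_topology X X) X (\<lambda>(x, y). x \<otimes> y)"
    using topological_group by (simp add: topological_group_def)
  moreover have "continuous_map Z (prod_topology X X) (\<lambda>z. (f z, g z))"
    using assms by (simp add: continuous_map_pairedI)
  ultimately have "continuous_map Z X ((\<lambda>(x, y). x \<otimes> y) \<circ> (\<lambda>z. (f z, g z)))"
    using continuous_map_compose by blast
  then show ?thesis by (simp add: o_def)
qed

lemma continuous_map_inv:
  assumes "continuous_map Z X f"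
  shows "continuous_map Z X (\<lambda>z. inv (f z))"
proof -
  have "continuous_map X X (\<lambda>x. inv x)"
    using topological_group by (simp add: topological_group_def)
  with assms have "continuous_map Z X ((\<lambda>x. inv x) \<circ> f)"
    using continuous_map_compose by blast
  then show ?thesis by (simp add: o_def)
qed

lemma continuous_map_left_translation:
  "a \<in> carrier G \<Longrightarrow> continuous_map X X (\<lambda>x. a \<otimes> x)"
  by (intro continuous_map_mult) auto

lemma continuous_map_right_translation:
  "a \<in> carrier G \<Longrightarrow> continuous_map X X (\<lambda>x. x \<otimes> a)"
  by (intro continuous_map_mult) auto

lemma left_translation_image_eq:
  assumes "a \<in> carrier G" "A \<subseteq> carrier G"
  shows "(\<lambda>x. a \<otimes> x) ` A = {x \<in> carrier G. inv a \<otimes> x \<in> A}"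
proof (intro equalityI subsetI)
  fix x assume "x \<in> {x \<in> carrier G. inv a \<otimes> x \<in> A}"
  then have "x = a \<otimes> (inv a \<otimes> x)" "inv a \<otimes> x \<in> A" using assms by auto
  then show "x \<in> (\<lambda>x. a \<otimes> x) ` A" by blast
qed (use assms in auto)

lemma right_translation_image_eq:
  assumes "a \<in> carrier G" "A \<subseteq> carrier G"
  shows "(\<lambda>x. x \<otimes> a) ` A = {x \<in> carrier G. x \<otimes> inv a \<in> A}"
proof (intro equalityI subsetI)
  fix x assume "x \<in> {x \<in> carrier G. x \<otimes> inv a \<in> A}"
  then have "x = x \<otimes> inv a \<otimes> a" "x \<otimes> inv a \<in> A" using assms by auto
  then show "x \<in> (\<lambda>x. x \<otimes> a) ` A" by blast
qed (use assms in auto)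

lemma inv_image_eq:
  assumes "A \<subseteq> carrier G"
  shows "(\<lambda>x. inv x) ` A = {x \<in> carrier G. inv x \<in> A}"
proof (intro equalityI subsetI)
  fix x assume "x \<in> {x \<in> carrier G. inv x \<in> A}"
  then have "x = inv (inv x)" "inv x \<in> A" using assms by auto
  then show "x \<in> (\<lambda>x. inv x) ` A" by blast
qed (use assms in auto)

lemma openin_left_translation:
  assumes "a \<in> carrier G" "openin X U"
  shows "openin X ((\<lambda>x. a \<otimes> x) ` U)"
  using openin_continuous_map_preimage[OF continuous_map_left_translation[of "inv a"] assms(2)]
    openin_subset[OF assms(2)] assms(1)
  by (simp add: left_translation_image_eq)

lemma openin_right_translation:
  assumes "a \<in> carrier G" "openin X U"
  shows "openin X ((\<lambda>x. x \<otimes> a) ` U)"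
  using openin_continuous_map_preimage[OF continuous_map_right_translation[of "inv a"] assms(2)]
    openin_subset[OF assms(2)] assms(1)
  by (simp add: right_translation_image_eq)

lemma openin_inv_image:
  assumes "openin X U"
  shows "openin X ((\<lambda>x. inv x) ` U)"
  using openin_continuous_map_preimage[OF continuous_map_inv[OF continuous_map_id] assms]
    openin_subset[OF assms]
  by (simp add: inv_image_eq)

section \<open>The algebra of compact open sets\<close>

lemma compact_open_subset: "compact_open C \<Longrightarrow> C \<subseteq> carrier G"
  unfolding compact_open_def using compactin_subset_topspace by fastforce

lemma compact_open_imp_open: "compact_open C \<Longrightarrow> openin X C"
  by (simp add: compact_open_def)

lemma compact_open_imp_closed: "compact_open C \<Longrightarrow> closedin X C"
  by (simp add: compact_open_def compactin_imp_closedin Hausdorff)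

lemma compact_open_left_translation:
  "a \<in> carrier G \<Longrightarrow> compact_open C \<Longrightarrow> compact_open ((\<lambda>x. a \<otimes> x) ` C)"
  unfolding compact_open_def
  using image_compactin[OF _ continuous_map_left_translation] openin_left_translation by blast

lemma compact_open_right_translation:
  "a \<in> carrier G \<Longrightarrow> compact_open C \<Longrightarrow> compact_open ((\<lambda>x. x \<otimes> a) ` C)"
  unfolding compact_open_def
  using image_compactin[OF _ continuous_map_right_translation] openin_right_translation by blast

lemma compact_open_inv_image:
  "compact_open C \<Longrightarrow> compact_open ((\<lambda>x. inv x) ` C)"
  unfolding compact_open_def
  using image_compactin[OF _ continuous_map_inv[OF continuous_map_id]] openin_inv_image by fastforce

lemma compact_open_empty [simp]: "compact_open {}"
  by (simp add: compact_open_def)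

lemma compact_open_Un: "compact_open C \<Longrightarrow> compact_open D \<Longrightarrow> compact_open (C \<union> D)"
  by (auto simp: compact_open_def compactin_Un)

lemma compact_open_Int_open: 
  assumes "compact_open C" "openin X D" "closedin X D" shows "compact_open (C \<inter> D)"
  using assms by (auto simp: compact_open_def compact_Int_closedin)

lemma compact_open_Int: "compact_open C \<Longrightarrow> compact_open D \<Longrightarrow> compact_open (C \<inter> D)"
  by (simp add: compact_open_Int_open compact_open_imp_closed compact_open_imp_open)

lemma compact_open_Diff:
  assumes "compact_open C" "compact_open D" shows "compact_open (C - D)"
proof -
  have "C - D = C \<inter> (carrier G - D)" using compact_open_subset[OF assms(1)] by auto
  moreover have "openin X (carrier G - D)" "closedin X (carrier G - D)"
    using compact_open_imp_closed[OF assms(2)] compact_open_imp_open[OF assms(2)]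
    by (metis closedin_diff closedin_topspace openin_diff openin_topspace topspace_eq)+
  ultimately show ?thesis using assms(1) by (simp add: compact_open_Int_open)
qed

lemma compact_open_UN:
  "finite I \<Longrightarrow> (\<And>i. i \<in> I \<Longrightarrow> compact_open (F i)) \<Longrightarrow> compact_open (\<Union>i\<in>I. F i)"
  by (induction I rule: finite_induct) (auto intro: compact_open_Un)

lemma compact_open_subgroupD:
  assumes "compact_open_subgroup K"
  shows "subgroup K G" "compact_open K" "K \<subseteq> carrier G" "openin X K" "compactin X K"
    "\<one> \<in> K" "\<And>x y. x \<in> K \<Longrightarrow> y \<in> K \<Longrightarrow> x \<otimes> y \<in> K" "\<And>x. x \<in> K \<Longrightarrow> inv x \<in> K"
    "\<And>x. x \<in> K \<Longrightarrow> x \<in> carrier G"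
  using assms unfolding compact_open_subgroup_def compact_open_def
  by (auto simp: subgroup.subset subgroup.one_closed subgroup.m_closed subgroup.m_inv_closed
      dest: subgroup.mem_carrier)

lemma compact_open_subgroup_Int:
  "compact_open_subgroup K \<Longrightarrow> compact_open_subgroup L \<Longrightarrow> compact_open_subgroup (K \<inter> L)"
  unfolding compact_open_subgroup_def by (auto intro: compact_open_Int subgroups_Inter_pair)

text \<open>The pairs \<open>(c, g)\<close> with \<open>c \<otimes> g\<close> outside
  \<open>C\<close> form a closed set because \<open>C\<close> is open. Compactness of
  \<open>C\<close> makes the projection to the second factor a closed map, so the \<open>g\<close>
  that fail form a closed set.\<close>

lemma openin_right_stabiliser:
  assumes C: "compact_open C"
  shows "openin X {g \<in> carrier G. \<forall>c\<in>C. c \<otimes> g \<in> C}"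
proof -
  let ?Z = "prod_topology (subtopology X C) X"
  have CX: "C \<subseteq> carrier G" using C by (rule compact_open_subset)
  have snd: "closed_map ?Z X snd"
    by (rule closed_map_snd) (use C in \<open>simp add: compact_open_def compact_space_subtopology\<close>)
  have "continuous_map ?Z X (\<lambda>z. fst z \<otimes> snd z)"
    by (intro continuous_map_mult)
      (auto intro: continuous_map_snd continuous_map_into_fulltopology continuous_map_fst)
  moreover have "closedin X (carrier G - C)"
    using compact_open_imp_open[OF C] by (metis closedin_diff closedin_topspace topspace_eq)
  ultimately have "closedin ?Z {z \<in> topspace ?Z. fst z \<otimes> snd z \<in> carrier G - C}"
    by (rule closedin_continuous_map_preimage)
  then have "closedin X (snd ` {z \<in> topspace ?Z. fst z \<otimes> snd z \<in> carrier G - C})"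
    using snd by (simp add: closed_map_def)
  moreover have "carrier G - snd ` {z \<in> topspace ?Z. fst z \<otimes> snd z \<in> carrier G - C}
      = {g \<in> carrier G. \<forall>c\<in>C. c \<otimes> g \<in> C}"
    using CX by (force simp: image_iff)
  ultimately show ?thesis
    using openin_diff[OF openin_topspace[of X]] by (metis (no_types, lifting) topspace_eq)
qed

text \<open>The elements mapping \<open>C\<close> into itself from the right form an open submonoid
  \<open>N\<close>, and \<open>\<one> \<in> C\<close> puts \<open>N\<close> inside \<open>C\<close>.
  Intersecting with the inverses gives an open subgroup, which is closed and therefore compact as a
  subset of \<open>C\<close>.\<close>

lemma compact_open_contains_subgroup:
  assumes C: "compact_open C" and one: "\<one> \<in> C"
  obtains K where "compact_open_subgroup K" "K \<subseteq> C"
proof -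
  define N where "N = {g \<in> carrier G. \<forall>c\<in>C. c \<otimes> g \<in> C}"
  define K where "K = N \<inter> {x \<in> carrier G. inv x \<in> N}"
  have CX: "C \<subseteq> carrier G" using C by (rule compact_open_subset)
  have "openin X N" unfolding N_def using C by (rule openin_right_stabiliser)
  then have "openin X {x \<in> topspace X. inv x \<in> N}"
    using openin_continuous_map_preimage[OF continuous_map_inv[OF continuous_map_id]] by fastforce
  with \<open>openin X N\<close> have oK: "openin X K" by (simp add: K_def openin_Int)
  have KC: "K \<subseteq> C"
  proof
    fix x assume "x \<in> K"
    then have "\<one> \<otimes> x \<in> C" "x \<in> carrier G" using one unfolding K_def N_def by blast+
    then show "x \<in> C" by simp
  qed
  have N_mult: "x \<otimes> y \<in> N" if "x \<in> N" "y \<in> N" for x y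
    using that CX by (auto simp: N_def m_assoc[symmetric] subset_iff)
  have sK: "subgroup K G"
  proof (rule subgroupI)
    show "K \<subseteq> carrier G" by (auto simp: K_def N_def)
    have "\<one> \<in> K" using CX by (auto simp: K_def N_def)
    then show "K \<noteq> {}" by auto
    show "inv a \<in> K" if "a \<in> K" for a using that by (auto simp: K_def)
    show "a \<otimes> b \<in> K" if "a \<in> K" "b \<in> K" for a b
      using that by (auto simp: K_def inv_mult_group intro: N_mult)
  qed
  \<comment> \<open>The complement of an open subgroup is a union of its left cosets, hence
    open.\<close>
  have "closedin X K"
  proof -
    have "carrier G - K = (\<Union>x\<in>carrier G - K. (\<lambda>k. x \<otimes> k) ` K)"
    proof (intro equalityI subsetI)
      fix y assume "y \<in> carrier G - K"
      then show "y \<in> (\<Union>x\<in>carrier G - K. (\<lambda>k. x \<otimes> k) ` K)"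
        using subgroup.one_closed[OF sK] by (auto intro!: bexI[of _ y] image_eqI[of _ _ "\<one>"])
    next
      fix y assume "y \<in> (\<Union>x\<in>carrier G - K. (\<lambda>k. x \<otimes> k) ` K)"
      then obtain x k where x: "x \<in> carrier G" "x \<notin> K" "k \<in> K" "y = x \<otimes> k" by auto
      then have k: "k \<in> carrier G" using sK by (simp add: subgroup.mem_carrier)
      have "x = y \<otimes> inv k" using x k by simp
      with x k show "y \<in> carrier G - K"
        using sK by (metis DiffI m_closed subgroup.m_closed subgroup.m_inv_closed)
    qed
    moreover have "openin X (\<Union>x\<in>carrier G - K. (\<lambda>k. x \<otimes> k) ` K)"
      using oK by (intro openin_Union) (auto intro: openin_left_translation)
    ultimately show ?thesis
      using openin_subset[OF oK] by (simp add: closedin_def)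
  qed
  then have "compact_open K"
    using C KC oK closed_compactin unfolding compact_open_def by blast
  with sK KC that show thesis by (simp add: compact_open_subgroup_def)
qed

end

text \<open>The form in which total disconnectedness is used from here on. For the overgroup this
  base is exhibited directly, so van Dantzig's theorem is applied to \<open>G\<close> alone.\<close>

locale td_group = top_group +
  assumes small_subgroup: "\<And>U. openin X U \<Longrightarrow> \<one> \<in> U \<Longrightarrow> \<exists>K. compact_open_subgroup K \<and> K \<subseteq> U"

text \<open>
  Van Dantzig: in a locally compact Hausdorff space the compact connected components can be
  separated from closed sets by clopen sets, so the identity has a compact open neighbourhood
  inside any given neighbourhood.
\<close>

lemma tdlc_group_imp_td_group:
  fixes G :: "('a, 'm) monoid_scheme" and X :: "'a topology"
  assumes "tdlc_group G X"
  shows "td_group G X"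
proof -
  have tg: "topological_group G X" and H: "Hausdorff_space X" and lc: "locally_compact_space X"
    and td: "totally_disconnected_space X"
    using assms by (auto simp: tdlc_group_def locally_compact_group_def)
  interpret group G using tg by (simp add: topological_group_def)
  interpret top_group G X by standard (use tg H in auto)
  show ?thesis
  proof
    fix U assume U: "openin X U" "\<one>\<^bsub>G\<^esub> \<in> U"
    obtain V C where V: "openin X V" "compactin X C" "\<one>\<^bsub>G\<^esub> \<in> V" "V \<subseteq> C"
      using lc unfolding locally_compact_space_def by (metis one_closed topspace_eq)
    \<comment> \<open>The component of the identity is a point, in particular compact, as the
      separation theorem below requires.\<close>
    have "connected_component_of_set X \<one>\<^bsub>G\<^esub> = {\<one>\<^bsub>G\<^esub>}"
    proof -
      have "connectedin X (connected_component_of_set X \<one>\<^bsub>G\<^esub>)"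
        by (rule connectedin_connected_component_of)
      then obtain a where "connected_component_of_set X \<one>\<^bsub>G\<^esub> \<subseteq> {a}"
        using td unfolding totally_disconnected_space_def by blast
      moreover have "\<one>\<^bsub>G\<^esub> \<in> connected_component_of_set X \<one>\<^bsub>G\<^esub>"
        by (simp add: connected_component_of_refl)
      ultimately show ?thesis by blast
    qed
    then have "{\<one>\<^bsub>G\<^esub>} \<in> connected_components_of X"
      by (metis connected_component_in_connected_components_of one_closed topspace_eq)
    moreover have "openin X (U \<inter> V)" using U V by blast
    ultimately obtain A B where AB: "openin X A" "openin X B" "disjnt A B"
        "A \<union> B = topspace X" "{\<one>\<^bsub>G\<^esub>} \<subseteq> A" "A \<subseteq> U \<inter> V"
      using wilder_locally_compact_component_thm[OF lc H, of "{\<one>\<^bsub>G\<^esub>}" "U \<inter> V"] U V by auto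
    have "topspace X - B = A" using AB by (auto simp: disjnt_def)
    then have "closedin X A" using AB(2) by (metis closedin_diff closedin_topspace)
    moreover have "A \<subseteq> C" using AB V by auto
    ultimately have "compact_open A"
      using AB(1) V(2) closed_compactin by (auto simp: compact_open_def)
    then show "\<exists>K. compact_open_subgroup K \<and> K \<subseteq> U"
      using compact_open_contains_subgroup AB(5,6) by (metis Int_subset_iff insert_subset subset_trans)
  qed
qed

section \<open>The Haar content on compact open sets\<close>

context top_group
begin

section \<open>Cosets and indices\<close>

definition left_cosets :: "'a set \<Rightarrow> 'a set \<Rightarrow> 'a set set" where
  "left_cosets L C = (\<lambda>c. (\<lambda>l. c \<otimes> l) ` L) ` C"

text \<open>For a subgroup \<open>L\<close> this means that \<open>C\<close> is a union of left
  cosets of \<open>L\<close>, so that counting cosets measures \<open>C\<close> exactly.\<close>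

definition right_invariant :: "'a set \<Rightarrow> 'a set \<Rightarrow> bool" where
  "right_invariant L C \<longleftrightarrow> (\<forall>c\<in>C. \<forall>l\<in>L. c \<otimes> l \<in> C)"

lemma left_coset_eq:
  assumes L: "subgroup L G" and c: "c \<in> carrier G" and d: "d \<in> (\<lambda>l. c \<otimes> l) ` L"
  shows "(\<lambda>l. d \<otimes> l) ` L = (\<lambda>l. c \<otimes> l) ` L"
proof -
  obtain l where l: "l \<in> L" "d = c \<otimes> l" using d by auto
  have lc: "\<And>m. m \<in> L \<Longrightarrow> m \<in> carrier G" using L by (simp add: subgroup.mem_carrier)
  show ?thesis
  proof (intro equalityI subsetI)
    fix x assume "x \<in> (\<lambda>l. d \<otimes> l) ` L"
    then obtain m where m: "m \<in> L" "x = d \<otimes> m" by auto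
    then have "x = c \<otimes> (l \<otimes> m)" using l c lc by (simp add: m_assoc)
    then show "x \<in> (\<lambda>l. c \<otimes> l) ` L" using L l m by (auto intro: subgroup.m_closed)
  next
    fix x assume "x \<in> (\<lambda>l. c \<otimes> l) ` L"
    then obtain m where m: "m \<in> L" "x = c \<otimes> m" by auto
    then have "x = d \<otimes> (inv l \<otimes> m)" using l c lc by (simp add: m_assoc)
    then show "x \<in> (\<lambda>l. d \<otimes> l) ` L" 
      using L l m by (auto intro: subgroup.m_closed subgroup.m_inv_closed)
  qed
qed

lemma mem_left_coset_self:
  "subgroup L G \<Longrightarrow> c \<in> carrier G \<Longrightarrow> c \<in> (\<lambda>l. c \<otimes> l) ` L"
  by (force simp: subgroup.one_closed intro: image_eqI[of _ _ \<one>])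

lemma left_cosets_disjoint:
  assumes "subgroup L G" "A \<in> left_cosets L (carrier G)" "B \<in> left_cosets L (carrier G)" "A \<inter> B \<noteq> {}"
  shows "A = B"
proof -
  obtain a b where ab: "a \<in> carrier G" "b \<in> carrier G" "A = (\<lambda>l. a \<otimes> l) ` L" "B = (\<lambda>l. b \<otimes> l) ` L"
    using assms(2,3) by (auto simp: left_cosets_def)
  obtain d where "d \<in> A" "d \<in> B" using assms(4) by auto
  then show ?thesis using left_coset_eq[OF assms(1) ab(1)] left_coset_eq[OF assms(1) ab(2)] ab by metis
qed

lemma left_cosets_mono: "C \<subseteq> D \<Longrightarrow> left_cosets L C \<subseteq> left_cosets L D"
  by (auto simp: left_cosets_def)

lemma Union_left_cosets:
  assumes "subgroup L G" "right_invariant L C" "C \<subseteq> carrier G"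
  shows "\<Union>(left_cosets L C) = C"
proof (intro equalityI subsetI)
  fix x assume "x \<in> C"
  then have "x \<in> (\<lambda>l. x \<otimes> l) ` L" "(\<lambda>l. x \<otimes> l) ` L \<in> left_cosets L C"
    using assms mem_left_coset_self by (auto simp: left_cosets_def)
  then show "x \<in> \<Union>(left_cosets L C)" by blast
qed (use assms in \<open>auto simp: left_cosets_def right_invariant_def\<close>)

text \<open>The cosets cover \<open>C\<close> by pairwise disjoint open sets, each of which meets
  \<open>C\<close>, so a finite subcover has to contain every one of them.\<close>

lemma finite_left_cosets:
  assumes C: "compactin X C" and L: "compact_open_subgroup L"
  shows "finite (left_cosets L C)"
proof -
  have CX: "C \<subseteq> carrier G" using C compactin_subset_topspace by fastforce
  have "openin X A" if "A \<in> left_cosets L C" for A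
    using that CX compact_open_subgroupD(4)[OF L] 
    by (auto simp: left_cosets_def intro!: openin_left_translation)
  moreover have "C \<subseteq> \<Union>(left_cosets L C)"
  proof
    fix x assume "x \<in> C"
    then have "x \<in> (\<lambda>l. x \<otimes> l) ` L" "(\<lambda>l. x \<otimes> l) ` L \<in> left_cosets L C"
      using mem_left_coset_self[OF compact_open_subgroupD(1)[OF L]] CX by (auto simp: left_cosets_def)
    then show "x \<in> \<Union>(left_cosets L C)" by blast
  qed
  ultimately obtain F where F: "finite F" "F \<subseteq> left_cosets L C" "C \<subseteq> \<Union>F"
    using compactinD[OF C] by metis
  have "left_cosets L C \<subseteq> F"
  proof
    fix A assume A: "A \<in> left_cosets L C"
    then obtain c where c: "c \<in> C" "A = (\<lambda>l. c \<otimes> l) ` L" by (auto simp: left_cosets_def)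
    then obtain B where B: "B \<in> F" "c \<in> B" using F by auto
    have "c \<in> A" using c CX mem_left_coset_self[OF compact_open_subgroupD(1)[OF L]] by auto
    then have "A = B" 
      using left_cosets_disjoint[OF compact_open_subgroupD(1)[OF L], of A B] A B F CX
        left_cosets_mono[OF CX] by blast
    then show "A \<in> F" using B by simp
  qed
  then show ?thesis using F finite_subset by blast
qed

lemma left_cosets_translate:
  assumes "a \<in> carrier G" "C \<subseteq> carrier G" "L \<subseteq> carrier G"
  shows "left_cosets L ((\<lambda>x. a \<otimes> x) ` C) = (\<lambda>B. (\<lambda>x. a \<otimes> x) ` B) ` left_cosets L C"
proof -
  have "(\<lambda>l. a \<otimes> c \<otimes> l) ` L = (\<lambda>x. a \<otimes> x) ` (\<lambda>l. c \<otimes> l) ` L" if "c \<in> C" for c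
  proof -
    have "a \<otimes> c \<otimes> l = a \<otimes> (c \<otimes> l)" if "l \<in> L" for l
      using that \<open>c \<in> C\<close> assms by (intro m_assoc) auto
    then show ?thesis by (simp add: image_image cong: image_cong_simp)
  qed
  then show ?thesis unfolding left_cosets_def image_image by (rule image_cong[OF refl])
qed

lemma inj_on_left_translation: "a \<in> carrier G \<Longrightarrow> inj_on (\<lambda>x. a \<otimes> x) (carrier G)"
  by (auto simp: inj_on_def)

lemma card_left_cosets_translate:
  assumes "a \<in> carrier G" "C \<subseteq> carrier G" "L \<subseteq> carrier G"
  shows "card (left_cosets L ((\<lambda>x. a \<otimes> x) ` C)) = card (left_cosets L C)"
proof -
  have "left_cosets L C \<subseteq> Pow (carrier G)"
    using assms by (auto simp: left_cosets_def)
  then have "inj_on (\<lambda>B. (\<lambda>x. a \<otimes> x) ` B) (left_cosets L C)"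
    using inj_on_image_Pow[OF inj_on_left_translation[OF assms(1)]] inj_on_subset by blast
  then show ?thesis using left_cosets_translate[OF assms] by (simp add: card_image)
qed

text \<open>Each left coset of \<open>L\<close> in \<open>C\<close> is a translate of
  \<open>L\<close>, so all of them split into the same number of cosets of
  \<open>L'\<close>.\<close>

lemma card_left_cosets_refine:
  assumes C: "compactin X C" and inv: "right_invariant L C" 
    and L: "compact_open_subgroup L" and L': "compact_open_subgroup L'" "L' \<subseteq> L"
  shows "card (left_cosets L' C) = card (left_cosets L C) * card (left_cosets L' L)"
proof -
  note sL = compact_open_subgroupD(1)[OF L] and sL' = compact_open_subgroupD(1)[OF L'(1)]
  have CX: "C \<subseteq> carrier G" using C compactin_subset_topspace by fastforce
  have un: "\<Union>(left_cosets L C) = C" using Union_left_cosets[OF sL inv CX] .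
  have "left_cosets L' C = \<Union>(left_cosets L' ` left_cosets L C)"
    by (subst un[symmetric]) (simp add: left_cosets_def image_UN image_Union image_image)
  also have "card \<dots> = (\<Sum>A\<in>left_cosets L C. card (left_cosets L' A))"
  proof (rule card_UN_disjoint)
    show "finite (left_cosets L C)" by (rule finite_left_cosets[OF C L])
    show "\<forall>A\<in>left_cosets L C. finite (left_cosets L' A)"
      using finite_left_cosets[OF C L'(1)] un left_cosets_mono by (metis Sup_upper finite_subset)
    have sub: "B \<subseteq> A" "B \<noteq> {}" if A: "A \<in> left_cosets L C" and B: "B \<in> left_cosets L' A" for A B
    proof -
      obtain c where c: "c \<in> C" "A = (\<lambda>l. c \<otimes> l) ` L" using A by (auto simp: left_cosets_def)
      obtain b where b: "b \<in> A" "B = (\<lambda>l. b \<otimes> l) ` L'" using B by (auto simp: left_cosets_def)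
      have "(\<lambda>l. b \<otimes> l) ` L = A" using left_coset_eq[OF sL, of c b] b(1) c CX by blast
      then show "B \<subseteq> A" using b(2) L'(2) by blast
      show "B \<noteq> {}" using b subgroup.one_closed[OF sL'] by auto
    qed
    show "\<forall>A\<in>left_cosets L C. \<forall>A'\<in>left_cosets L C. A \<noteq> A' \<longrightarrow> left_cosets L' A \<inter> left_cosets L' A' = {}"
    proof (intro ballI impI, rule ccontr)
      fix A A' assume A: "A \<in> left_cosets L C" "A' \<in> left_cosets L C" "A \<noteq> A'"
        and "left_cosets L' A \<inter> left_cosets L' A' \<noteq> {}"
      then obtain B where "B \<in> left_cosets L' A" "B \<in> left_cosets L' A'" by auto
      then have "A \<inter> A' \<noteq> {}" using sub A by blast
      then show False using left_cosets_disjoint[OF sL] left_cosets_mono[OF CX] A by blast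
    qed
  qed
  also have "\<dots> = (\<Sum>A\<in>left_cosets L C. card (left_cosets L' L))"
  proof (rule sum.cong[OF refl])
    fix A assume "A \<in> left_cosets L C"
    then obtain c where c: "c \<in> C" "A = (\<lambda>l. c \<otimes> l) ` L" by (auto simp: left_cosets_def)
    then show "card (left_cosets L' A) = card (left_cosets L' L)"
      using card_left_cosets_translate[of c L L'] CX compact_open_subgroupD(3) L L' by auto
  qed
  finally show ?thesis by simp
qed

end

context td_group
begin

text \<open>The elements mapping \<open>C\<close> into itself from the right form an open
  neighbourhood of the identity. The bound \<open>L0\<close> allows adapting to several sets in
  succession.\<close>

lemma exists_adapted_subgroup:
  assumes C: "compact_open C" and L0: "compact_open_subgroup L0"
  obtains L where "compact_open_subgroup L" "right_invariant L C" "L \<subseteq> L0"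
proof -
  let ?U = "{g \<in> carrier G. \<forall>c\<in>C. c \<otimes> g \<in> C} \<inter> L0"
  have "openin X ?U"
    using openin_right_stabiliser[OF C] compact_open_subgroupD(4)[OF L0] by blast
  moreover have "\<one> \<in> ?U" 
    using compact_open_subset[OF C] compact_open_subgroupD(6)[OF L0] by auto
  ultimately obtain L where L: "compact_open_subgroup L" "L \<subseteq> ?U" using small_subgroup by blast
  then have "right_invariant L C" by (auto simp: right_invariant_def)
  with L that show thesis by blast
qed

section \<open>The content, normalised on a fixed compact open subgroup\<close>

definition base_subgroup :: "'a set" where
  "base_subgroup = (SOME K. compact_open_subgroup K)"

lemma base_subgroup: "compact_open_subgroup base_subgroup"
  unfolding base_subgroup_def
  using small_subgroup[OF openin_topspace] by (metis one_closed someI_ex topspace_eq)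

definition content :: "'a set \<Rightarrow> real" where
  "content C = (let L = SOME L. compact_open_subgroup L \<and> right_invariant L C \<and> L \<subseteq> base_subgroup
     in card (left_cosets L C) / card (left_cosets L base_subgroup))"

lemma left_cosets_nonempty: "C \<noteq> {} \<Longrightarrow> left_cosets L C \<noteq> {}"
  by (simp add: left_cosets_def)

lemma card_left_cosets_pos:
  assumes "compactin X C" "compact_open_subgroup L" "C \<noteq> {}"
  shows "card (left_cosets L C) > 0"
  using assms by (simp add: card_gt_0_iff finite_left_cosets left_cosets_nonempty)

lemma right_invariant_subgroup: "compact_open_subgroup K \<Longrightarrow> L \<subseteq> K \<Longrightarrow> right_invariant L K"
  by (auto simp: right_invariant_def compact_open_subgroupD(7))

text \<open>Two admissible subgroups are compared through their intersection: passing from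
  \<open>N\<close> to \<open>M \<inter> L\<close> multiplies both counts by the same index, so the
  quotient does not depend on the subgroup chosen in the definition.\<close>

lemma content_eq:
  assumes C: "compact_open C" and L: "compact_open_subgroup L" "right_invariant L C" "L \<subseteq> base_subgroup"
  shows "content C = card (left_cosets L C) / card (left_cosets L base_subgroup)"
proof -
  let ?P = "\<lambda>L. compact_open_subgroup L \<and> right_invariant L C \<and> L \<subseteq> base_subgroup"
  define M where "M = (SOME L. ?P L)"
  have M: "?P M" unfolding M_def using exists_adapted_subgroup[OF C base_subgroup] by (metis (mono_tags, lifting) someI)
  have *: "card (left_cosets (M \<inter> L) C) / card (left_cosets (M \<inter> L) base_subgroup)
      = card (left_cosets N C) / card (left_cosets N base_subgroup)" if N: "?P N" "M \<inter> L \<subseteq> N" for N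
  proof -
    have I: "compact_open_subgroup (M \<inter> L)" using M L by (simp add: compact_open_subgroup_Int)
    have "card (left_cosets (M \<inter> L) C) = card (left_cosets N C) * card (left_cosets (M \<inter> L) N)"
      using C N I by (intro card_left_cosets_refine) (auto simp: compact_open_def)
    moreover have "card (left_cosets (M \<inter> L) base_subgroup) = 
        card (left_cosets N base_subgroup) * card (left_cosets (M \<inter> L) N)"
      using compact_open_subgroupD(5)[OF base_subgroup] N I base_subgroup right_invariant_subgroup
      by (intro card_left_cosets_refine) auto
    moreover have "card (left_cosets (M \<inter> L) N) > 0"
      using N I compact_open_subgroupD(5,6) by (intro card_left_cosets_pos) auto
    ultimately show ?thesis by simp
  qed
  show ?thesis
    using *[OF M] *[of L] L by (simp add: content_def M_def[symmetric] Let_def)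
qed

lemma content_nonneg [simp]: "content C \<ge> 0"
  by (simp add: content_def Let_def)

lemma content_empty [simp]: "content {} = 0"
  by (simp add: content_def Let_def left_cosets_def)

text \<open>Adapting twice gives one subgroup for both sets. Disjoint sets then share no coset, and
  the numbers of cosets add.\<close>

lemma content_Un:
  assumes C: "compact_open C" and D: "compact_open D" and disj: "C \<inter> D = {}"
  shows "content (C \<union> D) = content C + content D"
proof -
  obtain L1 where L1: "compact_open_subgroup L1" "right_invariant L1 C" "L1 \<subseteq> base_subgroup"
    using exists_adapted_subgroup[OF C base_subgroup] .
  obtain L where L: "compact_open_subgroup L" "right_invariant L D" "L \<subseteq> L1"
    using exists_adapted_subgroup[OF D L1(1)] .
  have inv: "right_invariant L C" "right_invariant L (C \<union> D)" "L \<subseteq> base_subgroup"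
    using L L1 by (auto simp: right_invariant_def)
  have "left_cosets L C \<inter> left_cosets L D = {}"
  proof (rule ccontr)
    note sL = compact_open_subgroupD(1)[OF L(1)]
    assume "left_cosets L C \<inter> left_cosets L D \<noteq> {}"
    then obtain A where A: "A \<in> left_cosets L C" "A \<in> left_cosets L D" by auto
    then have "A \<subseteq> C" "A \<subseteq> D" 
      using Union_left_cosets[OF sL] inv L C D compact_open_subset by (metis Sup_upper)+
    moreover have "A \<noteq> {}" using A(1) subgroup.one_closed[OF sL] by (auto simp: left_cosets_def)
    ultimately show False using disj by blast
  qed
  moreover have "left_cosets L (C \<union> D) = left_cosets L C \<union> left_cosets L D"
    by (auto simp: left_cosets_def)
  ultimately have "card (left_cosets L (C \<union> D)) = card (left_cosets L C) + card (left_cosets L D)"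
    using C D L(1) by (simp add: card_Un_disjoint finite_left_cosets compact_open_def)
  then show ?thesis
    using content_eq[OF C L(1) inv(1,3)] content_eq[OF D L(1,2) inv(3)]
      content_eq[OF compact_open_Un[OF C D] L(1) inv(2,3)]
    by (simp add: add_divide_distrib)
qed

lemma content_mono:
  assumes "compact_open C" "compact_open D" "C \<subseteq> D"
  shows "content C \<le> content D"
proof -
  have "content D = content (C \<union> (D - C))" using assms(3) by (simp add: Un_absorb1)
  also have "\<dots> = content C + content (D - C)"
    using assms by (intro content_Un) (auto intro: compact_open_Diff)
  finally show ?thesis by simp
qed

lemma content_Un_le:
  assumes "compact_open C" "compact_open D"
  shows "content (C \<union> D) \<le> content C + content D"
proof -
  have "content (C \<union> D) = content (C \<union> (D - C))" by simp
  also have "\<dots> = content C + content (D - C)"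
    using assms by (intro content_Un) (auto intro: compact_open_Diff)
  also have "\<dots> \<le> content C + content D"
    using assms by (intro add_left_mono content_mono) (auto intro: compact_open_Diff)
  finally show ?thesis .
qed

lemma content_UN_le:
  assumes "finite I" "\<And>i. i \<in> I \<Longrightarrow> compact_open (F i)"
  shows "content (\<Union>i\<in>I. F i) \<le> (\<Sum>i\<in>I. content (F i))"
  using assms
proof (induction I rule: finite_induct)
  case (insert i I)
  have "content (\<Union>i\<in>insert i I. F i) \<le> content (F i) + content (\<Union>i\<in>I. F i)"
    using insert by (auto intro!: content_Un_le compact_open_UN)
  with insert show ?case by force
qed simp

lemma content_left_translation:
  assumes a: "a \<in> carrier G" and C: "compact_open C"
  shows "content ((\<lambda>x. a \<otimes> x) ` C) = content C"
proof -
  obtain L where L: "compact_open_subgroup L" "right_invariant L C" "L \<subseteq> base_subgroup"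
    using exists_adapted_subgroup[OF C base_subgroup] .
  have CX: "C \<subseteq> carrier G" and LX: "L \<subseteq> carrier G"
    using compact_open_subset[OF C] compact_open_subgroupD(3)[OF L(1)] by auto
  have "right_invariant L ((\<lambda>x. a \<otimes> x) ` C)"
    unfolding right_invariant_def
  proof (intro ballI)
    fix c l assume "c \<in> (\<lambda>x. a \<otimes> x) ` C" "l \<in> L"
    then obtain d where d: "d \<in> C" "c = a \<otimes> d" by auto
    then have "c \<otimes> l = a \<otimes> (d \<otimes> l)" using a CX LX \<open>l \<in> L\<close> by (auto intro: m_assoc)
    then show "c \<otimes> l \<in> (\<lambda>x. a \<otimes> x) ` C" using L(2) d \<open>l \<in> L\<close> by (auto simp: right_invariant_def)
  qed
  then show ?thesis
    using content_eq[OF C L] content_eq[OF compact_open_left_translation[OF a C] L(1) _ L(3)]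
      card_left_cosets_translate[OF a CX LX] by simp
qed

lemma content_pos:
  assumes "compact_open C" "C \<noteq> {}" shows "content C > 0"
proof -
  obtain L where L: "compact_open_subgroup L" "right_invariant L C" "L \<subseteq> base_subgroup"
    using exists_adapted_subgroup[OF assms(1) base_subgroup] .
  have "card (left_cosets L C) > 0"
    using assms L by (intro card_left_cosets_pos) (auto simp: compact_open_def)
  moreover have "card (left_cosets L base_subgroup) > 0"
    using L compact_open_subgroupD(5,6)[OF base_subgroup] by (intro card_left_cosets_pos) auto
  ultimately
  show ?thesis using content_eq[OF assms(1) L] by simp
qed

lemma content_base_subgroup: "content base_subgroup = 1"
proof -
  have "card (left_cosets base_subgroup base_subgroup) > 0"
    using base_subgroup compact_open_subgroupD(5,6)[OF base_subgroup]
    by (intro card_left_cosets_pos) auto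
  then show ?thesis
    using content_eq[OF compact_open_subgroupD(2)[OF base_subgroup] base_subgroup 
      right_invariant_subgroup[OF base_subgroup] order_refl] by simp
qed

text \<open>An additive set function with a common value on all left cosets of \<open>L\<close> is
  determined by counting. This takes the place of uniqueness of Haar measure; it is applied to the
  content itself and to the content composed with right translation and with inversion.\<close>

lemma additive_eq_card_left_cosets:
  fixes F :: "'a set \<Rightarrow> real" and r :: real
  assumes C: "compact_open C" and L: "compact_open_subgroup L" "right_invariant L C"
    and empty: "F {} = 0"
    and add: "\<And>A B. compact_open A \<Longrightarrow> compact_open B \<Longrightarrow> A \<inter> B = {} \<Longrightarrow> A \<union> B \<subseteq> C \<Longrightarrow> F (A \<union> B) = F A + F B"
    and coset: "\<And>c. c \<in> C \<Longrightarrow> F ((\<lambda>l. c \<otimes> l) ` L) = r"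
  shows "F C = card (left_cosets L C) * r"
proof -
  note sL = compact_open_subgroupD(1)[OF L(1)]
  have CX: "C \<subseteq> carrier G" by (rule compact_open_subset[OF C])
  have un: "\<Union>(left_cosets L C) = C" using Union_left_cosets[OF sL L(2) CX] .
  have co: "compact_open A" if "A \<in> left_cosets L C" for A
    using that CX compact_open_subgroupD(2)[OF L(1)]
    by (auto simp: left_cosets_def intro!: compact_open_left_translation)
  have "F (\<Union>S) = card S * r" if "S \<subseteq> left_cosets L C" for S
  proof -
    have "finite S" using that finite_left_cosets C L(1) unfolding compact_open_def by (metis finite_subset)
    then show ?thesis using that
    proof (induction S rule: finite_induct)
      case (insert A S)
      have "A \<inter> \<Union>S = {}"
      proof (rule ccontr)
        assume "A \<inter> \<Union>S \<noteq> {}"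
        then obtain B where B: "B \<in> S" "A \<inter> B \<noteq> {}" by auto
        then have "A = B" 
          using left_cosets_disjoint[OF sL] left_cosets_mono[OF CX] insert.prems by blast
        then show False using B insert by auto
      qed
      moreover have "compact_open (\<Union>S)" 
        using insert co compact_open_UN[of S "\<lambda>x. x"] by auto
      moreover have "A \<union> \<Union>S \<subseteq> C" using un insert.prems by auto
      ultimately have "F (A \<union> \<Union>S) = F A + F (\<Union>S)" using add co insert.prems by auto
      moreover have "F A = r" using insert.prems coset by (auto simp: left_cosets_def)
      ultimately show ?case using insert by (simp add: algebra_simps)
    qed (simp add: empty)
  qed
  then show ?thesis using un by force
qed

section \<open>The modular function\<close>

definition modular :: "'a \<Rightarrow> real" where
  "modular x = content ((\<lambda>y. y \<otimes> x) ` base_subgroup)"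

lemma modular_pos: "x \<in> carrier G \<Longrightarrow> modular x > 0"
  unfolding modular_def using base_subgroup compact_open_subgroupD(2,6)
  by (intro content_pos compact_open_right_translation) auto

lemma inj_on_right_translation: "a \<in> carrier G \<Longrightarrow> inj_on (\<lambda>x. x \<otimes> a) (carrier G)"
  by (auto simp: inj_on_def)

text \<open>Right translations commute with left ones, so the content of translates is again
  additive and left invariant, hence proportional to the content. Evaluation at
  \<open>base_subgroup\<close> identifies the factor.\<close>

lemma content_right_translation:
  assumes x: "x \<in> carrier G" and C: "compact_open C"
  shows "content ((\<lambda>y. y \<otimes> x) ` C) = modular x * content C"
proof -
  obtain L where L: "compact_open_subgroup L" "right_invariant L C" "L \<subseteq> base_subgroup"
    using exists_adapted_subgroup[OF C base_subgroup] .
  note LX = compact_open_subgroupD(3)[OF L(1)]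
  let ?F = "\<lambda>A. content ((\<lambda>y. y \<otimes> x) ` A)"
  have F: "?F D = card (left_cosets L D) * ?F L" if D: "compact_open D" "right_invariant L D" for D
  proof (rule additive_eq_card_left_cosets[OF D(1) L(1) D(2), where F = ?F])
    fix A B assume AB: "compact_open A" "compact_open B" "A \<inter> B = {}"
    have "(\<lambda>y. y \<otimes> x) ` A \<inter> (\<lambda>y. y \<otimes> x) ` B = (\<lambda>y. y \<otimes> x) ` (A \<inter> B)"
      using inj_on_image_Int[OF inj_on_right_translation[OF x]] AB(1,2) compact_open_subset by metis
    then show "?F (A \<union> B) = ?F A + ?F B"
      using AB x by (simp add: image_Un content_Un compact_open_right_translation)
  next
    fix c assume "c \<in> D"
    then have c: "c \<in> carrier G" using compact_open_subset[OF D(1)] by auto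
    have "(\<lambda>y. y \<otimes> x) ` (\<lambda>l. c \<otimes> l) ` L = (\<lambda>l. c \<otimes> l) ` (\<lambda>y. y \<otimes> x) ` L"
      using c x LX by (auto simp: image_image m_assoc subset_iff cong: image_cong_simp)
    then show "?F ((\<lambda>l. c \<otimes> l) ` L) = ?F L"
      using content_left_translation[OF c compact_open_right_translation[OF x compact_open_subgroupD(2)[OF L(1)]]]
      by simp
  qed simp
  have "?F base_subgroup = card (left_cosets L base_subgroup) * ?F L"
    using F compact_open_subgroupD(2)[OF base_subgroup] right_invariant_subgroup[OF base_subgroup L(3)] by blast
  moreover have "card (left_cosets L base_subgroup) > 0"
    using base_subgroup compact_open_subgroupD(5,6)[OF base_subgroup] L by (intro card_left_cosets_pos) auto
  ultimately show ?thesis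
    using F[OF C L(2)] content_eq[OF C L] by (simp add: modular_def field_simps)
qed

lemma modular_mult:
  assumes "x \<in> carrier G" "y \<in> carrier G"
  shows "modular (x \<otimes> y) = modular x * modular y"
proof -
  have "(\<lambda>z. z \<otimes> (x \<otimes> y)) ` base_subgroup = (\<lambda>z. z \<otimes> y) ` (\<lambda>z. z \<otimes> x) ` base_subgroup"
    using assms compact_open_subgroupD(3)[OF base_subgroup] 
    by (auto simp: image_image m_assoc subset_iff cong: image_cong_simp)
  moreover have "compact_open ((\<lambda>z. z \<otimes> x) ` base_subgroup)"
    using assms(1) compact_open_right_translation compact_open_subgroupD(2)[OF base_subgroup] by blast
  ultimately show ?thesis
    using content_right_translation[OF assms(2)] by (simp add: modular_def)
qed

text \<open>Right translation by \<open>k\<close> maps \<open>K\<close> onto itself, and the content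
  of \<open>K\<close> is positive.\<close>

lemma modular_compact_open_subgroup:
  assumes K: "compact_open_subgroup K" and k: "k \<in> K"
  shows "modular k = 1"
proof -
  have "(\<lambda>y. y \<otimes> k) ` K = K"
  proof (intro equalityI subsetI)
    fix z assume "z \<in> K"
    then have "z = z \<otimes> inv k \<otimes> k" "z \<otimes> inv k \<in> K" 
      using k compact_open_subgroupD[OF K] by auto
    then show "z \<in> (\<lambda>y. y \<otimes> k) ` K" by blast
  qed (use k compact_open_subgroupD(7)[OF K] in auto)
  then have "content K = modular k * content K"
    using content_right_translation[OF compact_open_subgroupD(9)[OF K k] compact_open_subgroupD(2)[OF K]] by simp
  moreover have "content K > 0" using compact_open_subgroupD(2,6)[OF K] by (intro content_pos) auto
  ultimately show ?thesis by simp
qed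

lemma inv_image_subgroup:
  assumes K: "compact_open_subgroup K" shows "(\<lambda>x. inv x) ` K = K"
proof (intro equalityI subsetI)
  fix x assume "x \<in> K"
  then have "x = inv (inv x)" "inv x \<in> K" using compact_open_subgroupD(8,9)[OF K] by auto
  then show "x \<in> (\<lambda>x. inv x) ` K" by blast
qed (use compact_open_subgroupD(8)[OF K] in auto)

text \<open>Inversion distorts the content by modular factors, which are 1 inside the compact open
  subgroup \<open>K\<close>; only \<open>modular x\<close> is left. This is the source of the
  substitution z = inv y x in convolution integrals over \<open>K\<close>.\<close>

lemma content_inverse_translation:
  assumes x: "x \<in> carrier G" and K: "compact_open_subgroup K" and C: "compact_open C" "C \<subseteq> K"
  shows "content ((\<lambda>y. inv y \<otimes> x) ` C) = modular x * content C"
proof -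
  obtain L1 where L1: "compact_open_subgroup L1" "right_invariant L1 C" "L1 \<subseteq> base_subgroup"
    using exists_adapted_subgroup[OF C(1) base_subgroup] .
  let ?L = "L1 \<inter> K"
  have L: "compact_open_subgroup ?L" "right_invariant ?L C"
    using L1 K by (auto simp: compact_open_subgroup_Int right_invariant_def)
  note sL = compact_open_subgroupD(1)[OF L(1)]
  let ?F = "\<lambda>A. content ((\<lambda>y. inv y \<otimes> x) ` A)"
  have inv_co: "compact_open ((\<lambda>y. inv y \<otimes> x) ` A)" if "compact_open A" for A
    using compact_open_right_translation[OF x compact_open_inv_image[OF that]] by (simp add: image_image)
  have inj: "inj_on (\<lambda>y. inv y \<otimes> x) (carrier G)" using x by (auto simp: inj_on_def) (metis inv_inv)
  have "?F C = card (left_cosets ?L C) * (modular x * content ?L)"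
  proof (rule additive_eq_card_left_cosets[OF C(1) L, where F = ?F])
    fix A B assume AB: "compact_open A" "compact_open B" "A \<inter> B = {}"
    have "(\<lambda>y. inv y \<otimes> x) ` A \<inter> (\<lambda>y. inv y \<otimes> x) ` B = (\<lambda>y. inv y \<otimes> x) ` (A \<inter> B)"
      using inj_on_image_Int[OF inj] AB(1,2) compact_open_subset by metis
    then show "?F (A \<union> B) = ?F A + ?F B"
      using AB x by (simp add: image_Un content_Un inv_co)
  next
    fix c assume c: "c \<in> C"
    then have cG: "c \<in> carrier G" "c \<in> K" using compact_open_subset[OF C(1)] C(2) by auto
    \<comment> \<open>The left coset of \<open>c\<close> becomes a right coset of
      \<open>inv c \<otimes> x\<close>, since \<open>?L\<close> is closed under inversion.\<close>
    have "(\<lambda>y. inv y \<otimes> x) ` (\<lambda>l. c \<otimes> l) ` ?L = (\<lambda>y. y \<otimes> (inv c \<otimes> x)) ` (\<lambda>l. inv l) ` ?L"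
      using cG x compact_open_subgroupD(9)[OF K]
      by (auto simp: image_image m_assoc inv_mult_group cong: image_cong_simp)
    also have "(\<lambda>l. inv l) ` ?L = ?L"
      by (rule inv_image_subgroup[OF L(1)])
    finally have "?F ((\<lambda>l. c \<otimes> l) ` ?L) = modular (inv c \<otimes> x) * content ?L"
      using content_right_translation[OF _ compact_open_subgroupD(2)[OF L(1)], of "inv c \<otimes> x"] cG x by simp
    then show "?F ((\<lambda>l. c \<otimes> l) ` ?L) = modular x * content ?L"
      using modular_mult modular_compact_open_subgroup[OF K] cG x compact_open_subgroupD(8)[OF K] by simp
  qed simp
  moreover have "content C = card (left_cosets ?L C) * content ?L"
    using content_left_translation[OF _ compact_open_subgroupD(2)[OF L(1)]] compact_open_subset[OF C(1)]
    by (intro additive_eq_card_left_cosets[OF C(1) L, where F = content]) (auto intro: content_Un)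
  ultimately show ?thesis by simp
qed

end

section \<open>Haar measure\<close>

context td_group
begin

text \<open>Cosets of small subgroups form a base of compact open sets, and finitely many of those
  inside \<open>U\<close> cover \<open>K\<close>.\<close>

lemma compact_subset_compact_open:
  assumes K: "compactin X K" and U: "openin X U" "K \<subseteq> U"
  obtains C where "compact_open C" "K \<subseteq> C" "C \<subseteq> U"
proof -
  have UX: "U \<subseteq> carrier G" using openin_subset[OF U(1)] by simp
  have "\<exists>C. compact_open C \<and> x \<in> C \<and> C \<subseteq> U" if x: "x \<in> U" for x
  proof -
    have xG: "x \<in> carrier G" using x UX by auto
    have "\<one> \<in> (\<lambda>y. inv x \<otimes> y) ` U" using x xG by (force intro: image_eqI[of _ _ x])
    then obtain L where L: "compact_open_subgroup L" "L \<subseteq> (\<lambda>y. inv x \<otimes> y) ` U"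
      using small_subgroup[OF openin_left_translation[OF _ U(1)], of "inv x"] xG by auto
    have "x \<otimes> y \<in> U" if yL: "y \<in> L" for y
    proof -
      obtain u where "u \<in> U" "y = inv x \<otimes> u" using L(2) yL by blast
      then show ?thesis using xG UX by auto
    qed
    then have "(\<lambda>y. x \<otimes> y) ` L \<subseteq> U" by blast
    then show ?thesis
      using compact_open_left_translation[OF xG compact_open_subgroupD(2)[OF L(1)]] 
        mem_left_coset_self[OF compact_open_subgroupD(1)[OF L(1)] xG] by blast
  qed
  then obtain C where C: "\<And>x. x \<in> U \<Longrightarrow> compact_open (C x) \<and> x \<in> C x \<and> C x \<subseteq> U" by metis
  have "K \<subseteq> \<Union>(C ` K)" using C U(2) by blast
  moreover have "openin X V" if "V \<in> C ` K" for V
    using that C U(2) compact_open_imp_open by blast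
  ultimately obtain F where F: "finite F" "F \<subseteq> C ` K" "K \<subseteq> \<Union>F"
    using compactinD[OF K, of "C ` K"] by metis
  have *: "compact_open V \<and> V \<subseteq> U" if "V \<in> F" for V
    using that F(2) C U(2) by blast
  have "compact_open (\<Union>V\<in>F. V)" by (rule compact_open_UN[OF F(1)]) (use * in blast)
  then have "compact_open (\<Union>F)" by simp
  moreover have "\<Union>F \<subseteq> U" using * by blast
  ultimately show thesis by (rule that[OF _ F(3)])
qed

section \<open>Extension of the content to a Borel measure\<close>

definition open_content :: "'a set \<Rightarrow> ennreal" where
  "open_content U = (SUP C\<in>{C. compact_open C \<and> C \<subseteq> U}. ennreal (content C))"

definition outer_content :: "'a set \<Rightarrow> ennreal" where
  "outer_content A = (INF U\<in>{U. openin X U \<and> A \<subseteq> U}. open_content U)"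

lemma open_content_mono: "U \<subseteq> V \<Longrightarrow> open_content U \<le> open_content V"
  unfolding open_content_def by (rule SUP_subset_mono) auto

lemma content_le_open_content: "compact_open C \<Longrightarrow> C \<subseteq> U \<Longrightarrow> ennreal (content C) \<le> open_content U"
  unfolding open_content_def by (rule SUP_upper) auto

lemma outer_content_open: "openin X U \<Longrightarrow> outer_content U = open_content U"
  unfolding outer_content_def by (rule antisym) (auto intro!: INF_lower INF_greatest open_content_mono)

lemma outer_content_mono: "A \<subseteq> B \<Longrightarrow> outer_content A \<le> outer_content B"
  unfolding outer_content_def by (rule INF_superset_mono) auto

lemma open_content_compact_open: "compact_open C \<Longrightarrow> open_content C = ennreal (content C)"
  unfolding open_content_def
  by (rule antisym) (auto intro!: SUP_upper SUP_least ennreal_leI content_mono)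

lemma outer_content_compact_open: "compact_open C \<Longrightarrow> outer_content C = ennreal (content C)"
  by (simp add: outer_content_open compact_open_imp_open open_content_compact_open)

text \<open>By compactness, a compact open set inside the union is covered by finitely many compact
  open pieces, each inside a single \<open>U i\<close>.\<close>

lemma open_content_UN_le:
  fixes U :: "nat \<Rightarrow> 'a set"
  assumes U: "\<And>i. openin X (U i)"
  shows "open_content (\<Union>i. U i) \<le> (\<Sum>i. open_content (U i))"
  unfolding open_content_def[of "\<Union>i. U i"]
proof (rule SUP_least)
  fix C assume "C \<in> {C. compact_open C \<and> C \<subseteq> (\<Union>i. U i)}"
  then have C: "compact_open C" "C \<subseteq> (\<Union>i. U i)" by auto
  have "\<exists>i D. compact_open D \<and> x \<in> D \<and> D \<subseteq> U i" if xC: "x \<in> C" for x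
  proof -
    obtain i where i: "x \<in> U i" using C(2) xC by blast
    have "compactin X {x}" using xC compact_open_subset[OF C(1)] by auto
    then obtain D where "compact_open D" "{x} \<subseteq> D" "D \<subseteq> U i"
      using compact_subset_compact_open[OF _ U] i by blast
    then show ?thesis by auto
  qed
  then obtain i D where D: "\<And>x. x \<in> C \<Longrightarrow> compact_open (D x) \<and> x \<in> D x \<and> D x \<subseteq> U (i x)" by metis
  have "\<exists>F. finite F \<and> F \<subseteq> D ` C \<and> C \<subseteq> \<Union>F"
    using D C(1) by (intro compactinD[of X C]) (auto simp: compact_open_def)
  then obtain F where F: "finite F" "F \<subseteq> C" "C \<subseteq> \<Union>(D ` F)"
    by (metis finite_subset_image)
  \<comment> \<open>Pieces lying in the same \<open>U j\<close> are merged, since the series on the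
    right counts every index only once.\<close>
  define E where "E j = (\<Union>x\<in>{x\<in>F. i x = j}. D x)" for j
  have E: "compact_open (E j)" "E j \<subseteq> U j" for j
    unfolding E_def using F D by (auto intro!: compact_open_UN)
  have J: "finite (i ` F)" using F(1) by simp
  have "C \<subseteq> (\<Union>j\<in>i ` F. E j)" using F(3) unfolding E_def by blast
  then have "content C \<le> content (\<Union>j\<in>i ` F. E j)"
    using C(1) E(1) J by (intro content_mono compact_open_UN)
  also have "\<dots> \<le> (\<Sum>j\<in>i ` F. content (E j))" by (rule content_UN_le[OF J E(1)])
  finally have "ennreal (content C) \<le> (\<Sum>j\<in>i ` F. ennreal (content (E j)))"
    by (simp add: sum_ennreal ennreal_leI)
  also have "\<dots> \<le> (\<Sum>j\<in>i ` F. open_content (U j))"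
    using E by (intro sum_mono content_le_open_content)
  also have "\<dots> \<le> (\<Sum>j. open_content (U j))"
    by (rule sum_le_suminf) (use J in auto)
  finally show "ennreal (content C) \<le> (\<Sum>j. open_content (U j))" .
qed

lemma outer_measure_space_outer_content: "outer_measure_space (Pow (carrier G)) outer_content"
  unfolding outer_measure_space_def
proof (intro conjI)
  show "positive (Pow (carrier G)) outer_content"
    by (simp add: positive_def outer_content_compact_open)
  show "increasing (Pow (carrier G)) outer_content"
    by (simp add: increasing_def outer_content_mono)
  show "countably_subadditive (Pow (carrier G)) outer_content"
    unfolding countably_subadditive_def
  proof (intro allI impI)
    fix A :: "nat \<Rightarrow> 'a set"
    assume A: "range A \<subseteq> Pow (carrier G)"
    show "outer_content (\<Union>i. A i) \<le> (\<Sum>i. outer_content (A i))"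
    proof (rule ennreal_le_epsilon)
      fix e :: real assume e: "0 < e" and fin: "(\<Sum>i. outer_content (A i)) < Orderings.top"
      have "outer_content (A i) < Orderings.top" for i 
        using ennreal_suminf_lessD[OF fin] .
      \<comment> \<open>The slacks e/2, e/4, ... add up to \<open>e\<close>. Strictness comes from
        the finiteness of the outer content of \<open>A i\<close>.\<close>
      then have "outer_content (A i) < outer_content (A i) + ennreal (e * (1/2) ^ Suc i)" for i
      proof -
        obtain r where "0 \<le> r" "outer_content (A i) = ennreal r"
          using \<open>outer_content (A i) < Orderings.top\<close> by (auto simp: less_top_ennreal)
        then show ?thesis using e by (simp add: ennreal_plus[symmetric] ennreal_less_iff del: ennreal_plus)
      qed
      then have "\<exists>U. openin X U \<and> A i \<subseteq> U \<and> open_content U < outer_content (A i) + ennreal (e * (1/2) ^ Suc i)" for i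
        by (subst (asm) outer_content_def) (auto simp: INF_less_iff)
      then obtain U where U: "\<And>i. openin X (U i)" "\<And>i. A i \<subseteq> U i" 
        "\<And>i. open_content (U i) < outer_content (A i) + ennreal (e * (1/2) ^ Suc i)" by metis
      have "outer_content (\<Union>i. A i) \<le> outer_content (\<Union>i. U i)"
        using U(2) by (intro outer_content_mono) blast
      also have "\<dots> \<le> (\<Sum>i. open_content (U i))"
        using open_content_UN_le[of U, OF U(1)] outer_content_open[of "\<Union>i. U i"] U(1) by fastforce
      also have "\<dots> \<le> (\<Sum>i. outer_content (A i) + ennreal (e * (1/2) ^ Suc i))"
        using U(3) by (intro suminf_le) (auto intro: less_imp_le)
      also have "\<dots> = (\<Sum>i. outer_content (A i)) + (\<Sum>i. ennreal (e * (1/2) ^ Suc i))"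
        by (rule suminf_add[symmetric]) auto
      also have "(\<Sum>i. ennreal (e * (1/2) ^ Suc i)) = ennreal e"
      proof (rule suminf_ennreal_eq)
        show "(\<lambda>i. e * (1/2) ^ Suc i) sums e"
          using sums_mult[OF power_half_series, of e] by simp
      qed (use e in auto)
      finally show "outer_content (\<Union>i. A i) \<le> (\<Sum>i. outer_content (A i)) + ennreal e" .
    qed
  qed
qed

text \<open>\<open>V \<inter> U\<close> is exhausted from inside by compact open sets
  \<open>C\<close>. Each \<open>V - C\<close> is open and contains \<open>V - U\<close>, so it
  bounds the second term, and it is in turn exhausted by compact open sets disjoint from
  \<open>C\<close>.\<close>

lemma open_content_Un_disjoint_ge:
  assumes V: "openin X V" and U: "openin X U"
  shows "outer_content (V \<inter> U) + outer_content (V - U) \<le> open_content V"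
proof -
  have "ennreal (content C) + outer_content (V - U) \<le> open_content V" if C: "compact_open C" "C \<subseteq> V \<inter> U" for C
  proof -
    have o: "openin X (V - C)" using V compact_open_imp_closed[OF C(1)] by blast
    have "ennreal (content C) + outer_content (V - U) \<le> ennreal (content C) + open_content (V - C)"
      using C(2) outer_content_mono[of "V - U" "V - C"] outer_content_open[OF o] by (auto intro!: add_left_mono)
    also have "\<dots> = (SUP D\<in>{D. compact_open D \<and> D \<subseteq> V - C}. ennreal (content C) + ennreal (content D))"
      unfolding open_content_def by (rule ennreal_SUP_add_right) (auto intro: exI[of _ "{}"])
    also have "\<dots> \<le> open_content V"
    proof (rule SUP_least)
      fix D assume "D \<in> {D. compact_open D \<and> D \<subseteq> V - C}"
      then have D: "compact_open D" "D \<subseteq> V - C" by auto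
      have "ennreal (content C) + ennreal (content D) = ennreal (content (C \<union> D))"
        using C(1) D by (subst content_Un) auto
      also have "\<dots> \<le> open_content V"
        using C D by (intro content_le_open_content compact_open_Un) auto
      finally show "ennreal (content C) + ennreal (content D) \<le> open_content V" .
    qed
    finally show ?thesis .
  qed
  moreover have "outer_content (V \<inter> U) = open_content (V \<inter> U)"
    using V U by (simp add: outer_content_open openin_Int)
  moreover have "open_content (V \<inter> U) + outer_content (V - U) = 
      (SUP C\<in>{C. compact_open C \<and> C \<subseteq> V \<inter> U}. ennreal (content C) + outer_content (V - U))"
    unfolding open_content_def by (rule ennreal_SUP_add_left[symmetric]) auto
  ultimately show ?thesis by (auto intro!: SUP_least)
qed

text \<open>Since the outer content is an infimum over open supersets, the splitting condition of
  Caratheodory for an arbitrary set reduces to the case of an open set.\<close>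

lemma open_in_lambda_system:
  assumes U: "openin X U"
  shows "U \<in> lambda_system (carrier G) (Pow (carrier G)) outer_content"
proof -
  have UX: "U \<subseteq> carrier G" using openin_subset[OF U] by simp
  interpret sigma_algebra "carrier G" "Pow (carrier G)" by (rule sigma_algebra_Pow)
  have sub: "subadditive (Pow (carrier G)) outer_content"
    using outer_measure_space_outer_content countably_subadditive_subadditive
    by (auto simp: outer_measure_space_def)
  have "outer_content (x \<inter> U) + outer_content (x - U) = outer_content x" if x: "x \<subseteq> carrier G" for x
  proof (rule antisym)
    show "outer_content (x \<inter> U) + outer_content (x - U) \<le> outer_content x"
      unfolding outer_content_def[of x]
    proof (rule INF_greatest)
      fix V assume "V \<in> {V. openin X V \<and> x \<subseteq> V}"
      then have V: "openin X V" "x \<subseteq> V" by auto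
      have "outer_content (x \<inter> U) + outer_content (x - U) \<le> outer_content (V \<inter> U) + outer_content (V - U)"
        using V by (intro add_mono outer_content_mono) auto
      also have "\<dots> \<le> open_content V" by (rule open_content_Un_disjoint_ge[OF V(1) U])
      finally show "outer_content (x \<inter> U) + outer_content (x - U) \<le> open_content V" .
    qed
    have "x = (x \<inter> U) \<union> (x - U)" by auto
    then show "outer_content x \<le> outer_content (x \<inter> U) + outer_content (x - U)"
      using subadditiveD[OF sub, of "x \<inter> U" "x - U"] x by (metis Diff_disjoint Int_Diff_disjoint PowI Diff_subset
        Int_lower1 subset_trans)
  qed
  then show ?thesis using UX by (auto simp: lambda_system_eq)
qed

definition haar :: "'a measure" where
  "haar = measure_of (carrier G) {U. openin X U} outer_content"

lemma openin_Pow: "{U. openin X U} \<subseteq> Pow (carrier G)"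
  using openin_subset by fastforce

lemma space_haar [simp]: "space haar = carrier G"
  by (simp add: haar_def space_measure_of[OF openin_Pow])

lemma sets_haar: "sets haar = sigma_sets (carrier G) {U. openin X U}"
  unfolding haar_def by (rule sets_measure_of[OF openin_Pow])

lemma openin_sets_haar: "openin X U \<Longrightarrow> U \<in> sets haar"
  by (simp add: sets_haar)

lemma compact_open_sets_haar: "compact_open C \<Longrightarrow> C \<in> sets haar"
  by (simp add: compact_open_imp_open openin_sets_haar)

text \<open>The Caratheodory measurable sets form a \<sigma>-algebra containing the open sets, so
  the outer content is a measure on all Borel sets.\<close>

lemma emeasure_haar: "A \<in> sets haar \<Longrightarrow> emeasure haar A = outer_content A"
proof -
  interpret sigma_algebra "carrier G" "Pow (carrier G)" by (rule sigma_algebra_Pow)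
  let ?L = "lambda_system (carrier G) (Pow (carrier G)) outer_content"
  have ms: "measure_space (carrier G) ?L outer_content"
    by (rule caratheodory_lemma[OF outer_measure_space_outer_content])
  then have sa: "sigma_algebra (carrier G) ?L" by (simp add: measure_space_def)
  have "sigma_sets (carrier G) {U. openin X U} \<subseteq> ?L"
    using sa open_in_lambda_system by (intro sigma_algebra.sigma_sets_subset) auto
  then have "measure_space (carrier G) (sigma_sets (carrier G) {U. openin X U}) outer_content"
    using measure_down[OF ms sigma_algebra_sigma_sets[OF openin_Pow]] by blast
  moreover assume "A \<in> sets haar"
  ultimately show ?thesis
    unfolding haar_def using sets_haar openin_Pow
    by (intro emeasure_measure_of[OF refl]) 
      (auto simp: measure_space_def haar_def[symmetric])
qed

lemma emeasure_haar_compact_open: "compact_open C \<Longrightarrow> emeasure haar C = ennreal (content C)"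
  by (simp add: emeasure_haar compact_open_sets_haar outer_content_compact_open)

lemma measure_haar_compact_open: "compact_open C \<Longrightarrow> measure haar C = content C"
  by (simp add: measure_def emeasure_haar_compact_open)

text \<open>A scaling rule on compact open sets survives the supremum and the infimum in the
  definition of the outer content. The restriction to \<open>U\<close> is made for inversion, whose
  factor is controlled inside a compact open subgroup.\<close>

lemma outer_content_homeomorphic_image_le:
  assumes \<phi>: "homeomorphic_map X X \<phi>" and U: "openin X U" and A: "A \<subseteq> U" and c: "c > 0"
    and scale: "\<And>C. compact_open C \<Longrightarrow> C \<subseteq> U \<Longrightarrow> content (\<phi> ` C) = c * content C"
  shows "outer_content (\<phi> ` A) \<le> ennreal c * outer_content A"
proof -
  have op: "openin X (\<phi> ` W)" if "openin X W" for W
    using \<phi> that homeomorphic_map_openness_eq by blast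
  have UX: "U \<subseteq> carrier G" using openin_subset[OF U] by simp
  have opc: "open_content (\<phi> ` W) \<le> ennreal c * open_content W" if W: "openin X W" "W \<subseteq> U" for W
    unfolding open_content_def[of "\<phi> ` W"]
  proof (rule SUP_least)
    fix D assume "D \<in> {C. compact_open C \<and> C \<subseteq> \<phi> ` W}"
    then obtain C where C: "C \<subseteq> W" "D = \<phi> ` C" "compact_open D" by (auto elim: subset_imageE)
    have "C \<subseteq> topspace X" using C W UX by auto
    then have "compact_open C"
      using C \<phi> homeomorphic_map_compactness_eq[OF \<phi>, of C] homeomorphic_map_openness_eq[OF \<phi>, of C]
      by (auto simp: compact_open_def)
    then have "ennreal (content D) = ennreal c * ennreal (content C)"
      using C W scale c by (simp add: ennreal_mult)
    also have "\<dots> \<le> ennreal c * open_content W"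
      using \<open>compact_open C\<close> C by (intro mult_left_mono content_le_open_content) auto
    finally show "ennreal (content D) \<le> ennreal c * open_content W" .
  qed
  have *: "ennreal c * (ennreal (1/c) * z) = z" "ennreal (1/c) * (ennreal c * z) = z" for z
    using c by (simp_all add: mult.assoc[symmetric] ennreal_mult[symmetric])
  have "ennreal (1/c) * outer_content (\<phi> ` A) \<le> outer_content A"
    unfolding outer_content_def[of A]
  proof (rule INF_greatest)
    fix W assume "W \<in> {W. openin X W \<and> A \<subseteq> W}"
    then have W: "openin X W" "A \<subseteq> W" by auto
    have "outer_content (\<phi> ` A) \<le> outer_content (\<phi> ` (W \<inter> U))"
      using W A by (intro outer_content_mono) auto
    also have "\<dots> \<le> ennreal c * open_content (W \<inter> U)"
      using opc[of "W \<inter> U"] W U op by (simp add: outer_content_open openin_Int)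
    also have "\<dots> \<le> ennreal c * open_content W"
      by (intro mult_left_mono open_content_mono) auto
    finally have "ennreal (1/c) * outer_content (\<phi> ` A) \<le> ennreal (1/c) * (ennreal c * open_content W)"
      by (intro mult_left_mono) auto
    then show "ennreal (1/c) * outer_content (\<phi> ` A) \<le> open_content W" using * by simp
  qed
  then have "ennreal c * (ennreal (1/c) * outer_content (\<phi> ` A)) \<le> ennreal c * outer_content A"
    by (intro mult_left_mono) auto
  then show ?thesis using * by simp
qed

text \<open>The reverse inequality is the previous lemma for the inverse homeomorphism, with the
  factor \<open>1 / c\<close> on the image of \<open>U\<close>.\<close>

lemma outer_content_homeomorphic_image:
  assumes \<phi>: "homeomorphic_map X X \<phi>" and U: "openin X U" and A: "A \<subseteq> U" and c: "c > 0"
    and scale: "\<And>C. compact_open C \<Longrightarrow> C \<subseteq> U \<Longrightarrow> content (\<phi> ` C) = c * content C"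
  shows "outer_content (\<phi> ` A) = ennreal c * outer_content A"
proof (rule antisym)
  show "outer_content (\<phi> ` A) \<le> ennreal c * outer_content A"
    by (rule outer_content_homeomorphic_image_le[OF assms])
  have UX: "U \<subseteq> carrier G" using openin_subset[OF U] by simp
  obtain \<psi> where "homeomorphic_maps X X \<phi> \<psi>"
    using \<phi> by (auto simp: homeomorphic_map_maps)
  then have \<psi>: "homeomorphic_map X X \<psi>" and inv: "\<And>x. x \<in> carrier G \<Longrightarrow> \<psi> (\<phi> x) = x"
    using homeomorphic_maps_map[of X X \<phi> \<psi>] by simp_all
  have im: "\<psi> ` \<phi> ` B = B" if "B \<subseteq> carrier G" for B
    using inv that by (force simp: image_image subset_iff)
  have "outer_content (\<psi> ` \<phi> ` A) \<le> ennreal (1/c) * outer_content (\<phi> ` A)"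
  proof (rule outer_content_homeomorphic_image_le[OF \<psi>])
    show "openin X (\<phi> ` U)" using \<phi> U homeomorphic_map_openness_eq by blast
    show "\<phi> ` A \<subseteq> \<phi> ` U" using A by auto
    show "1 / c > 0" using c by simp
    fix D assume D: "compact_open D" "D \<subseteq> \<phi> ` U"
    then obtain C where C: "C \<subseteq> U" "D = \<phi> ` C" by (auto elim: subset_imageE)
    have "C \<subseteq> topspace X" using C UX by auto
    then have "compact_open C"
      using C D homeomorphic_map_compactness_eq[OF \<phi>, of C] homeomorphic_map_openness_eq[OF \<phi>, of C]
      by (auto simp: compact_open_def)
    then show "content (\<psi> ` D) = 1 / c * content D" using C im UX scale c by auto
  qed
  then have "ennreal c * outer_content A \<le> ennreal c * (ennreal (1/c) * outer_content (\<phi> ` A))"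
    using im A UX by (metis mult_left_mono subset_trans zero_le)
  then show "ennreal c * outer_content A \<le> outer_content (\<phi> ` A)"
    using c by (simp add: mult.assoc[symmetric] ennreal_mult[symmetric])
qed

section \<open>Translation and inversion of Borel sets\<close>

lemma homeomorphic_map_left_translation:
  assumes "a \<in> carrier G" shows "homeomorphic_map X X (\<lambda>x. a \<otimes> x)"
proof -
  have "homeomorphic_maps X X (\<lambda>x. a \<otimes> x) (\<lambda>x. inv a \<otimes> x)"
    using assms by (auto simp: homeomorphic_maps_def intro: continuous_map_left_translation)
  then show ?thesis by (auto simp: homeomorphic_map_maps)
qed

lemma homeomorphic_map_inverse_translation:
  assumes "x \<in> carrier G" shows "homeomorphic_map X X (\<lambda>y. inv y \<otimes> x)"
proof -
  have "homeomorphic_maps X X (\<lambda>y. inv y \<otimes> x) (\<lambda>y. x \<otimes> inv y)"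
    using assms by (auto simp: homeomorphic_maps_def inv_mult_group m_assoc[symmetric] 
        intro!: continuous_map_mult continuous_map_inv)
  then show ?thesis by (auto simp: homeomorphic_map_maps)
qed

lemma measurable_continuous_map:
  assumes "continuous_map X X f"
  shows "f \<in> measurable haar haar"
proof (rule measurable_sigma_sets[OF sets_haar openin_Pow])
  show "f \<in> space haar \<rightarrow> carrier G" using assms by (auto simp: continuous_map_def)
  fix U assume "U \<in> {U. openin X U}"
  then have "openin X {x \<in> topspace X. f x \<in> U}" using openin_continuous_map_preimage[OF assms] by blast
  moreover have "f -` U \<inter> space haar = {x \<in> topspace X. f x \<in> U}" by auto
  ultimately show "f -` U \<inter> space haar \<in> sets haar" by (simp add: openin_sets_haar)
qed

lemma homeomorphic_image_sets_haar:
  assumes \<phi>: "homeomorphic_map X X \<phi>" and A: "A \<in> sets haar"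
  shows "\<phi> ` A \<in> sets haar"
proof -
  obtain \<psi> where "homeomorphic_maps X X \<phi> \<psi>"
    using \<phi> by (auto simp: homeomorphic_map_maps)
  then have \<psi>: "continuous_map X X \<psi>" and inv: "\<And>x. x \<in> carrier G \<Longrightarrow> \<psi> (\<phi> x) = x"
     "\<And>x. x \<in> carrier G \<Longrightarrow> \<phi> (\<psi> x) = x" "\<And>x. x \<in> carrier G \<Longrightarrow> \<phi> x \<in> carrier G"
    by (auto simp: homeomorphic_maps_def continuous_map_def Pi_iff)
  have "\<psi> -` A \<inter> space haar \<in> sets haar" 
    using measurable_sets[OF measurable_continuous_map[OF \<psi>] A] .
  moreover have "\<psi> -` A \<inter> space haar = \<phi> ` A"
  proof (intro equalityI subsetI)
    fix x assume "x \<in> \<psi> -` A \<inter> space haar"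
    then have "x = \<phi> (\<psi> x)" "\<psi> x \<in> A" using inv by auto
    then show "x \<in> \<phi> ` A" by blast
  qed (use inv sets.sets_into_space[OF A] in auto)
  ultimately show ?thesis by simp
qed

lemma emeasure_left_translation:
  assumes a: "a \<in> carrier G" and A: "A \<in> sets haar"
  shows "emeasure haar ((\<lambda>x. a \<otimes> x) ` A) = emeasure haar A"
proof -
  have "outer_content ((\<lambda>x. a \<otimes> x) ` A) = ennreal 1 * outer_content A"
    using sets.sets_into_space[OF A] content_left_translation[OF a]
    by (intro outer_content_homeomorphic_image[OF homeomorphic_map_left_translation[OF a] openin_topspace]) auto
  then show ?thesis
    using emeasure_haar homeomorphic_image_sets_haar[OF homeomorphic_map_left_translation[OF a] A] A by simp
qed

lemma emeasure_inverse_translation: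
  assumes x: "x \<in> carrier G" and K: "compact_open_subgroup K" and A: "A \<in> sets haar" "A \<subseteq> K"
  shows "emeasure haar ((\<lambda>y. inv y \<otimes> x) ` A) = ennreal (modular x) * emeasure haar A"
proof -
  have "outer_content ((\<lambda>y. inv y \<otimes> x) ` A) = ennreal (modular x) * outer_content A"
    using content_inverse_translation[OF x K] modular_pos[OF x] A(2)
    by (intro outer_content_homeomorphic_image[OF homeomorphic_map_inverse_translation[OF x] 
       compact_open_subgroupD(4)[OF K]]) auto
  then show ?thesis
    using emeasure_haar homeomorphic_image_sets_haar[OF homeomorphic_map_inverse_translation[OF x] A(1)] A by simp
qed

lemma emeasure_haar_outer_regular:
  "A \<in> sets haar \<Longrightarrow> emeasure haar A = (INF U\<in>{U. openin X U \<and> A \<subseteq> U}. emeasure haar U)"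
  by (simp add: emeasure_haar openin_sets_haar outer_content_open cong: INF_cong_simp)
   (simp add: outer_content_def)

lemma emeasure_haar_inner_regular:
  "openin X U \<Longrightarrow> emeasure haar U = (SUP C\<in>{C. compact_open C \<and> C \<subseteq> U}. emeasure haar C)"
  by (simp add: emeasure_haar openin_sets_haar outer_content_open emeasure_haar_compact_open cong: SUP_cong_simp)
   (simp add: open_content_def)

lemma left_haar_measure_haar: "left_haar_measure G X haar"
  unfolding left_haar_measure_def
proof (intro conjI allI impI ballI)
  show "emeasure haar (space haar) \<noteq> 0"
  proof -
    note B = compact_open_subgroupD(2)[OF base_subgroup]
    have "emeasure haar base_subgroup \<le> emeasure haar (space haar)"
      using compact_open_subset[OF B] by (intro emeasure_mono sets.top) auto
    then show ?thesis by (auto simp: emeasure_haar_compact_open[OF B] content_base_subgroup)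
  qed
  fix K assume K: "compactin X K"
  then obtain C where C: "compact_open C" "K \<subseteq> C"
    using compact_subset_compact_open[OF K openin_topspace] compactin_subset_topspace by metis
  then have "emeasure haar K \<le> emeasure haar C"
    by (intro emeasure_mono compact_open_sets_haar)
  then show "emeasure haar K < \<infinity>" 
    by (simp add: emeasure_haar_compact_open[OF C(1)] order_le_less_trans)
next
  fix U assume U: "openin X U"
  show "emeasure haar U = (SUP K\<in>{K. compactin X K \<and> K \<subseteq> U}. emeasure haar K)"
  proof (rule antisym)
    show "emeasure haar U \<le> (SUP K\<in>{K. compactin X K \<and> K \<subseteq> U}. emeasure haar K)"
      unfolding emeasure_haar_inner_regular[OF U]
      by (intro SUP_subset_mono) (auto simp: compact_open_def)
    show "(SUP K\<in>{K. compactin X K \<and> K \<subseteq> U}. emeasure haar K) \<le> emeasure haar U"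
      using openin_sets_haar[OF U] by (auto intro!: SUP_least emeasure_mono)
  qed
qed (auto simp: sets_haar[symmetric] emeasure_haar_outer_regular[symmetric] emeasure_left_translation)

end

section \<open>Square-integrable functions\<close>

lemma L2_spaceD:
  assumes "f \<in> L2_space M"
  shows "f \<in> borel_measurable M" "integrable M (\<lambda>x. (cmod (f x))\<^sup>2)"
  using assms by (auto simp: L2_space_def)

lemma L2_space_bound:
  assumes "f \<in> borel_measurable M" "integrable M h" "\<And>x. x \<in> space M \<Longrightarrow> (cmod (f x))\<^sup>2 \<le> h x"
  shows "f \<in> L2_space M"
  unfolding L2_space_def
proof (intro CollectI conjI)
  show "integrable M (\<lambda>x. (cmod (f x))\<^sup>2)"
    using assms by (intro Bochner_Integration.integrable_bound[OF assms(2)]) (auto intro!: AE_I2 order_trans[OF assms(3)])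
qed (fact assms)

lemma cmod_add_squared_le: "(cmod (a + b))\<^sup>2 \<le> 2 * (cmod a)\<^sup>2 + 2 * (cmod b)\<^sup>2"
proof -
  have "(cmod (a + b))\<^sup>2 \<le> (cmod a + cmod b)\<^sup>2"
    by (intro power_mono norm_triangle_ineq) auto
  also have "\<dots> \<le> 2 * (cmod a)\<^sup>2 + 2 * (cmod b)\<^sup>2"
    using sum_squares_bound[of "cmod a" "cmod b"] by (simp add: power2_sum)
  finally show ?thesis .
qed

lemma L2_space_add:
  assumes "f \<in> L2_space M" "g \<in> L2_space M"
  shows "(\<lambda>x. f x + g x) \<in> L2_space M"
  using L2_spaceD[OF assms(1)] L2_spaceD[OF assms(2)]
  by (intro L2_space_bound[where h = "\<lambda>x. 2 * (cmod (f x))\<^sup>2 + 2 * (cmod (g x))\<^sup>2"])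
     (auto intro: cmod_add_squared_le)

lemma L2_space_scale:
  assumes "f \<in> L2_space M" shows "(\<lambda>x. c * f x) \<in> L2_space M"
  using L2_spaceD[OF assms]
  by (intro L2_space_bound[where h = "\<lambda>x. (cmod c)\<^sup>2 * (cmod (f x))\<^sup>2"])
     (auto simp: norm_mult power_mult_distrib)

lemma L2_space_diff:
  assumes "f \<in> L2_space M" "g \<in> L2_space M"
  shows "(\<lambda>x. f x - g x) \<in> L2_space M"
  using L2_space_add[OF assms(1) L2_space_scale[OF assms(2), of "-1"]] by simp

lemma L2_space_zero [simp]: "(\<lambda>x. 0) \<in> L2_space M"
  by (simp add: L2_space_def)

lemma L2_space_sum:
  "(\<And>i. i \<in> I \<Longrightarrow> f i \<in> L2_space M) \<Longrightarrow> (\<lambda>x. \<Sum>i\<in>I. f i x) \<in> L2_space M"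
  by (induction I rule: infinite_finite_induct) (auto intro: L2_space_add)

lemma L2_space_cmod:
  assumes "f \<in> L2_space M" shows "(\<lambda>x. complex_of_real (cmod (f x))) \<in> L2_space M"
  using L2_spaceD[OF assms] by (intro L2_space_bound[where h = "\<lambda>x. (cmod (f x))\<^sup>2"]) auto

lemma L2_space_indicator_mult:
  assumes "f \<in> L2_space M" "A \<in> sets M"
  shows "(\<lambda>x. indicator A x * f x) \<in> L2_space M"
  using L2_spaceD[OF assms(1)] assms(2)
  by (intro L2_space_bound[where h = "\<lambda>x. (cmod (f x))\<^sup>2"]) (auto split: split_indicator)

lemma L2_norm_nonneg [simp]: "L2_norm M f \<ge> 0"
  by (simp add: L2_norm_def)

lemma L2_norm_squared: "(L2_norm M f)\<^sup>2 = (LINT x|M. (cmod (f x))\<^sup>2)"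
  by (simp add: L2_norm_def)

lemma L2_norm_zero [simp]: "L2_norm M (\<lambda>x. 0) = 0"
  by (simp add: L2_norm_def)

lemma L2_norm_mono:
  assumes "f \<in> borel_measurable M" "g \<in> L2_space M" "AE x in M. cmod (f x) \<le> cmod (g x)"
  shows "L2_norm M f \<le> L2_norm M g"
  unfolding L2_norm_def using assms L2_spaceD[OF assms(2)]
  by (intro real_sqrt_le_mono integral_mono_AE') (auto elim!: eventually_mono intro!: power_mono)

lemma L2_norm_cong_AE:
  assumes "f \<in> L2_space M" "g \<in> L2_space M" "AE x in M. f x = g x"
  shows "L2_norm M f = L2_norm M g"
  using assms by (intro antisym L2_norm_mono) (auto simp: L2_spaceD elim!: eventually_mono)

lemma L2_norm_cong: "(\<And>x. x \<in> space M \<Longrightarrow> f x = g x) \<Longrightarrow> L2_norm M f = L2_norm M g"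
  unfolding L2_norm_def by (metis (no_types, lifting) Bochner_Integration.integral_cong)

lemma L2_norm_scale: "L2_norm M (\<lambda>x. c * f x) = cmod c * L2_norm M f"
  by (simp add: L2_norm_def norm_mult power_mult_distrib real_sqrt_mult)

lemma L2_norm_eq_0_iff:
  assumes "f \<in> L2_space M" shows "L2_norm M f = 0 \<longleftrightarrow> (AE x in M. f x = 0)"
  using integral_nonneg_eq_0_iff_AE[OF L2_spaceD(2)[OF assms]] by (simp add: L2_norm_def)

lemma L2_mult_integrable:
  assumes "f \<in> L2_space M" "g \<in> L2_space M"
  shows "integrable M (\<lambda>x. f x * g x)"
proof (rule Bochner_Integration.integrable_bound)
  show "integrable M (\<lambda>x. (cmod (f x))\<^sup>2 + (cmod (g x))\<^sup>2)"
    using assms by (auto simp: L2_spaceD)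
  show "AE x in M. norm (f x * g x) \<le> norm ((cmod (f x))\<^sup>2 + (cmod (g x))\<^sup>2)"
  proof (rule AE_I2)
    fix x
    have "2 * (cmod (f x) * cmod (g x)) \<le> (cmod (f x))\<^sup>2 + (cmod (g x))\<^sup>2"
      using sum_squares_bound[of "cmod (f x)" "cmod (g x)"] by simp
    moreover have "0 \<le> cmod (f x) * cmod (g x)" by simp
    ultimately show "norm (f x * g x) \<le> norm ((cmod (f x))\<^sup>2 + (cmod (g x))\<^sup>2)"
      unfolding norm_mult real_norm_def by linarith
  qed
qed (intro borel_measurable_times L2_spaceD assms)

lemma Cauchy_Schwarz_cmod:
  assumes f: "f \<in> L2_space M" and g: "g \<in> L2_space M"
  shows "(LINT x|M. cmod (f x) * cmod (g x)) \<le> L2_norm M f * L2_norm M g"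
proof -
  define A where "A = (LINT x|M. (cmod (f x))\<^sup>2)"
  define B where "B = (LINT x|M. (cmod (g x))\<^sup>2)"
  define I where "I = (LINT x|M. cmod (f x) * cmod (g x))"
  have int: "integrable M (\<lambda>x. cmod (f x) * cmod (g x))"
    using integrable_norm[OF L2_mult_integrable[OF f g]] by (simp add: norm_mult)
  have A: "A \<ge> 0" and B: "B \<ge> 0" and I: "I \<ge> 0" by (auto simp: A_def B_def I_def)
  have "I\<^sup>2 \<le> A * B"
  proof (cases "A = 0")
    case True
    then have "AE x in M. f x = 0" using L2_norm_eq_0_iff[OF f] by (simp add: L2_norm_def A_def)
    then have "I = (LINT x|M. 0)" unfolding I_def 
      using int by (intro integral_cong_AE) (auto elim!: eventually_mono)
    then show ?thesis using A B by simp
  next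
    case False
    have quad: "0 \<le> t\<^sup>2 * A - 2 * t * I + B" for t
    proof -
      have "0 \<le> (LINT x|M. (t * cmod (f x) - cmod (g x))\<^sup>2)" by simp
      also have "\<dots> = (LINT x|M. t\<^sup>2 * (cmod (f x))\<^sup>2 - 2 * t * (cmod (f x) * cmod (g x)) + (cmod (g x))\<^sup>2)"
        by (simp add: power2_diff power_mult_distrib algebra_simps)
      also have "\<dots> = t\<^sup>2 * A - 2 * t * I + B"
        using int L2_spaceD(2)[OF f] L2_spaceD(2)[OF g] by (simp add: A_def B_def I_def)
      finally show ?thesis .
    qed
    \<comment> \<open>The quadratic in \<open>t\<close> is evaluated at its minimum
      \<open>I / A\<close>.\<close>
    have "0 \<le> A * ((I / A)\<^sup>2 * A - 2 * (I / A) * I + B)" by (intro mult_nonneg_nonneg A quad)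
    also have "\<dots> = A * B - I\<^sup>2" using False by (simp add: field_simps power2_eq_square)
    finally show ?thesis by simp
  qed
  then have "I \<le> sqrt (A * B)" by (rule real_le_rsqrt)
  then show ?thesis by (simp add: L2_norm_def A_def B_def I_def real_sqrt_mult)
qed

lemma Cauchy_Schwarz:
  assumes f: "f \<in> L2_space M" and g: "g \<in> L2_space M"
  shows "cmod (LINT x|M. f x * g x) \<le> L2_norm M f * L2_norm M g"
proof -
  have "cmod (LINT x|M. f x * g x) \<le> (LINT x|M. cmod (f x * g x))" by (rule integral_norm_bound)
  then show ?thesis using Cauchy_Schwarz_cmod[OF assms] by (simp add: norm_mult)
qed

lemma L2_norm_triangle:
  assumes f: "f \<in> L2_space M" and g: "g \<in> L2_space M"
  shows "L2_norm M (\<lambda>x. f x + g x) \<le> L2_norm M f + L2_norm M g"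
proof (rule power2_le_imp_le)
  have int: "integrable M (\<lambda>x. cmod (f x) * cmod (g x))"
    using integrable_norm[OF L2_mult_integrable[OF f g]] by (simp add: norm_mult)
  have "(L2_norm M (\<lambda>x. f x + g x))\<^sup>2 = (LINT x|M. (cmod (f x + g x))\<^sup>2)" by (rule L2_norm_squared)
  also have "\<dots> \<le> (LINT x|M. (cmod (f x))\<^sup>2 + 2 * (cmod (f x) * cmod (g x)) + (cmod (g x))\<^sup>2)"
  proof (rule integral_mono)
    fix x
    have "(cmod (f x + g x))\<^sup>2 \<le> (cmod (f x) + cmod (g x))\<^sup>2"
      by (intro power_mono norm_triangle_ineq) auto
    then show "(cmod (f x + g x))\<^sup>2 \<le> (cmod (f x))\<^sup>2 + 2 * (cmod (f x) * cmod (g x)) + (cmod (g x))\<^sup>2"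
      by (simp add: power2_sum)
  qed (use int f g L2_space_add[OF f g] in \<open>auto simp: L2_spaceD\<close>)
  also have "\<dots> = (L2_norm M f)\<^sup>2 + 2 * (LINT x|M. cmod (f x) * cmod (g x)) + (L2_norm M g)\<^sup>2"
    using int f g by (simp add: L2_spaceD L2_norm_squared)
  also have "\<dots> \<le> (L2_norm M f)\<^sup>2 + 2 * (L2_norm M f * L2_norm M g) + (L2_norm M g)\<^sup>2"
    using Cauchy_Schwarz_cmod[OF f g] by simp
  also have "\<dots> = (L2_norm M f + L2_norm M g)\<^sup>2" by (simp add: power2_sum)
  finally show "(L2_norm M (\<lambda>x. f x + g x))\<^sup>2 \<le> (L2_norm M f + L2_norm M g)\<^sup>2" .
qed simp

lemma L2_norm_triangle_diff:
  assumes "f \<in> L2_space M" "g \<in> L2_space M" "h \<in> L2_space M"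
  shows "L2_norm M (\<lambda>x. f x - h x) \<le> L2_norm M (\<lambda>x. f x - g x) + L2_norm M (\<lambda>x. g x - h x)"
  using L2_norm_triangle[OF L2_space_diff[OF assms(1,2)] L2_space_diff[OF assms(2,3)]] by simp

lemma L2_norm_sum_le:
  "(\<And>i. i \<in> I \<Longrightarrow> f i \<in> L2_space M) \<Longrightarrow>
    L2_norm M (\<lambda>x. \<Sum>i\<in>I. f i x) \<le> (\<Sum>i\<in>I. L2_norm M (f i))"
proof (induction I rule: infinite_finite_induct)
  case (insert i I)
  have "L2_norm M (\<lambda>x. f i x + (\<Sum>i\<in>I. f i x)) \<le> L2_norm M (f i) + L2_norm M (\<lambda>x. \<Sum>i\<in>I. f i x)"
    using insert.prems by (intro L2_norm_triangle L2_space_sum) auto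
  with insert show ?case by fastforce
qed auto

lemma L2_space_indicator:
  assumes "A \<in> sets M" "emeasure M A < \<infinity>"
  shows "indicator A \<in> L2_space M"
  using assms by (intro L2_space_bound[where h = "indicator A"]) (auto simp: indicator_def)

lemma L2_norm_indicator:
  assumes "A \<in> sets M" "emeasure M A < \<infinity>"
  shows "L2_norm M (indicator A) = sqrt (measure M A)"
proof -
  have "(LINT x|M. (cmod (indicator A x))\<^sup>2) = (LINT x|M. indicator A x)"
    by (intro Bochner_Integration.integral_cong) (auto simp: indicator_def)
  then show ?thesis using assms by (simp add: L2_norm_def sets.sets_into_space Int_absorb2)
qed

text \<open>At every point at most one summand is nonzero, so the squared moduli already add
  pointwise.\<close>

lemma L2_norm_sum_disjoint_squared:
  assumes "finite I" "\<And>i. i \<in> I \<Longrightarrow> f i \<in> L2_space M"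
    and "\<And>x i j. x \<in> space M \<Longrightarrow> i \<in> I \<Longrightarrow> j \<in> I \<Longrightarrow> i \<noteq> j \<Longrightarrow> f i x = 0 \<or> f j x = 0"
  shows "(L2_norm M (\<lambda>x. \<Sum>i\<in>I. f i x))\<^sup>2 = (\<Sum>i\<in>I. (L2_norm M (f i))\<^sup>2)"
proof -
  have "(cmod (\<Sum>i\<in>I. f i x))\<^sup>2 = (\<Sum>i\<in>I. (cmod (f i x))\<^sup>2)" if x: "x \<in> space M" for x
  proof (cases "\<exists>j\<in>I. f j x \<noteq> 0")
    case True
    then obtain j where j: "j \<in> I" "f j x \<noteq> 0" by auto
    then have z: "f i x = 0" if "i \<in> I - {j}" for i using assms(3)[OF x] that by blast
    have "(\<Sum>i\<in>I. f i x) = f j x" 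
      using sum.remove[OF assms(1) j(1), of "\<lambda>i. f i x"] z by simp
    moreover have "(\<Sum>i\<in>I. (cmod (f i x))\<^sup>2) = (cmod (f j x))\<^sup>2"
      using sum.remove[OF assms(1) j(1), of "\<lambda>i. (cmod (f i x))\<^sup>2"] z by simp
    ultimately show ?thesis by simp
  qed simp
  then show ?thesis
    using assms(2) unfolding L2_norm_squared
    by (simp add: L2_spaceD cong: Bochner_Integration.integral_cong)
qed

section \<open>Bounded operators\<close>

lemma bounded_operatorsD:
  assumes "T \<in> bounded_operators M"
  shows "f \<in> L2_space M \<Longrightarrow> T f \<in> L2_space M"
    and "f \<in> L2_space M \<Longrightarrow> g \<in> L2_space M \<Longrightarrow> AE x in M. T (\<lambda>y. f y + g y) x = T f x + T g x"
    and "f \<in> L2_space M \<Longrightarrow> AE x in M. T (\<lambda>y. c * f y) x = c * T f x"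
  using assms by (auto simp: bounded_operators_def)

lemma bounded_operators_bound:
  assumes "T \<in> bounded_operators M"
  obtains C where "C \<ge> 0" "\<And>f. f \<in> L2_space M \<Longrightarrow> L2_norm M (T f) \<le> C * L2_norm M f"
proof -
  obtain C where C: "\<And>f. f \<in> L2_space M \<Longrightarrow> L2_norm M (T f) \<le> C * L2_norm M f"
    using assms unfolding bounded_operators_def by blast
  have "L2_norm M (T f) \<le> max C 0 * L2_norm M f" if "f \<in> L2_space M" for f
    by (rule order_trans[OF C[OF that]]) (auto intro: mult_right_mono)
  then show thesis using that[of "max C 0"] by auto
qed

lemma L2_norm_le_on_unit_ball:
  assumes "\<And>f. f \<in> L2_space M \<Longrightarrow> L2_norm M (T f) \<le> C * L2_norm M f" "C \<ge> 0"
    and "f \<in> L2_space M" "L2_norm M f \<le> 1"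
  shows "L2_norm M (T f) \<le> C"
  using assms(1)[OF assms(3)] mult_left_mono[OF assms(4) assms(2)] by simp

lemma op_norm_le:
  assumes "\<And>f. f \<in> L2_space M \<Longrightarrow> L2_norm M (T f) \<le> C * L2_norm M f" "C \<ge> 0"
  shows "op_norm M T \<le> C"
  unfolding op_norm_def
proof (rule cSup_least)
  have "L2_norm M (T (\<lambda>x. 0)) \<in> {L2_norm M (T f) |f. f \<in> L2_space M \<and> L2_norm M f \<le> 1}"
    by (auto intro!: exI[of _ "\<lambda>x. 0"])
  then show "{L2_norm M (T f) |f. f \<in> L2_space M \<and> L2_norm M f \<le> 1} \<noteq> {}" by blast
qed (use L2_norm_le_on_unit_ball[of M T C] assms in auto)

lemma L2_norm_le_op_norm_unit:
  assumes "T \<in> bounded_operators M" "f \<in> L2_space M" "L2_norm M f \<le> 1"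
  shows "L2_norm M (T f) \<le> op_norm M T"
proof -
  obtain C where C: "C \<ge> 0" "\<And>f. f \<in> L2_space M \<Longrightarrow> L2_norm M (T f) \<le> C * L2_norm M f"
    using bounded_operators_bound[OF assms(1)] by blast
  show ?thesis
    unfolding op_norm_def
  proof (rule cSup_upper)
    show "bdd_above {L2_norm M (T f) |f. f \<in> L2_space M \<and> L2_norm M f \<le> 1}"
      using L2_norm_le_on_unit_ball[of M T C] C by (intro bdd_aboveI[of _ C]) auto
  qed (use assms in auto)
qed

lemma op_norm_nonneg: "T \<in> bounded_operators M \<Longrightarrow> op_norm M T \<ge> 0"
  using L2_norm_le_op_norm_unit[of T M "\<lambda>x. 0"] by (simp add: order_trans[OF L2_norm_nonneg])

lemma L2_norm_le_op_norm:
  assumes T: "T \<in> bounded_operators M" and f: "f \<in> L2_space M"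
  shows "L2_norm M (T f) \<le> op_norm M T * L2_norm M f"
proof (cases "L2_norm M f = 0")
  case True
  obtain C where "L2_norm M (T f) \<le> C * L2_norm M f"
    using bounded_operators_bound[OF T] f by blast
  then show ?thesis using True by simp
next
  case False
  define c where "c = complex_of_real (1 / L2_norm M f)"
  have cf: "(\<lambda>x. c * f x) \<in> L2_space M" by (rule L2_space_scale[OF f])
  have c: "cmod c = 1 / L2_norm M f" by (simp add: c_def norm_divide)
  have "L2_norm M (\<lambda>x. c * f x) \<le> 1" using False by (simp add: L2_norm_scale c)
  then have "L2_norm M (T (\<lambda>x. c * f x)) \<le> op_norm M T" 
    by (rule L2_norm_le_op_norm_unit[OF T cf])
  moreover have "L2_norm M (T (\<lambda>x. c * f x)) = cmod c * L2_norm M (T f)"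
    unfolding L2_norm_scale[symmetric]
    using bounded_operatorsD[OF T] f cf by (intro L2_norm_cong_AE) (auto intro: L2_space_scale)
  moreover have "L2_norm M f > 0" using False L2_norm_nonneg[of M f] by linarith
  ultimately show ?thesis using c by (simp add: field_simps)
qed

lemma bounded_operatorsI:
  assumes "\<And>f. f \<in> L2_space M \<Longrightarrow> T f \<in> L2_space M"
    and "\<And>f g x. f \<in> L2_space M \<Longrightarrow> g \<in> L2_space M \<Longrightarrow> x \<in> space M \<Longrightarrow> T (\<lambda>y. f y + g y) x = T f x + T g x"
    and "\<And>c f x. f \<in> L2_space M \<Longrightarrow> x \<in> space M \<Longrightarrow> T (\<lambda>y. c * f y) x = c * T f x"
    and "\<And>f. f \<in> L2_space M \<Longrightarrow> L2_norm M (T f) \<le> C * L2_norm M f"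
  shows "T \<in> bounded_operators M"
  unfolding bounded_operators_def using assms by (auto intro!: AE_I2 exI[of _ C])

lemma bounded_operators_op_diff:
  assumes S: "S \<in> bounded_operators M" and T: "T \<in> bounded_operators M"
  shows "op_diff S T \<in> bounded_operators M"
proof -
  obtain C where C: "C \<ge> 0" "\<And>f. f \<in> L2_space M \<Longrightarrow> L2_norm M (S f) \<le> C * L2_norm M f"
    using bounded_operators_bound[OF S] by blast
  obtain D where D: "D \<ge> 0" "\<And>f. f \<in> L2_space M \<Longrightarrow> L2_norm M (T f) \<le> D * L2_norm M f"
    using bounded_operators_bound[OF T] by blast
  have "L2_norm M (\<lambda>x. S f x - T f x) \<le> (C + D) * L2_norm M f" if f: "f \<in> L2_space M" for f
  proof -
    have "L2_norm M (\<lambda>x. S f x + (-1) * T f x) \<le> L2_norm M (S f) + L2_norm M (\<lambda>x. (-1) * T f x)"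
      using S T f by (intro L2_norm_triangle L2_space_scale) (auto intro: bounded_operatorsD)
    then show ?thesis using C(2)[OF f] D(2)[OF f] by (simp add: L2_norm_scale[of M "-1", simplified] algebra_simps)
  qed
  moreover have "AE x in M. S (\<lambda>y. f y + g y) x - T (\<lambda>y. f y + g y) x = S f x - T f x + (S g x - T g x)"
    if "f \<in> L2_space M" "g \<in> L2_space M" for f g
    using bounded_operatorsD(2)[OF S that] bounded_operatorsD(2)[OF T that] by eventually_elim simp
  moreover have "AE x in M. S (\<lambda>y. c * f y) x - T (\<lambda>y. c * f y) x = c * (S f x - T f x)"
    if "f \<in> L2_space M" for f c
    using bounded_operatorsD(3)[OF S that, of c] bounded_operatorsD(3)[OF T that, of c] 
    by eventually_elim (simp add: algebra_simps)
  ultimately show ?thesis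
    unfolding bounded_operators_def op_diff_def
    by (intro CollectI conjI ballI allI exI[of _ "C + D"] L2_space_diff bounded_operatorsD(1)[OF S] 
        bounded_operatorsD(1)[OF T])
qed

lemma op_diff_apply: "op_diff S T f = (\<lambda>x. S f x - T f x)"
  by (simp add: op_diff_def)

section \<open>Averaging over a compact open subgroup\<close>

text \<open>Finite subfamilies have total measure at most that of \<open>W\<close>, so the measures
  are summable, and a summable family of reals has only countably many nonzero members.\<close>

lemma countable_disjoint_positive_measure:
  assumes F: "disjoint F" "F \<subseteq> sets M" and W: "W \<in> sets M" "emeasure M W < \<infinity>"
    and sub: "\<And>A. A \<in> F \<Longrightarrow> A \<subseteq> W" and pos: "\<And>A. A \<in> F \<Longrightarrow> emeasure M A > 0"
  shows "countable F"
proof -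
  have fin: "emeasure M A \<noteq> \<infinity>" if "A \<subseteq> W" for A
    using emeasure_mono[OF that W(1)] W(2) by (auto simp: top_unique)
  have "measure M summable_on F"
  proof (rule nonneg_bdd_above_summable_on)
    show "bdd_above (sum (measure M) ` {S. S \<subseteq> F \<and> finite S})"
    proof (rule bdd_aboveI2)
      fix S assume S: "S \<in> {S. S \<subseteq> F \<and> finite S}"
      then have "disjoint_family_on (\<lambda>A. A) S"
        using disjointD[OF F(1)] by (auto simp: disjoint_family_on_def)
      then have "sum (measure M) S = measure M (\<Union>A\<in>S. A)"
        using S F(2) sub fin by (intro measure_finite_Union[symmetric]) auto
      also have "\<dots> \<le> measure M W"
        using S F(2) sub W by (intro measure_mono_fmeasurable) (auto simp: fmeasurable_def intro!: sets.finite_Union)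
      finally show "sum (measure M) S \<le> measure M W" .
    qed
  qed simp
  then have "countable {A \<in> F. measure M A \<noteq> 0}"
    using summable_countable_real by blast
  moreover have "measure M A \<noteq> 0" if "A \<in> F" for A
    using pos[OF that] fin[OF sub[OF that]] by (simp add: measure_def enn2real_eq_0_iff)
  ultimately show ?thesis by (simp cong: conj_cong)
qed

context td_group
begin

abbreviation conv :: "('a \<Rightarrow> complex) \<Rightarrow> 'a operator" where
  "conv \<equiv> convolution_operator G haar"

definition right_coset :: "'a set \<Rightarrow> 'a \<Rightarrow> 'a set" where
  "right_coset K x = (\<lambda>k. k \<otimes> x) ` K"

section \<open>Integrals under translation and inversion\<close>

lemma measurable_left_translation: "a \<in> carrier G \<Longrightarrow> (\<lambda>x. a \<otimes> x) \<in> measurable haar haar"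
  by (intro measurable_continuous_map continuous_map_left_translation)

lemma measurable_inverse_translation: "x \<in> carrier G \<Longrightarrow> (\<lambda>y. inv y \<otimes> x) \<in> measurable haar haar"
  using measurable_continuous_map homeomorphic_imp_continuous_map homeomorphic_map_inverse_translation by blast

lemma distr_left_translation:
  assumes a: "a \<in> carrier G" shows "distr haar haar (\<lambda>x. a \<otimes> x) = haar"
proof (rule measure_eqI)
  fix A assume "A \<in> sets (distr haar haar (\<lambda>x. a \<otimes> x))"
  then have A: "A \<in> sets haar" by simp
  then have AG: "A \<subseteq> carrier G" using sets.sets_into_space by fastforce
  have "(\<lambda>x. a \<otimes> x) -` A \<inter> space haar = (\<lambda>x. inv a \<otimes> x) ` A"
    using left_translation_image_eq[of "inv a" A] a AG by auto
  then show "emeasure (distr haar haar (\<lambda>x. a \<otimes> x)) A = emeasure haar A"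
    using emeasure_distr[OF measurable_left_translation[OF a] A] emeasure_left_translation[of "inv a" A] a A
    by simp
qed simp

lemma integral_left_translation:
  fixes h :: "'a \<Rightarrow> 'v::{banach, second_countable_topology}"
  assumes "a \<in> carrier G" "h \<in> borel_measurable haar"
  shows "(LINT y|haar. h (a \<otimes> y)) = (LINT y|haar. h y)"
  using integral_distr[OF measurable_left_translation[OF assms(1)] assms(2)] distr_left_translation[OF assms(1)]
  by simp

lemma integrable_left_translation:
  fixes h :: "'a \<Rightarrow> 'v::{banach, second_countable_topology}"
  assumes "a \<in> carrier G" "h \<in> borel_measurable haar"
  shows "integrable haar (\<lambda>y. h (a \<otimes> y)) \<longleftrightarrow> integrable haar h"
  using integrable_distr_eq[OF measurable_left_translation[OF assms(1)] assms(2)] distr_left_translation[OF assms(1)]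
  by simp

lemma L2_left_translation:
  assumes a: "a \<in> carrier G" and g: "g \<in> L2_space haar"
  shows "(\<lambda>y. g (a \<otimes> y)) \<in> L2_space haar" "L2_norm haar (\<lambda>y. g (a \<otimes> y)) = L2_norm haar g"
proof -
  have m: "(\<lambda>y. (cmod (g y))\<^sup>2) \<in> borel_measurable haar" using L2_spaceD(1)[OF g] by simp
  show "(\<lambda>y. g (a \<otimes> y)) \<in> L2_space haar"
    using integrable_left_translation[OF a m] L2_spaceD[OF g] measurable_compose[OF measurable_left_translation[OF a]]
    by (simp add: L2_space_def)
  show "L2_norm haar (\<lambda>y. g (a \<otimes> y)) = L2_norm haar g"
    using integral_left_translation[OF a m] by (simp add: L2_norm_def)
qed

lemma right_coset_compact_open:
  "x \<in> carrier G \<Longrightarrow> compact_open_subgroup K \<Longrightarrow> compact_open (right_coset K x)"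
  unfolding right_coset_def by (intro compact_open_right_translation compact_open_subgroupD(2))

lemma content_right_coset:
  "x \<in> carrier G \<Longrightarrow> compact_open_subgroup K \<Longrightarrow> content (right_coset K x) = modular x * content K"
  unfolding right_coset_def by (intro content_right_translation compact_open_subgroupD(2))

lemma mem_right_coset:
  assumes K: "compact_open_subgroup K" and "x \<in> carrier G"
  shows "x \<in> right_coset K x"
  using compact_open_subgroupD(6)[OF K] assms by (auto simp: right_coset_def intro!: image_eqI[of _ _ \<one>])

lemma right_coset_eq:
  assumes K: "compact_open_subgroup K" and x: "x \<in> carrier G" and y: "y \<in> right_coset K x"
  shows "right_coset K y = right_coset K x"
proof -
  note KD = compact_open_subgroupD[OF K]
  obtain k where k: "k \<in> K" "y = k \<otimes> x" using y by (auto simp: right_coset_def)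
  show ?thesis
  proof (intro equalityI subsetI)
    fix z assume "z \<in> right_coset K y"
    then obtain m where m: "m \<in> K" "z = m \<otimes> y" by (auto simp: right_coset_def)
    then have "z = (m \<otimes> k) \<otimes> x" using k x KD(9) by (simp add: m_assoc)
    then show "z \<in> right_coset K x" using KD(7) m k by (auto simp: right_coset_def)
  next
    fix z assume "z \<in> right_coset K x"
    then obtain m where m: "m \<in> K" "z = m \<otimes> x" by (auto simp: right_coset_def)
    then have "z = (m \<otimes> inv k) \<otimes> y" using k x KD(9) by (simp add: m_assoc)
    then show "z \<in> right_coset K y" using KD(7,8) m k by (auto simp: right_coset_def)
  qed
qed

lemma right_cosets_disjoint:
  assumes K: "compact_open_subgroup K" shows "disjoint (right_coset K ` carrier G)"
proof (rule pairwiseI)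
  fix A B assume "A \<in> right_coset K ` carrier G" "B \<in> right_coset K ` carrier G" "A \<noteq> B"
  then obtain a b where ab: "a \<in> carrier G" "b \<in> carrier G" "A = right_coset K a" "B = right_coset K b" by auto
  show "disjnt A B"
  proof (rule ccontr)
    assume "\<not> disjnt A B"
    then obtain z where "z \<in> A" "z \<in> B" by (auto simp: disjnt_def)
    then have "A = B" using right_coset_eq[OF K] ab by metis
    then show False using \<open>A \<noteq> B\<close> by simp
  qed
qed

lemma right_coset_inverse_image:
  assumes K: "compact_open_subgroup K" and x: "x \<in> carrier G"
  shows "(\<lambda>y. inv y \<otimes> x) ` K = right_coset K x"
proof -
  have "(\<lambda>y. inv y \<otimes> x) ` K = (\<lambda>k. k \<otimes> x) ` (\<lambda>y. inv y) ` K" by (simp add: image_image)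
  then show ?thesis by (simp add: inv_image_subgroup[OF K] right_coset_def)
qed

text \<open>The map carries \<open>K\<close> onto its right coset through \<open>x\<close> and
  multiplies measures by \<open>modular x\<close>; the density on the right compensates for this
  factor.\<close>

lemma distr_inverse_translation:
  assumes x: "x \<in> carrier G" and K: "compact_open_subgroup K"
  shows "distr (density haar (\<lambda>y. ennreal (indicator K y))) haar (\<lambda>y. inv y \<otimes> x) =
    density haar (\<lambda>z. ennreal (indicator (right_coset K x) z / modular x))"
proof (rule measure_eqI)
  let ?\<phi> = "\<lambda>y. inv y \<otimes> x" and ?R = "right_coset K x"
  note \<phi> = measurable_inverse_translation[OF x]
  have Ks: "K \<in> sets haar" using compact_open_sets_haar[OF compact_open_subgroupD(2)[OF K]] .
  have Rs: "?R \<in> sets haar" using compact_open_sets_haar[OF right_coset_compact_open[OF x K]] .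
  have m: "modular x > 0" by (rule modular_pos[OF x])
  fix A assume "A \<in> sets (distr (density haar (\<lambda>y. ennreal (indicator K y))) haar ?\<phi>)"
  then have A: "A \<in> sets haar" by simp
  let ?B = "K \<inter> (?\<phi> -` A \<inter> space haar)"
  have B: "?B \<in> sets haar" using Ks measurable_sets[OF \<phi> A] by auto
  have "?\<phi> ` ?B = ?R \<inter> A"
    using right_coset_inverse_image[OF K x, symmetric] compact_open_subgroupD(3)[OF K] by auto
  then have "emeasure haar (?R \<inter> A) = ennreal (modular x) * emeasure haar ?B"
    using emeasure_inverse_translation[OF x K B] by simp
  then have "ennreal (1 / modular x) * emeasure haar (?R \<inter> A) = emeasure haar ?B"
    using m by (simp add: mult.assoc[symmetric] ennreal_mult[symmetric])
  moreover have "emeasure (density haar (\<lambda>z. ennreal (indicator ?R z / modular x))) A = 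
      ennreal (1 / modular x) * emeasure haar (?R \<inter> A)"
  proof -
    have "emeasure (density haar (\<lambda>z. ennreal (indicator ?R z / modular x))) A = 
      (\<integral>\<^sup>+z. ennreal (indicator ?R z / modular x) * indicator A z \<partial>haar)"
      using A Rs by (intro emeasure_density) auto
    also have "\<dots> = (\<integral>\<^sup>+z. ennreal (1 / modular x) * indicator (?R \<inter> A) z \<partial>haar)"
      by (intro nn_integral_cong) (auto split: split_indicator)
    also have "\<dots> = ennreal (1 / modular x) * emeasure haar (?R \<inter> A)"
      using A Rs by (intro nn_integral_cmult_indicator) auto
    finally show ?thesis .
  qed
  moreover have "emeasure (distr (density haar (\<lambda>y. ennreal (indicator K y))) haar ?\<phi>) A = emeasure haar ?B"
  proof -
    have "emeasure (distr (density haar (\<lambda>y. ennreal (indicator K y))) haar ?\<phi>) A = 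
       emeasure (density haar (indicator K)) (?\<phi> -` A \<inter> space haar)"
      using A \<phi> by (simp add: emeasure_distr ennreal_indicator)
    also have "\<dots> = emeasure haar ?B"
      using Ks measurable_sets[OF \<phi> A] by (intro emeasure_restricted) auto
    finally show ?thesis .
  qed
  ultimately show "emeasure (distr (density haar (\<lambda>y. ennreal (indicator K y))) haar ?\<phi>) A = 
     emeasure (density haar (\<lambda>z. ennreal (indicator ?R z / modular x))) A" by simp
qed simp

lemma
  fixes u :: "'a \<Rightarrow> 'v::{banach, second_countable_topology}"
  assumes x: "x \<in> carrier G" and K: "compact_open_subgroup K" and u: "u \<in> borel_measurable haar"
  shows integrable_inverse_translation: "integrable haar (\<lambda>y. (indicator K y :: real) *\<^sub>R u (inv y \<otimes> x)) \<longleftrightarrow> 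
        integrable haar (\<lambda>z. (indicator (right_coset K x) z :: real) *\<^sub>R u z)"
    and integral_inverse_translation: "(LINT y|haar. (indicator K y :: real) *\<^sub>R u (inv y \<otimes> x)) =
        (LINT z|haar. (indicator (right_coset K x) z :: real) *\<^sub>R u z) /\<^sub>R modular x"
proof -
  let ?\<phi> = "\<lambda>y. inv y \<otimes> x" and ?R = "right_coset K x"
  note \<phi> = measurable_inverse_translation[OF x]
  have Ks[measurable]: "K \<in> sets haar" using compact_open_sets_haar[OF compact_open_subgroupD(2)[OF K]] .
  have Rs[measurable]: "?R \<in> sets haar" using compact_open_sets_haar[OF right_coset_compact_open[OF x K]] .
  have m: "modular x > 0" by (rule modular_pos[OF x])
  note [measurable] = u
  have \<phi>'[measurable]: "?\<phi> \<in> measurable (density haar (\<lambda>y. ennreal (indicator K y))) haar" using \<phi> by simp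
  have u\<phi>[measurable]: "(\<lambda>y. u (?\<phi> y)) \<in> borel_measurable haar" using measurable_compose[OF \<phi> u] .
  have "integrable haar (\<lambda>y. (indicator K y :: real) *\<^sub>R u (?\<phi> y)) \<longleftrightarrow> 
      integrable (density haar (\<lambda>y. ennreal (indicator K y))) (\<lambda>y. u (?\<phi> y))"
    by (intro integrable_density[symmetric]) auto
  also have "\<dots> \<longleftrightarrow> integrable (distr (density haar (\<lambda>y. ennreal (indicator K y))) haar ?\<phi>) u"
    by (intro integrable_distr_eq[symmetric] \<phi>' u)
  also have "\<dots> \<longleftrightarrow> integrable haar (\<lambda>z. (indicator ?R z / modular x) *\<^sub>R u z)"
    unfolding distr_inverse_translation[OF x K] using m by (intro integrable_density) auto
  also have "(\<lambda>z. (indicator ?R z / modular x) *\<^sub>R u z) = (\<lambda>z. (1 / modular x) *\<^sub>R ((indicator ?R z :: real) *\<^sub>R u z))"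
    by auto
  also have "integrable haar \<dots> \<longleftrightarrow> integrable haar (\<lambda>z. (indicator ?R z :: real) *\<^sub>R u z)"
  proof
    assume "integrable haar (\<lambda>z. (1 / modular x) *\<^sub>R ((indicator ?R z :: real) *\<^sub>R u z))"
    then have "integrable haar (\<lambda>z. modular x *\<^sub>R ((1 / modular x) *\<^sub>R ((indicator ?R z :: real) *\<^sub>R u z)))"
      by (rule integrable_scaleR_right)
    then show "integrable haar (\<lambda>z. (indicator ?R z :: real) *\<^sub>R u z)"
      by (rule back_subst[of "integrable haar"]) (use m in auto)
  qed (intro integrable_scaleR_right)
  finally show "integrable haar (\<lambda>y. (indicator K y :: real) *\<^sub>R u (?\<phi> y)) \<longleftrightarrow> 
      integrable haar (\<lambda>z. (indicator ?R z :: real) *\<^sub>R u z)" .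
  have "(LINT y|haar. (indicator K y :: real) *\<^sub>R u (?\<phi> y)) = 
      integral\<^sup>L (density haar (\<lambda>y. ennreal (indicator K y))) (\<lambda>y. u (?\<phi> y))"
    by (intro integral_density[symmetric]) auto
  also have "\<dots> = integral\<^sup>L (distr (density haar (\<lambda>y. ennreal (indicator K y))) haar ?\<phi>) u"
    by (intro integral_distr[symmetric] \<phi>' u)
  also have "\<dots> = (LINT z|haar. (indicator ?R z / modular x) *\<^sub>R u z)"
    unfolding distr_inverse_translation[OF x K] using m by (intro integral_density) auto
  also have "(\<lambda>z. (indicator ?R z / modular x) *\<^sub>R u z) = (\<lambda>z. (1 / modular x) *\<^sub>R ((indicator ?R z :: real) *\<^sub>R u z))"
    by auto
  also have "(LINT z|haar. (1 / modular x) *\<^sub>R ((indicator ?R z :: real) *\<^sub>R u z)) = 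
      (LINT z|haar. (indicator ?R z :: real) *\<^sub>R u z) /\<^sub>R modular x"
    by (subst integral_scaleR_right) (simp add: divide_inverse)
  finally show "(LINT y|haar. (indicator K y :: real) *\<^sub>R u (?\<phi> y)) = 
     (LINT z|haar. (indicator ?R z :: real) *\<^sub>R u z) /\<^sub>R modular x" .
qed

lemma complex_indicator_scaleR: "(indicator A x :: complex) * z = (indicator A x :: real) *\<^sub>R z"
  by (simp split: split_indicator)

lemma emeasure_compact_open_finite: "compact_open C \<Longrightarrow> emeasure haar C < \<infinity>"
  by (simp add: emeasure_haar_compact_open)

lemma L2_space_indicator_compact_open: "compact_open C \<Longrightarrow> indicator C \<in> L2_space haar"
  by (intro L2_space_indicator compact_open_sets_haar emeasure_compact_open_finite)

lemma measurable_convolution_integrand: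
  assumes "x \<in> carrier G" "g \<in> borel_measurable haar"
  shows "(\<lambda>y. g (inv y \<otimes> x)) \<in> borel_measurable haar"
  using measurable_compose[OF measurable_inverse_translation[OF assms(1)] assms(2)] .

lemma L2_average_integrand:
  assumes x: "x \<in> carrier G" and K: "compact_open_subgroup K" and g: "g \<in> L2_space haar"
  shows "(\<lambda>y. indicator K y * g (inv y \<otimes> x)) \<in> L2_space haar"
proof -
  let ?u = "\<lambda>z. (cmod (g z))\<^sup>2"
  have Rs: "right_coset K x \<in> sets haar" using compact_open_sets_haar[OF right_coset_compact_open[OF x K]] .
  have Ks: "K \<in> sets haar" using compact_open_sets_haar[OF compact_open_subgroupD(2)[OF K]] .
  have um: "?u \<in> borel_measurable haar" using L2_spaceD(1)[OF g] by simp
  have "integrable haar (\<lambda>z. (indicator (right_coset K x) z :: real) *\<^sub>R ?u z)"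
    using L2_spaceD(2)[OF g] Rs by (rule integrable_mult_indicator[rotated])
  then have "integrable haar (\<lambda>y. (indicator K y :: real) *\<^sub>R ?u (inv y \<otimes> x))"
    using integrable_inverse_translation[OF x K um] by simp
  then show ?thesis
    using Ks measurable_convolution_integrand[OF x L2_spaceD(1)[OF g]]
    by (intro L2_space_bound[where h = "\<lambda>y. (indicator K y :: real) *\<^sub>R ?u (inv y \<otimes> x)"]) 
       (auto simp: norm_mult split: split_indicator)
qed

lemma integrable_average_integrand:
  assumes x: "x \<in> carrier G" and K: "compact_open_subgroup K" and g: "g \<in> L2_space haar"
  shows "integrable haar (\<lambda>y. indicator K y * g (inv y \<otimes> x))"
proof -
  have "integrable haar (\<lambda>y. indicator K y * (indicator K y * g (inv y \<otimes> x)))"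
    using L2_average_integrand[OF assms] L2_space_indicator_compact_open[OF compact_open_subgroupD(2)[OF K]]
    by (rule L2_mult_integrable[rotated])
  moreover have "(\<lambda>y. indicator K y * (indicator K y * g (inv y \<otimes> x))) = (\<lambda>y. indicator K y * g (inv y \<otimes> x))"
    by (auto split: split_indicator)
  ultimately show ?thesis by metis
qed

text \<open>Left invariance of the measure allows \<open>y\<close> to be replaced by
  \<open>k \<otimes> y\<close>, which preserves membership in \<open>K\<close> and cancels
  \<open>k\<close> in the argument of \<open>g\<close>.\<close>

lemma average_left_invariant:
  assumes x: "x \<in> carrier G" and K: "compact_open_subgroup K" and g: "g \<in> L2_space haar" and k: "k \<in> K"
  shows "conv (indicator K) g (k \<otimes> x) = conv (indicator K) g x"
proof -
  note KD = compact_open_subgroupD[OF K]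
  have kG: "k \<in> carrier G" using KD(9) k by simp
  let ?h = "\<lambda>y. indicator K y * g (inv y \<otimes> (k \<otimes> x))"
  have Ks: "K \<in> sets haar" using compact_open_sets_haar[OF KD(2)] .
  have h: "?h \<in> borel_measurable haar"
    using measurable_convolution_integrand[OF _ L2_spaceD(1)[OF g]] kG x Ks by auto
  have "conv (indicator K) g (k \<otimes> x) = (LINT y|haar. ?h (k \<otimes> y))"
    unfolding convolution_operator_def using integral_left_translation[OF kG h] by simp
  also have "\<dots> = (LINT y|haar. indicator K y * g (inv y \<otimes> x))"
  proof (rule Bochner_Integration.integral_cong[OF refl])
    fix y assume "y \<in> space haar"
    then have y: "y \<in> carrier G" by simp
    have "k \<otimes> y \<in> K \<longleftrightarrow> y \<in> K"
      using KD(7)[OF k, of y] KD(7)[OF KD(8)[OF k], of "k \<otimes> y"] kG y by auto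
    moreover have "inv (k \<otimes> y) \<otimes> (k \<otimes> x) = inv y \<otimes> x"
      using kG x y by (simp add: inv_mult_group m_assoc)
    ultimately show "?h (k \<otimes> y) = indicator K y * g (inv y \<otimes> x)" by (simp add: indicator_def)
  qed
  finally show ?thesis by (simp add: convolution_operator_def)
qed

text \<open>Preimages are unions of right cosets of \<open>K\<close>, hence open. This gives
  measurability of averages without integrating in a parameter.\<close>

lemma measurable_left_invariant:
  fixes F :: "'a \<Rightarrow> complex"
  assumes K: "compact_open_subgroup K" and F: "\<And>k x. k \<in> K \<Longrightarrow> x \<in> carrier G \<Longrightarrow> F (k \<otimes> x) = F x"
  shows "F \<in> borel_measurable haar"
proof (rule measurableI)
  fix B :: "complex set"
  have "F -` B \<inter> carrier G = (\<Union>x\<in>F -` B \<inter> carrier G. right_coset K x)"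
  proof (intro equalityI subsetI)
    fix y assume "y \<in> F -` B \<inter> carrier G"
    then show "y \<in> (\<Union>x\<in>F -` B \<inter> carrier G. right_coset K x)" using mem_right_coset[OF K] by blast
  next
    fix y assume "y \<in> (\<Union>x\<in>F -` B \<inter> carrier G. right_coset K x)"
    then obtain x k where "x \<in> carrier G" "F x \<in> B" "k \<in> K" "y = k \<otimes> x" by (auto simp: right_coset_def)
    then show "y \<in> F -` B \<inter> carrier G" using F compact_open_subgroupD(9)[OF K] by auto
  qed
  moreover have "openin X (\<Union>x\<in>F -` B \<inter> carrier G. right_coset K x)"
    using right_coset_compact_open[OF _ K] compact_open_imp_open by (intro openin_Union) auto
  ultimately show "F -` B \<inter> space haar \<in> sets haar" using openin_sets_haar by simp
qed simp

text \<open>Each nonempty intersection of a coset with \<open>W\<close> is open and has positive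
  measure, while these intersections are disjoint subsets of a set of finite measure.\<close>

lemma countable_right_cosets_meeting:
  assumes K: "compact_open_subgroup K" and W: "openin X W" "emeasure haar W < \<infinity>"
  shows "countable {R \<in> right_coset K ` carrier G. R \<inter> W \<noteq> {}}" (is "countable ?F")
proof -
  have op: "openin X (R \<inter> W)" if "R \<in> ?F" for R
    using that W right_coset_compact_open[OF _ K] compact_open_imp_open by (intro openin_Int) auto
  have "countable ((\<lambda>R. R \<inter> W) ` ?F)"
  proof (rule countable_disjoint_positive_measure[OF _ _ openin_sets_haar[OF W(1)] W(2)])
    show "disjoint ((\<lambda>R. R \<inter> W) ` ?F)"
      using right_cosets_disjoint[OF K] by (fastforce simp: pairwise_def disjnt_def)
    show "(\<lambda>R. R \<inter> W) ` ?F \<subseteq> sets haar" using op openin_sets_haar by auto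
    fix A assume "A \<in> (\<lambda>R. R \<inter> W) ` ?F"
    then have A: "openin X A" "A \<noteq> {}" "A \<subseteq> W" using op by auto
    then show "A \<subseteq> W" by simp
    obtain x where x: "x \<in> A" using A by auto
    then have "compactin X {x}" using openin_subset[OF A(1)] by auto
    then obtain C where C: "compact_open C" "{x} \<subseteq> C" "C \<subseteq> A"
      using compact_subset_compact_open A(1) x by (metis empty_subsetI insert_subset)
    have "0 < ennreal (content C)" using content_pos[OF C(1)] C(2) by auto
    also have "\<dots> = emeasure haar C" by (simp add: emeasure_haar_compact_open[OF C(1)])
    also have "\<dots> \<le> emeasure haar A" using C A openin_sets_haar by (intro emeasure_mono) auto
    finally show "emeasure haar A > 0" .
  qed
  moreover have "inj_on (\<lambda>R. R \<inter> W) ?F"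
  proof (rule inj_onI)
    fix R S assume RS: "R \<in> ?F" "S \<in> ?F" "R \<inter> W = S \<inter> W"
    then have "\<not> disjnt R S" by (auto simp: disjnt_def)
    then show "R = S" using right_cosets_disjoint[OF K] RS by (auto simp: pairwise_def)
  qed
  ultimately show ?thesis by (rule countable_image_inj_on)
qed

text \<open>
  The measure need not be \<open>\<sigma>\<close>-finite.  By outer regularity, however, a set of finite measure
  meets only countably many cosets of an open subgroup, which replaces Tonelli's theorem.
\<close>

lemma L2_countable_right_cosets:
  assumes K: "compact_open_subgroup K" and g: "g \<in> L2_space haar"
  obtains F where "countable F" "F \<subseteq> right_coset K ` carrier G"
    "\<And>x. x \<in> carrier G \<Longrightarrow> x \<notin> \<Union>F \<Longrightarrow> g x = 0"
proof -
  \<comment> \<open>These superlevel sets have finite measure by Markov's inequality, and outer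
    regularity encloses each of them in an open set of finite measure.\<close>
  define E where "E n = {x \<in> space haar. 1 / real (Suc n) \<le> (cmod (g x))\<^sup>2}" for n
  have m: "(\<lambda>x. (cmod (g x))\<^sup>2) \<in> borel_measurable haar" using L2_spaceD(1)[OF g] by simp
  have E: "E n \<in> sets haar" "emeasure haar (E n) < \<infinity>" for n
  proof -
    show Es: "E n \<in> sets haar" unfolding E_def using m by measurable
    have "ennreal (1 / real (Suc n)) * emeasure haar (E n) = (\<integral>\<^sup>+x. ennreal (1 / real (Suc n)) * indicator (E n) x \<partial>haar)"
      using Es by (simp add: nn_integral_cmult_indicator)
    also have "\<dots> \<le> (\<integral>\<^sup>+x. ennreal ((cmod (g x))\<^sup>2) \<partial>haar)"
      by (intro nn_integral_mono) (auto simp: E_def split: split_indicator intro!: ennreal_leI)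
    also have "\<dots> < \<infinity>" using L2_spaceD(2)[OF g] by (simp add: integrable_iff_bounded)
    finally have "ennreal (1 / real (Suc n)) * emeasure haar (E n) < \<infinity>" .
    then show "emeasure haar (E n) < \<infinity>"
      by (auto simp: ennreal_mult_less_top)
  qed
  have "\<exists>W. openin X W \<and> E n \<subseteq> W \<and> emeasure haar W < \<infinity>" for n
    using E(2)[of n] unfolding emeasure_haar_outer_regular[OF E(1)] by (auto simp: INF_less_iff)
  then obtain W where W: "\<And>n. openin X (W n)" "\<And>n. E n \<subseteq> W n" "\<And>n. emeasure haar (W n) < \<infinity>" by metis
  define F where "F = (\<Union>n. {R \<in> right_coset K ` carrier G. R \<inter> W n \<noteq> {}})"
  show thesis
  proof (rule that[of F])
    show "countable F" unfolding F_def using countable_right_cosets_meeting[OF K W(1,3)] by auto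
    show "F \<subseteq> right_coset K ` carrier G" by (auto simp: F_def)
    fix x assume x: "x \<in> carrier G" "x \<notin> \<Union>F"
    show "g x = 0"
    proof (rule ccontr)
      assume "g x \<noteq> 0"
      then obtain n where "1 / real (Suc n) < (cmod (g x))\<^sup>2" 
        using nat_approx_posE[of "(cmod (g x))\<^sup>2"] by auto
      then have "x \<in> W n" using x W(2)[of n] by (auto simp: E_def)
      then have "right_coset K x \<in> F" using x mem_right_coset[OF K x(1)] by (auto simp: F_def)
      then show False using x mem_right_coset[OF K x(1)] by blast
    qed
  qed
qed

text \<open>Cauchy-Schwarz against the indicator of \<open>K\<close>, followed by the substitution z
  = inv y x, which produces \<open>modular x\<close>. The factor stays on the left because the right
  coset through \<open>x\<close> has measure \<open>modular x * content K\<close>.\<close>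

lemma cmod_average_squared_le:
  assumes x: "x \<in> carrier G" and K: "compact_open_subgroup K" and g: "g \<in> L2_space haar"
  shows "modular x * (cmod (conv (indicator K) g x))\<^sup>2 \<le> 
    content K * (LINT z|haar. indicator (right_coset K x) z * (cmod (g z))\<^sup>2)"
proof -
  let ?h = "\<lambda>y. indicator K y * g (inv y \<otimes> x)" and ?u = "\<lambda>z. (cmod (g z))\<^sup>2"
  note KD = compact_open_subgroupD[OF K]
  have um: "?u \<in> borel_measurable haar" using L2_spaceD(1)[OF g] by simp
  have m: "modular x > 0" by (rule modular_pos[OF x])
  have "conv (indicator K) g x = (LINT y|haar. indicator K y * ?h y)"
    unfolding convolution_operator_def by (intro Bochner_Integration.integral_cong) (auto split: split_indicator)
  then have "cmod (conv (indicator K) g x) \<le> L2_norm haar (indicator K) * L2_norm haar ?h"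
    using Cauchy_Schwarz[OF L2_space_indicator_compact_open[OF KD(2)] L2_average_integrand[OF assms]] by simp
  then have "(cmod (conv (indicator K) g x))\<^sup>2 \<le> (L2_norm haar (indicator K) * L2_norm haar ?h)\<^sup>2"
    by (intro power_mono) auto
  also have "(L2_norm haar (indicator K))\<^sup>2 = content K"
    using L2_norm_indicator[OF compact_open_sets_haar[OF KD(2)] emeasure_compact_open_finite[OF KD(2)]]
    by (simp add: measure_haar_compact_open[OF KD(2)])
  then have "(L2_norm haar (indicator K) * L2_norm haar ?h)\<^sup>2 = content K * (LINT y|haar. (cmod (?h y))\<^sup>2)"
    by (simp add: power_mult_distrib L2_norm_squared)
  also have "(LINT y|haar. (cmod (?h y))\<^sup>2) = (LINT y|haar. (indicator K y :: real) *\<^sub>R ?u (inv y \<otimes> x))"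
    by (intro Bochner_Integration.integral_cong) (auto split: split_indicator)
  also have "\<dots> = (LINT z|haar. (indicator (right_coset K x) z :: real) *\<^sub>R ?u z) /\<^sub>R modular x"
    by (rule integral_inverse_translation[OF x K um])
  finally show ?thesis using m by (simp add: field_simps)
qed

text \<open>On each right coset of \<open>K\<close> the convolution is constant, so the preceding
  estimate is an L2 bound over that coset with constant \<open>content K\<close>. The argument
  \<open>inv y \<otimes> x\<close> stays in the coset of \<open>x\<close>, so cosets on which
  \<open>g\<close> vanishes contribute nothing, and the bounds are added over countably many
  cosets.\<close>

lemma L2_average:
  assumes K: "compact_open_subgroup K" and g: "g \<in> L2_space haar"
  shows "conv (indicator K) g \<in> L2_space haar"
    and "L2_norm haar (conv (indicator K) g) \<le> content K * L2_norm haar g"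
proof -
  let ?c = "conv (indicator K) g"
  note KD = compact_open_subgroupD[OF K]
  have Kpos: "content K > 0" using KD(2,6) by (intro content_pos) auto
  obtain F where F: "countable F" "F \<subseteq> right_coset K ` carrier G"
      "\<And>x. x \<in> carrier G \<Longrightarrow> x \<notin> \<Union>F \<Longrightarrow> g x = 0"
    using L2_countable_right_cosets[OF assms] by blast
  have cm: "?c \<in> borel_measurable haar"
    using measurable_left_invariant[OF K] average_left_invariant[OF _ K g] by blast
  have gm: "g \<in> borel_measurable haar" using L2_spaceD(1)[OF g] .
  let ?u = "\<lambda>x. ennreal ((cmod (?c x))\<^sup>2)" and ?v = "\<lambda>x. ennreal ((content K)\<^sup>2 * (cmod (g x))\<^sup>2)"
  have um: "?u \<in> borel_measurable haar" and vm: "?v \<in> borel_measurable haar" using cm gm by auto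
  have Rs: "R \<in> sets haar" if "R \<in> F" for R
    using that F(2) right_coset_compact_open[OF _ K] compact_open_sets_haar by auto
  have Fs: "\<Union>F \<in> sets haar" using Rs F(1) by (intro sets.countable_Union) auto
  have disj: "disjoint_family_on (\<lambda>R. R) F"
    unfolding disjoint_family_on_def
    by (intro ballI impI disjointD[OF right_cosets_disjoint[OF K]]) (use F(2) in auto)
  have coset: "(\<integral>\<^sup>+z. ?u z * indicator R z \<partial>haar) \<le> (\<integral>\<^sup>+z. ?v z * indicator R z \<partial>haar)" if R: "R \<in> F" for R
  proof -
    obtain x where x: "x \<in> carrier G" "R = right_coset K x" using subsetD[OF F(2) R] by (auto elim: imageE)
    have "(\<integral>\<^sup>+z. ?u z * indicator R z \<partial>haar) = (\<integral>\<^sup>+z. ?u x * indicator R z \<partial>haar)"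
    proof (rule nn_integral_cong)
      fix z
      show "?u z * indicator R z = ?u x * indicator R z"
        using average_left_invariant[OF x(1) K g] by (auto simp: x(2) right_coset_def split: split_indicator)
    qed
    also have "\<dots> = ?u x * emeasure haar R" using Rs[OF R] by (simp add: nn_integral_cmult_indicator)
    also have "emeasure haar R = ennreal (modular x * content K)"
      using emeasure_haar_compact_open[OF right_coset_compact_open[OF x(1) K]] content_right_coset[OF x(1) K] x by simp
    also have "?u x * ennreal (modular x * content K) = ennreal (content K * (modular x * (cmod (?c x))\<^sup>2))"
      using modular_pos[OF x(1)] by (simp add: ennreal_mult[symmetric] mult_ac)
    also have "\<dots> \<le> ennreal (content K * (content K * (LINT z|haar. indicator R z * (cmod (g z))\<^sup>2)))"
      using cmod_average_squared_le[OF x(1) K g] Kpos x(2) by (intro ennreal_leI mult_left_mono) auto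
    also have "\<dots> = ennreal (LINT z|haar. (content K)\<^sup>2 * (indicator R z * (cmod (g z))\<^sup>2))"
      by (subst integral_mult_right_zero) (simp add: power2_eq_square mult.assoc)
    also have "\<dots> = (\<integral>\<^sup>+z. ennreal ((content K)\<^sup>2 * (indicator R z * (cmod (g z))\<^sup>2)) \<partial>haar)"
      using integrable_mult_indicator[OF Rs[OF R] L2_spaceD(2)[OF g]]
      by (intro nn_integral_eq_integral[symmetric]) (auto intro!: integrable_mult_right)
    also have "\<dots> = (\<integral>\<^sup>+z. ?v z * indicator R z \<partial>haar)"
      by (intro nn_integral_cong) (auto split: split_indicator)
    finally show ?thesis .
  qed
  have "(\<integral>\<^sup>+z. ?u z \<partial>haar) = (\<integral>\<^sup>+z. ?u z * indicator (\<Union>F) z \<partial>haar)"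
  proof (rule nn_integral_cong)
    fix x assume "x \<in> space haar"
    then have x: "x \<in> carrier G" by simp
    have "?c x = 0" if xF: "x \<notin> \<Union>F"
    proof -
      have "indicator K y * g (inv y \<otimes> x) = 0" if y: "y \<in> carrier G" for y
      proof (cases "y \<in> K")
        case True
        have e: "inv y \<otimes> x \<in> right_coset K x" using right_coset_inverse_image[OF K x] True by blast
        have "inv y \<otimes> x \<notin> \<Union>F"
        proof
          assume "inv y \<otimes> x \<in> \<Union>F"
          then obtain R where R: "R \<in> F" "inv y \<otimes> x \<in> R" by auto
          moreover obtain z where z: "z \<in> carrier G" "R = right_coset K z" using R F(2) by auto
          ultimately have "R = right_coset K x"
            using right_coset_eq[OF K x e] right_coset_eq[OF K z(1)] by metis
          then show False using R mem_right_coset[OF K x] xF by blast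
        qed
        then show ?thesis using F(3) x y by simp
      qed simp
      then have "?c x = (LINT y|haar. 0)"
        unfolding convolution_operator_def by (intro Bochner_Integration.integral_cong) auto
      then show ?thesis by simp
    qed
    then show "?u x = ?u x * indicator (\<Union>F) x" by (auto simp: indicator_def)
  qed
  also have "\<dots> = emeasure (density haar ?u) (\<Union>F)"
    by (rule emeasure_density[symmetric, OF um Fs])
  also have "\<dots> = (\<integral>\<^sup>+R. emeasure (density haar ?u) R \<partial>count_space F)"
    using emeasure_UN_countable[OF _ F(1) disj, of "density haar ?u"] Rs by simp
  also have "\<dots> \<le> (\<integral>\<^sup>+R. emeasure (density haar ?v) R \<partial>count_space F)"
    using coset Rs um vm by (intro nn_integral_mono) (simp add: emeasure_density)
  also have "\<dots> = emeasure (density haar ?v) (\<Union>F)"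
    using emeasure_UN_countable[OF _ F(1) disj, of "density haar ?v"] Rs by simp
  also have "\<dots> \<le> (\<integral>\<^sup>+z. ?v z \<partial>haar)"
    unfolding emeasure_density[OF vm Fs] by (intro nn_integral_mono) (auto split: split_indicator)
  also have "\<dots> = ennreal ((content K)\<^sup>2 * (L2_norm haar g)\<^sup>2)"
    using L2_spaceD(2)[OF g] by (subst nn_integral_eq_integral) (auto simp: L2_norm_squared)
  finally have le: "(\<integral>\<^sup>+z. ?u z \<partial>haar) \<le> ennreal ((content K)\<^sup>2 * (L2_norm haar g)\<^sup>2)" .
  then have int: "integrable haar (\<lambda>x. (cmod (?c x))\<^sup>2)"
    using cm by (intro integrableI_bounded) (auto intro: order_le_less_trans)
  then show "?c \<in> L2_space haar" using cm by (simp add: L2_space_def)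
  have "ennreal ((L2_norm haar ?c)\<^sup>2) \<le> ennreal ((content K)\<^sup>2 * (L2_norm haar g)\<^sup>2)"
    using le nn_integral_eq_integral[OF int] by (simp add: L2_norm_squared)
  then have "(L2_norm haar ?c)\<^sup>2 \<le> (content K * L2_norm haar g)\<^sup>2"
    by (simp add: power_mult_distrib)
  then show "L2_norm haar ?c \<le> content K * L2_norm haar g"
    by (rule power2_le_imp_le) simp
qed

end

section \<open>Convolution operators\<close>

context td_group
begin

lemma left_coset_compact_open:
  "a \<in> carrier G \<Longrightarrow> compact_open_subgroup L \<Longrightarrow> compact_open ((\<lambda>l. a \<otimes> l) ` L)"
  by (intro compact_open_left_translation compact_open_subgroupD(2))

lemma left_cosets_compact_open:
  "C \<subseteq> carrier G \<Longrightarrow> compact_open_subgroup L \<Longrightarrow> A \<in> left_cosets L C \<Longrightarrow> compact_open A"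
  by (auto simp: left_cosets_def intro: left_coset_compact_open)

lemma content_eq_card_left_cosets:
  assumes C: "compact_open C" and L: "compact_open_subgroup L" "right_invariant L C"
  shows "content C = card (left_cosets L C) * content L"
  using content_left_translation[OF _ compact_open_subgroupD(2)[OF L(1)]] compact_open_subset[OF C(1)]
  by (intro additive_eq_card_left_cosets[OF C(1) L, where F = content]) (auto intro: content_Un)

text \<open>Left invariance of the measure turns a translate of the set into a translate of the
  convolution; arbitrary left cosets thus inherit the bounds for averages over subgroups.\<close>

lemma
  assumes t: "t \<in> carrier G" and x: "x \<in> carrier G" and K: "compact_open_subgroup K" and g: "g \<in> L2_space haar"
  shows conv_left_coset: "conv (indicator ((\<lambda>k. t \<otimes> k) ` K)) g x = conv (indicator K) g (inv t \<otimes> x)"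
    and integrable_conv_left_coset: 
      "integrable haar (\<lambda>y. indicator ((\<lambda>k. t \<otimes> k) ` K) y * g (inv y \<otimes> x))"
proof -
  let ?A = "(\<lambda>k. t \<otimes> k) ` K"
  let ?h = "\<lambda>y. indicator ?A y * g (inv y \<otimes> x)"
  have As: "?A \<in> sets haar" using compact_open_sets_haar[OF left_coset_compact_open[OF t K]] .
  have h: "?h \<in> borel_measurable haar"
    using measurable_convolution_integrand[OF x L2_spaceD(1)[OF g]] As by auto
  have eq: "?h (t \<otimes> y) = indicator K y * g (inv y \<otimes> (inv t \<otimes> x))" if y: "y \<in> space haar" for y
  proof -
    have yG: "y \<in> carrier G" using y by simp
    have "t \<otimes> y \<in> ?A \<longleftrightarrow> y \<in> K"
      using t yG compact_open_subgroupD(9)[OF K] by auto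
    moreover have "inv (t \<otimes> y) \<otimes> x = inv y \<otimes> (inv t \<otimes> x)"
      using t x yG by (simp add: inv_mult_group m_assoc)
    ultimately show ?thesis by (simp add: indicator_def)
  qed
  show "conv (indicator ?A) g x = conv (indicator K) g (inv t \<otimes> x)"
    unfolding convolution_operator_def integral_left_translation[OF t h, symmetric]
    by (rule Bochner_Integration.integral_cong[OF refl eq])
  have "integrable haar (\<lambda>y. ?h (t \<otimes> y))"
    using integrable_average_integrand[OF _ K g, of "inv t \<otimes> x"] t x
    by (subst Bochner_Integration.integrable_cong[OF refl eq]) auto
  then show "integrable haar ?h" using integrable_left_translation[OF t h] by simp
qed

section \<open>Convolution by step functions\<close>

definition representative :: "'a set \<Rightarrow> 'a" where
  "representative A = (SOME a. a \<in> A)"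

lemma representative_left_coset:
  assumes C: "C \<subseteq> carrier G" and L: "compact_open_subgroup L" and A: "A \<in> left_cosets L C"
  shows "representative A \<in> A" "representative A \<in> carrier G" "(\<lambda>l. representative A \<otimes> l) ` L = A"
proof -
  note sL = compact_open_subgroupD(1)[OF L]
  obtain c where c: "c \<in> C" "A = (\<lambda>l. c \<otimes> l) ` L" using A by (auto simp: left_cosets_def)
  then have "c \<in> A" using mem_left_coset_self[OF sL] C by auto
  then show r: "representative A \<in> A" unfolding representative_def by (rule someI)
  show "(\<lambda>l. representative A \<otimes> l) ` L = A" using left_coset_eq[OF sL, of c "representative A"] r c C by blast
  show "representative A \<in> carrier G"
    using r compact_open_subset[OF left_cosets_compact_open[OF C L A]] by auto
qed

text \<open>\<open>f\<close> is sampled at one point of each left coset. Convolution by the result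
  is a finite combination of left translates of an average over \<open>L\<close>, for which an L2
  bound is available.\<close>

definition step_function :: "'a set \<Rightarrow> 'a set \<Rightarrow> ('a \<Rightarrow> complex) \<Rightarrow> 'a \<Rightarrow> complex" where
  "step_function L C f y = (\<Sum>A\<in>left_cosets L C. f (representative A) * indicator A y)"

lemma step_function_eq:
  assumes C: "compact_open C" and L: "compact_open_subgroup L" "right_invariant L C" and A: "A \<in> left_cosets L C" "y \<in> A"
  shows "step_function L C f y = f (representative A)"
proof -
  have CG: "C \<subseteq> carrier G" by (rule compact_open_subset[OF C])
  have fin: "finite (left_cosets L C)" using C L finite_left_cosets by (auto simp: compact_open_def)
  have "indicator B y = (0 :: complex)" if "B \<in> left_cosets L C - {A}" for B
    using left_cosets_disjoint[OF compact_open_subgroupD(1)[OF L(1)], of A B] A that left_cosets_mono[OF CG]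
    by (auto simp: indicator_def)
  then show ?thesis
    unfolding step_function_def using A by (subst sum.remove[OF fin A(1)]) simp
qed

lemma step_function_outside:
  assumes C: "compact_open C" and L: "compact_open_subgroup L" "right_invariant L C" and y: "y \<notin> C"
  shows "step_function L C f y = 0"
proof -
  have "y \<notin> A" if "A \<in> left_cosets L C" for A
    using that Union_left_cosets[OF compact_open_subgroupD(1)[OF L(1)] L(2) compact_open_subset[OF C]] y by blast
  then show ?thesis by (simp add: step_function_def)
qed

lemma step_function_indicator:
  assumes C: "compact_open C" and L: "compact_open_subgroup L" "right_invariant L C"
  shows "step_function L C (\<lambda>y. 1) = indicator C"
proof
  fix y
  show "step_function L C (\<lambda>y. 1) y = indicator C y"
  proof (cases "y \<in> C")
    case True
    then obtain A where "A \<in> left_cosets L C" "y \<in> A"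
      using Union_left_cosets[OF compact_open_subgroupD(1)[OF L(1)] L(2) compact_open_subset[OF C]] by blast
    then show ?thesis using step_function_eq[OF C L] True by simp
  qed (simp add: step_function_outside[OF C L])
qed

lemma
  assumes C: "compact_open C" and L: "compact_open_subgroup L" "right_invariant L C"
    and x: "x \<in> carrier G" and g: "g \<in> L2_space haar"
  shows conv_step_function: "conv (step_function L C f) g x = 
      (\<Sum>A\<in>left_cosets L C. f (representative A) * conv (indicator L) g (inv (representative A) \<otimes> x))"
    and integrable_conv_step_function: "integrable haar (\<lambda>y. step_function L C f y * g (inv y \<otimes> x))"
proof -
  have CG: "C \<subseteq> carrier G" by (rule compact_open_subset[OF C])
  have eq: "step_function L C f y * g (inv y \<otimes> x) = 
     (\<Sum>A\<in>left_cosets L C. f (representative A) * (indicator A y * g (inv y \<otimes> x)))" for y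
    by (simp add: step_function_def sum_distrib_right mult.assoc)
  have A: "integrable haar (\<lambda>y. indicator A y * g (inv y \<otimes> x))"
    "conv (indicator A) g x = conv (indicator L) g (inv (representative A) \<otimes> x)" if A: "A \<in> left_cosets L C" for A
    using integrable_conv_left_coset[OF representative_left_coset(2)[OF CG L(1) A] x L(1) g]
      conv_left_coset[OF representative_left_coset(2)[OF CG L(1) A] x L(1) g]
      representative_left_coset(3)[OF CG L(1) A] by simp_all
  show "integrable haar (\<lambda>y. step_function L C f y * g (inv y \<otimes> x))"
    unfolding eq using A(1) by (intro Bochner_Integration.integrable_sum integrable_mult_right) auto
  have "conv (step_function L C f) g x = (\<Sum>A\<in>left_cosets L C. f (representative A) * conv (indicator A) g x)"
    unfolding convolution_operator_def eq using A(1) 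
    by (subst Bochner_Integration.integral_sum) (auto intro: integrable_mult_right)
  also have "\<dots> = (\<Sum>A\<in>left_cosets L C. f (representative A) * conv (indicator L) g (inv (representative A) \<otimes> x))"
    using A(2) by (intro sum.cong) auto
  finally show "conv (step_function L C f) g x = 
      (\<Sum>A\<in>left_cosets L C. f (representative A) * conv (indicator L) g (inv (representative A) \<otimes> x))" .
qed

lemma L2_space_cong: "(\<And>x. x \<in> space M \<Longrightarrow> f x = g x) \<Longrightarrow> f \<in> L2_space M \<longleftrightarrow> g \<in> L2_space M"
  unfolding L2_space_def mem_Collect_eq
  by (intro conj_cong measurable_cong Bochner_Integration.integrable_cong) auto

lemma L2_conv_step_function:
  assumes C: "compact_open C" and L: "compact_open_subgroup L" "right_invariant L C" and g: "g \<in> L2_space haar"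
  shows "conv (step_function L C f) g \<in> L2_space haar"
    and "L2_norm haar (conv (step_function L C f) g) \<le> 
      (\<Sum>A\<in>left_cosets L C. cmod (f (representative A)) * (content L * L2_norm haar g))"
proof -
  have CG: "C \<subseteq> carrier G" by (rule compact_open_subset[OF C])
  let ?s = "\<lambda>A x. f (representative A) * conv (indicator L) g (inv (representative A) \<otimes> x)"
  have s: "?s A \<in> L2_space haar" "L2_norm haar (?s A) \<le> cmod (f (representative A)) * (content L * L2_norm haar g)" 
    if A: "A \<in> left_cosets L C" for A
  proof -
    have r: "inv (representative A) \<in> carrier G" using representative_left_coset(2)[OF CG L(1) A] by simp
    show "?s A \<in> L2_space haar"
      by (intro L2_space_scale L2_left_translation[OF r] L2_average[OF L(1) g])
    have "L2_norm haar (?s A) = cmod (f (representative A)) * L2_norm haar (conv (indicator L) g)"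
      unfolding L2_norm_scale using L2_left_translation(2)[OF r L2_average(1)[OF L(1) g]] by simp
    also have "\<dots> \<le> cmod (f (representative A)) * (content L * L2_norm haar g)"
      by (intro mult_left_mono L2_average(2)[OF L(1) g]) auto
    finally show "L2_norm haar (?s A) \<le> cmod (f (representative A)) * (content L * L2_norm haar g)" .
  qed
  have eq: "conv (step_function L C f) g x = (\<Sum>A\<in>left_cosets L C. ?s A x)" if "x \<in> space haar" for x
    using conv_step_function[OF C L _ g] that by simp
  show "conv (step_function L C f) g \<in> L2_space haar"
    using s(1) by (subst L2_space_cong[OF eq]) (auto intro: L2_space_sum)
  have "L2_norm haar (conv (step_function L C f) g) = L2_norm haar (\<lambda>x. \<Sum>A\<in>left_cosets L C. ?s A x)"
    by (rule L2_norm_cong[OF eq])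
  also have "\<dots> \<le> (\<Sum>A\<in>left_cosets L C. L2_norm haar (?s A))"
    by (rule L2_norm_sum_le[OF s(1)])
  also have "\<dots> \<le> (\<Sum>A\<in>left_cosets L C. cmod (f (representative A)) * (content L * L2_norm haar g))"
    by (rule sum_mono[OF s(2)])
  finally show "L2_norm haar (conv (step_function L C f) g) \<le> 
      (\<Sum>A\<in>left_cosets L C. cmod (f (representative A)) * (content L * L2_norm haar g))" .
qed

text \<open>The indicator of \<open>C\<close> is the step function of the constant 1, and
  \<open>content C\<close> is the number of cosets times \<open>content L\<close>, so the triangle
  inequality over the cosets produces the constant \<open>content C\<close>.\<close>

lemma 
  assumes C: "compact_open C" and g: "g \<in> L2_space haar"
  shows L2_conv_indicator: "conv (indicator C) g \<in> L2_space haar"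
    and L2_norm_conv_indicator: "L2_norm haar (conv (indicator C) g) \<le> content C * L2_norm haar g"
    and integrable_conv_indicator: "x \<in> carrier G \<Longrightarrow> integrable haar (\<lambda>y. indicator C y * g (inv y \<otimes> x))"
proof -
  obtain L where L: "compact_open_subgroup L" "right_invariant L C"
    using exists_adapted_subgroup[OF C base_subgroup] by blast
  show "conv (indicator C) g \<in> L2_space haar"
    using L2_conv_step_function(1)[OF C L g, of "\<lambda>y. 1"] by (simp add: step_function_indicator[OF C L])
  show "L2_norm haar (conv (indicator C) g) \<le> content C * L2_norm haar g"
    using L2_conv_step_function(2)[OF C L g, of "\<lambda>y. 1"] content_eq_card_left_cosets[OF C L]
    by (simp add: step_function_indicator[OF C L])
  show "integrable haar (\<lambda>y. indicator C y * g (inv y \<otimes> x))" if "x \<in> carrier G"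
    using integrable_conv_step_function[OF C L that g, of "\<lambda>y. 1"] by (simp add: step_function_indicator[OF C L])
qed

text \<open>Size and support of a function, in particular of the difference between a function and
  its step approximation, are controlled by one inequality. It is required on the carrier, as
  functions are unconstrained elsewhere.\<close>

definition dominated :: "'a set \<Rightarrow> real \<Rightarrow> ('a \<Rightarrow> complex) \<Rightarrow> bool" where
  "dominated C B f \<longleftrightarrow> f \<in> borel_measurable haar \<and> B \<ge> 0 \<and> (\<forall>y\<in>carrier G. cmod (f y) \<le> B * indicator C y)"

lemma dominatedD:
  assumes "dominated C B f"
  shows "f \<in> borel_measurable haar" "B \<ge> 0" "y \<in> carrier G \<Longrightarrow> cmod (f y) \<le> B"
    "y \<in> carrier G \<Longrightarrow> y \<notin> C \<Longrightarrow> f y = 0"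
proof -
  show "f \<in> borel_measurable haar" "B \<ge> 0" using assms by (auto simp: dominated_def)
  assume y: "y \<in> carrier G"
  then have *: "cmod (f y) \<le> B * indicator C y" using assms by (auto simp: dominated_def)
  show "cmod (f y) \<le> B" using * \<open>B \<ge> 0\<close> by (cases "y \<in> C") auto
  show "f y = 0" if "y \<notin> C" using * that by simp
qed

text \<open>Moving the modulus inside the integral leaves a convolution of |g| with a multiple of an
  indicator. The bound is written as a \<open>cmod\<close> so that it fits
  \<open>L2_norm_mono\<close>.\<close>

lemma
  assumes C: "compact_open C" and f: "dominated C B f" and g: "g \<in> L2_space haar" and x: "x \<in> carrier G"
  shows integrable_conv: "integrable haar (\<lambda>y. f y * g (inv y \<otimes> x))"
    and cmod_conv_le: "cmod (conv f g x) \<le> cmod (B * conv (indicator C) (\<lambda>z. complex_of_real (cmod (g z))) x)"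
proof -
  let ?g = "\<lambda>z. complex_of_real (cmod (g z))"
  have B: "B \<ge> 0" using f by (simp add: dominated_def)
  have int: "integrable haar (\<lambda>y. B * (indicator C y * ?g (inv y \<otimes> x)))"
    using integrable_conv_indicator[OF C L2_space_cmod[OF g] x] by (rule integrable_mult_right)
  have le: "cmod (f y * g (inv y \<otimes> x)) \<le> cmod (B * (indicator C y * ?g (inv y \<otimes> x)))" if "y \<in> space haar" for y
  proof -
    have "cmod (f y * g (inv y \<otimes> x)) \<le> (B * indicator C y) * cmod (g (inv y \<otimes> x))"
      unfolding norm_mult using f that by (intro mult_right_mono) (auto simp: dominated_def)
    then show ?thesis using B by (cases "y \<in> C") (auto simp: norm_mult)
  qed
  show i: "integrable haar (\<lambda>y. f y * g (inv y \<otimes> x))"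
    using f measurable_convolution_integrand[OF x L2_spaceD(1)[OF g]] le
    by (intro Bochner_Integration.integrable_bound[OF int] AE_I2) (auto simp: dominated_def)
  have "cmod (conv f g x) \<le> (LINT y|haar. cmod (f y * g (inv y \<otimes> x)))"
    unfolding convolution_operator_def by (rule integral_norm_bound)
  also have "\<dots> \<le> (LINT y|haar. cmod (B * (indicator C y * ?g (inv y \<otimes> x))))"
    using i int le by (intro integral_mono integrable_norm) auto
  also have "\<dots> = (LINT y|haar. Re (B * (indicator C y * ?g (inv y \<otimes> x))))"
    using B by (intro Bochner_Integration.integral_cong) (auto simp: norm_mult split: split_indicator)
  also have "\<dots> = Re (LINT y|haar. B * (indicator C y * ?g (inv y \<otimes> x)))"
    using int by (rule integral_Re)
  also have "\<dots> = Re (B * conv (indicator C) ?g x)" by (simp add: convolution_operator_def)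
  also have "\<dots> \<le> cmod (B * conv (indicator C) ?g x)" by (rule complex_Re_le_cmod)
  finally show "cmod (conv f g x) \<le> cmod (B * conv (indicator C) ?g x)" .
qed

text \<open>The measurability assumption \<open>m\<close> is supplied by
  \<open>conv_measurable\<close> when \<open>f\<close> is continuous with compact support.\<close>

lemma L2_norm_conv_dominated:
  assumes C: "compact_open C" and f: "dominated C B f" and g: "g \<in> L2_space haar"
    and m: "conv f g \<in> borel_measurable haar"
  shows "conv f g \<in> L2_space haar" "L2_norm haar (conv f g) \<le> B * content C * L2_norm haar g"
proof -
  let ?h = "\<lambda>x. B * conv (indicator C) (\<lambda>z. complex_of_real (cmod (g z))) x"
  have h: "?h \<in> L2_space haar" by (intro L2_space_scale L2_conv_indicator[OF C] L2_space_cmod g)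
  have B: "B \<ge> 0" using f by (simp add: dominated_def)
  have le: "cmod (conv f g x) \<le> cmod (?h x)" if "x \<in> space haar" for x
    using cmod_conv_le[OF C f g] that by simp
  show "conv f g \<in> L2_space haar"
    using L2_spaceD(2)[OF h] le by (intro L2_space_bound[OF m]) (auto intro!: power_mono)
  have "L2_norm haar (conv f g) \<le> L2_norm haar ?h"
    using m h le by (intro L2_norm_mono AE_I2) auto
  also have "\<dots> \<le> B * (content C * L2_norm haar (\<lambda>z. complex_of_real (cmod (g z))))"
    unfolding L2_norm_scale using B
    by (auto intro!: mult_left_mono L2_norm_conv_indicator[OF C] L2_space_cmod g)
  finally show "L2_norm haar (conv f g) \<le> B * content C * L2_norm haar g"
    by (simp add: L2_norm_def mult.assoc)
qed

lemma conv_diff: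
  assumes C: "compact_open C" and f: "dominated C B f" "dominated C B' f'" 
    and g: "g \<in> L2_space haar" and x: "x \<in> carrier G"
  shows "conv (\<lambda>y. f y - f' y) g x = conv f g x - conv f' g x"
  using integrable_conv[OF C f(1) g x] integrable_conv[OF C f(2) g x]
  by (simp add: convolution_operator_def left_diff_distrib)

lemma dominated_step_function:
  assumes C: "compact_open C" and L: "compact_open_subgroup L" "right_invariant L C"
    and f: "\<And>y. y \<in> carrier G \<Longrightarrow> cmod (f y) \<le> B" and B: "B \<ge> 0"
  shows "dominated C B (step_function L C f)"
  unfolding dominated_def
proof (intro conjI ballI)
  have CG: "C \<subseteq> carrier G" by (rule compact_open_subset[OF C])
  show "step_function L C f \<in> borel_measurable haar"
    unfolding step_function_def[abs_def]
    using left_cosets_compact_open[OF CG L(1)] compact_open_sets_haar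
    by (intro borel_measurable_sum borel_measurable_times borel_measurable_indicator) auto
  fix y assume "y \<in> carrier G"
  show "cmod (step_function L C f y) \<le> B * indicator C y"
  proof (cases "y \<in> C")
    case True
    then obtain A where A: "A \<in> left_cosets L C" "y \<in> A"
      using Union_left_cosets[OF compact_open_subgroupD(1)[OF L(1)] L(2) CG] by blast
    then show ?thesis 
      using step_function_eq[OF C L A] True f representative_left_coset(2)[OF CG L(1) A(1)] by simp
  qed (simp add: step_function_outside[OF C L])
qed (fact B)

lemma compactly_supported_dominated:
  assumes f: "f \<in> compactly_supported X"
  obtains C B where "compact_open C" "dominated C B f"
proof -
  let ?S = "X closure_of {x \<in> topspace X. f x \<noteq> 0}"
  have cf: "continuous_map X euclidean f" and cS: "compactin X ?S"
    using f by (auto simp: compactly_supported_def)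
  obtain C where C: "compact_open C" "?S \<subseteq> C"
    using compact_subset_compact_open[OF cS openin_topspace] closure_of_subset_topspace by metis
  have "compactin euclidean (f ` C)"
    using image_compactin[of X C euclidean f] C(1) cf unfolding compact_open_def by blast
  then have "bounded (f ` C)" by (intro compact_imp_bounded) simp
  then obtain B where B: "\<And>y. y \<in> C \<Longrightarrow> cmod (f y) \<le> B" by (auto simp: bounded_iff)
  have zero: "f y = 0" if "y \<in> carrier G" "y \<notin> C" for y
  proof (rule ccontr)
    assume "f y \<noteq> 0"
    then have "y \<in> ?S" using that closure_of_subset[of "{x \<in> topspace X. f x \<noteq> 0}" X] by auto
    then show False using that C(2) by auto
  qed
  have "f \<in> borel_measurable haar"
  proof (rule borel_measurableI)
    fix S :: "complex set" assume "open S"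
    then have "openin X {x \<in> topspace X. f x \<in> S}"
      using openin_continuous_map_preimage[OF cf] by simp
    moreover have "f -` S \<inter> space haar = {x \<in> topspace X. f x \<in> S}" by auto
    ultimately show "f -` S \<inter> space haar \<in> sets haar" by (simp add: openin_sets_haar)
  qed
  moreover have "cmod (f y) \<le> max B 0 * indicator C y" if "y \<in> carrier G" for y
    using B[of y] zero[OF that] by (auto simp: indicator_def)
  ultimately have "dominated C (max B 0) f" by (auto simp: dominated_def)
  with C(1) that show thesis by blast
qed

text \<open>The pairs \<open>(c, n)\<close> along which \<open>f\<close> varies by at least
  \<open>e\<close> form a closed set; its projection along the compact \<open>C\<close> is closed
  and misses the identity. If only \<open>y \<otimes> l\<close> lies in \<open>C\<close>, the
  estimate is used there with \<open>inv l\<close>.\<close>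

lemma uniformly_right_continuous:
  assumes f: "f \<in> compactly_supported X" and C: "compact_open C" "dominated C B f" and e: "e > 0" 
    and L0: "compact_open_subgroup L0"
  obtains L where "compact_open_subgroup L" "L \<subseteq> L0"
    "\<And>y l. y \<in> carrier G \<Longrightarrow> l \<in> L \<Longrightarrow> cmod (f (y \<otimes> l) - f y) < e"
proof -
  have cf: "continuous_map X euclidean f" using f by (simp add: compactly_supported_def)
  have CX: "C \<subseteq> carrier G" using C(1) by (rule compact_open_subset)
  let ?Z = "prod_topology (subtopology X C) X"
  have snd: "closed_map ?Z X snd"
    by (rule closed_map_snd) (use C(1) in \<open>simp add: compact_open_def compact_space_subtopology\<close>)
  have fst: "continuous_map ?Z X fst" 
    by (auto intro: continuous_map_into_fulltopology continuous_map_fst)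
  have "continuous_map ?Z X (\<lambda>z. fst z \<otimes> snd z)"
    by (intro continuous_map_mult fst continuous_map_snd)
  from continuous_map_compose[OF this cf] have "continuous_map ?Z euclidean (\<lambda>z. f (fst z \<otimes> snd z))"
    by (simp add: o_def)
  moreover have "continuous_map ?Z euclidean (\<lambda>z. f (fst z))"
    using continuous_map_compose[OF fst cf] by (simp add: o_def)
  ultimately have "continuous_map ?Z euclidean (\<lambda>z. cmod (f (fst z \<otimes> snd z) - f (fst z)))"
    by (intro continuous_map_norm continuous_map_diff)
  then have "closedin ?Z {z \<in> topspace ?Z. cmod (f (fst z \<otimes> snd z) - f (fst z)) \<in> {e..}}"
    by (rule closedin_continuous_map_preimage) simp
  then have cl: "closedin X (snd ` {z \<in> topspace ?Z. cmod (f (fst z \<otimes> snd z) - f (fst z)) \<in> {e..}})"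
    using snd by (simp add: closed_map_def)
  define N where "N = carrier G - snd ` {z \<in> topspace ?Z. cmod (f (fst z \<otimes> snd z) - f (fst z)) \<in> {e..}}"
  have "openin X N" using openin_diff[OF openin_topspace cl] by (simp only: N_def topspace_eq)
  have N: "cmod (f (c \<otimes> n) - f c) < e" if "c \<in> C" "n \<in> N" for c n
  proof (rule ccontr)
    assume "\<not> cmod (f (c \<otimes> n) - f c) < e"
    then have "(c, n) \<in> {z \<in> topspace ?Z. cmod (f (fst z \<otimes> snd z) - f (fst z)) \<in> {e..}}"
      using that CX by (auto simp: N_def)
    then show False using that by (force simp: N_def)
  qed
  have "\<one> \<in> N" using e CX by (auto simp: N_def)
  then obtain L where L: "compact_open_subgroup L" "L \<subseteq> N \<inter> L0"
    using small_subgroup[of "N \<inter> L0"] \<open>openin X N\<close> compact_open_subgroupD(4,6)[OF L0] by auto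
  note LD = compact_open_subgroupD[OF L(1)]
  have "cmod (f (y \<otimes> l) - f y) < e" if y: "y \<in> carrier G" and l: "l \<in> L" for y l
  proof -
    consider "y \<in> C" | "y \<otimes> l \<in> C" | "y \<notin> C" "y \<otimes> l \<notin> C" by blast
    then show ?thesis
    proof cases
      case 1 then show ?thesis using N L l by auto
    next
      case 2
      then have "cmod (f (y \<otimes> l \<otimes> inv l) - f (y \<otimes> l)) < e" using N L LD(8)[OF l] by auto
      then show ?thesis using y LD(9)[OF l] by (simp add: norm_minus_commute)
    next
      case 3
      then have "f y = 0" "f (y \<otimes> l) = 0" 
        using dominatedD(4)[OF C(2)] y LD(9)[OF l] by auto
      then show ?thesis using e by simp
    qed
  qed
  with L that show thesis by blast
qed

text \<open>On every left coset of \<open>L\<close> the function \<open>f\<close> varies by less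
  than \<open>e\<close> from its sampled value. The estimate is kept for all smaller
  \<open>K\<close> because the subgroup is later replaced by one with the Powers property.\<close>

lemma step_function_approximation:
  assumes f: "f \<in> compactly_supported X" and C: "compact_open C" "dominated C B f" and e: "e > 0" 
    and L0: "compact_open_subgroup L0"
  obtains L where "compact_open_subgroup L" "L \<subseteq> L0" "right_invariant L C"
    "\<And>K. compact_open_subgroup K \<Longrightarrow> K \<subseteq> L \<Longrightarrow> dominated C e (\<lambda>y. f y - step_function K C f y)"
proof -
  obtain L1 where L1: "compact_open_subgroup L1" "L1 \<subseteq> L0"
    "\<And>y l. y \<in> carrier G \<Longrightarrow> l \<in> L1 \<Longrightarrow> cmod (f (y \<otimes> l) - f y) < e"
    using uniformly_right_continuous[OF f C e L0] by blast
  obtain L where L: "compact_open_subgroup L" "right_invariant L C" "L \<subseteq> L1"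
    using exists_adapted_subgroup[OF C(1) L1(1)] by blast
  have CG: "C \<subseteq> carrier G" by (rule compact_open_subset[OF C(1)])
  have "dominated C e (\<lambda>y. f y - step_function K C f y)" if K: "compact_open_subgroup K" "K \<subseteq> L" for K
  proof -
    have KC: "right_invariant K C" using L(2) K(2) by (auto simp: right_invariant_def)
    note B = dominatedD(3,2)[OF C(2)]
    have "step_function K C f \<in> borel_measurable haar"
      using dominated_step_function[OF C(1) K(1) KC B] by (simp add: dominated_def)
    moreover have "cmod (f y - step_function K C f y) \<le> e * indicator C y" if y: "y \<in> carrier G" for y
    proof (cases "y \<in> C")
      case True
      then obtain A where A: "A \<in> left_cosets K C" "y \<in> A"
        using Union_left_cosets[OF compact_open_subgroupD(1)[OF K(1)] KC CG] by blast
      note r = representative_left_coset[OF CG K(1) A(1)]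
      obtain l where "l \<in> K" "y = representative A \<otimes> l" using A(2) r(3) by blast
      then have "cmod (f y - f (representative A)) < e" using L1(3)[OF r(2)] K(2) L(3) by auto
      then show ?thesis using step_function_eq[OF C(1) K(1) KC A, of f] True by simp
    next
      case False
      then show ?thesis 
        using dominatedD(4)[OF C(2) y] step_function_outside[OF C(1) K(1) KC False, of f] by simp
    qed
    ultimately show ?thesis using C(2) e by (auto simp: dominated_def)
  qed
  with that[of L] L L1 show thesis by blast
qed

lemma conv_step_function_close:
  assumes C: "compact_open C" "dominated C B f" "compact_open_subgroup K" "right_invariant K C"
    and d: "dominated C e (\<lambda>y. f y - step_function K C f y)" and g: "g \<in> L2_space haar" and x: "x \<in> carrier G"
  shows "conv f g x - conv (step_function K C f) g x = conv (\<lambda>y. f y - step_function K C f y) g x"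
proof -
  have "dominated C B (step_function K C f)"
    by (intro dominated_step_function[OF C(1,3,4)] dominatedD[OF C(2)])
  then show ?thesis using conv_diff[OF C(1,2) _ g x] by simp
qed

text \<open>Convolutions by step functions are measurable and converge pointwise: at
  \<open>x\<close> the error is at most \<open>1 / Suc n\<close> times the modulus of the
  convolution of |g| by the indicator of \<open>C\<close>.\<close>

lemma conv_measurable:
  assumes f: "f \<in> compactly_supported X" and g: "g \<in> L2_space haar"
  shows "conv f g \<in> borel_measurable haar"
proof -
  obtain C B where C: "compact_open C" "dominated C B f" using compactly_supported_dominated[OF f] .
  have "\<exists>L. compact_open_subgroup L \<and> right_invariant L C \<and> 
      dominated C (1 / Suc n) (\<lambda>y. f y - step_function L C f y)" for n
  proof -
    obtain L where "compact_open_subgroup L" "right_invariant L C"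
      "\<And>K. compact_open_subgroup K \<Longrightarrow> K \<subseteq> L \<Longrightarrow> dominated C (1 / Suc n) (\<lambda>y. f y - step_function K C f y)"
      using step_function_approximation[OF f C _ base_subgroup, of "1 / Suc n"] by (metis of_nat_0_less_iff zero_less_Suc zero_less_divide_1_iff)
    then show ?thesis by blast
  qed
  then obtain L where L: "\<And>n. compact_open_subgroup (L n)" "\<And>n. right_invariant (L n) C"
      "\<And>n. dominated C (1 / Suc n) (\<lambda>y. f y - step_function (L n) C f y)"
    by metis
  show ?thesis
  proof (rule borel_measurable_LIMSEQ_metric)
    show "conv (step_function (L n) C f) g \<in> borel_measurable haar" for n
      using L2_conv_step_function(1)[OF C(1) L(1,2) g] L2_spaceD(1) by blast
    fix x assume "x \<in> space haar"
    then have x: "x \<in> carrier G" by simp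
    let ?M = "cmod (conv (indicator C) (\<lambda>z. complex_of_real (cmod (g z))) x)"
    have le: "dist (conv (step_function (L n) C f) g x) (conv f g x) \<le> ?M * (1 / Suc n)" for n
    proof -
      have "dist (conv (step_function (L n) C f) g x) (conv f g x) = 
          cmod (conv (\<lambda>y. f y - step_function (L n) C f y) g x)"
        using conv_step_function_close[OF C L(1,2,3) g x]
        by (metis dist_commute dist_norm)
      also have "\<dots> \<le> cmod (complex_of_real (1 / Suc n) * conv (indicator C) (\<lambda>z. complex_of_real (cmod (g z))) x)"
        by (rule cmod_conv_le[OF C(1) L(3) g x])
      finally show ?thesis unfolding norm_mult norm_of_real by (simp add: mult.commute)
    qed
    have lim: "(\<lambda>n. ?M * (1 / Suc n)) \<longlonglongrightarrow> 0"
      by (rule tendsto_mult_right_zero[OF LIMSEQ_inverse_real_of_nat[unfolded inverse_eq_divide]])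
    have "(\<lambda>n. dist (conv (step_function (L n) C f) g x) (conv f g x)) \<longlonglongrightarrow> 0"
    proof (rule Lim_null_comparison[OF always_eventually lim], rule allI)
      show "norm (dist (conv (step_function (L n) C f) g x) (conv f g x)) \<le> ?M * (1 / Suc n)" for n
        using le[of n] by simp
    qed
    then show "(\<lambda>n. conv (step_function (L n) C f) g x) \<longlonglongrightarrow> conv f g x"
      by (rule tendsto_dist_iff[THEN iffD2])
  qed
qed

lemma integrable_conv_compactly_supported:
  assumes f: "f \<in> compactly_supported X" and g: "g \<in> L2_space haar" and x: "x \<in> carrier G"
  shows "integrable haar (\<lambda>y. f y * g (inv y \<otimes> x))"
  using compactly_supported_dominated[OF f] integrable_conv[OF _ _ g x] by metis

lemma conv_add:
  assumes f: "f \<in> compactly_supported X" and g: "g \<in> L2_space haar" "h \<in> L2_space haar" and x: "x \<in> carrier G"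
  shows "conv f (\<lambda>y. g y + h y) x = conv f g x + conv f h x"
  using integrable_conv_compactly_supported[OF f g(1) x] integrable_conv_compactly_supported[OF f g(2) x]
  by (simp add: convolution_operator_def distrib_left)

lemma conv_scale: "conv f (\<lambda>y. c * g y) x = c * conv f g x"
proof -
  have "(LINT y|haar. f y * (c * g (inv y \<otimes> x))) = (LINT y|haar. c * (f y * g (inv y \<otimes> x)))"
    by (simp add: mult.left_commute)
  then show ?thesis by (simp add: convolution_operator_def)
qed

lemma conv_bounded_operator:
  assumes f: "f \<in> compactly_supported X"
  shows "conv f \<in> bounded_operators haar"
proof -
  obtain C B where C: "compact_open C" "dominated C B f" using compactly_supported_dominated[OF f] .
  show ?thesis
    using L2_norm_conv_dominated[OF C _ conv_measurable[OF f]] conv_add[OF f] conv_scale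
    by (intro bounded_operatorsI[where C = "B * content C"]) auto
qed

lemma indicator_compactly_supported:
  assumes C: "compact_open C" shows "indicator C \<in> compactly_supported X"
proof -
  have "continuous_map X euclidean (indicator C :: 'a \<Rightarrow> complex)"
    unfolding continuous_map_def
  proof (intro conjI allI impI)
    fix U :: "complex set"
    have o: "openin X C" "openin X (carrier G - C)" "openin X (carrier G)"
      using openin_topspace[of X] compact_open_imp_open[OF C] compact_open_imp_closed[OF C] by (auto simp: closedin_def)
    have "{x \<in> topspace X. indicator C x \<in> U} = 
       (if 1 \<in> U then C else {}) \<union> (if 0 \<in> U then carrier G - C else {})"
      by (auto simp: indicator_def dest: subsetD[OF compact_open_subset[OF C]])
    then show "openin X {x \<in> topspace X. indicator C x \<in> U}" using o by (auto intro: openin_Un)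
  qed auto
  moreover have "{x \<in> topspace X. indicator C x \<noteq> (0::complex)} = C"
    using compact_open_subset[OF C] by (auto simp: indicator_def)
  moreover have "X closure_of C = C" 
    using compact_open_imp_closed[OF C] by (simp add: closure_of_closedin)
  ultimately show ?thesis using C by (simp add: compactly_supported_def compact_open_def)
qed

end

section \<open>Density of locally constant functions\<close>

text \<open>A difference that vanishes almost everywhere has norm 0, and boundedness sends it to a
  function of norm 0; additivity does the rest.\<close>

lemma bounded_operator_cong_AE:
  assumes T: "T \<in> bounded_operators M" and f: "f \<in> L2_space M" "g \<in> L2_space M" and eq: "AE x in M. f x = g x"
  shows "AE x in M. T f x = T g x"
proof -
  have d: "(\<lambda>x. f x - g x) \<in> L2_space M" by (rule L2_space_diff[OF f])
  have "L2_norm M (\<lambda>x. f x - g x) = 0"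
    using eq by (subst L2_norm_eq_0_iff[OF d]) (auto elim: eventually_mono)
  then have "L2_norm M (T (\<lambda>x. f x - g x)) = 0"
    using L2_norm_le_op_norm[OF T d] by (simp add: antisym)
  then have "AE x in M. T (\<lambda>x. f x - g x) x = 0"
    using L2_norm_eq_0_iff bounded_operatorsD(1)[OF T d] by blast
  moreover have "AE x in M. T (\<lambda>y. g y + (f y - g y)) x = T g x + T (\<lambda>y. f y - g y) x"
    by (rule bounded_operatorsD(2)[OF T f(2) d])
  ultimately show ?thesis by eventually_elim simp
qed

context td_group
begin

lemma measure_less_ennreal: "emeasure M A < ennreal r \<Longrightarrow> measure M A < r"
proof -
  assume a: "emeasure M A < ennreal r"
  then have "emeasure M A = ennreal (measure M A)" by (intro emeasure_eq_ennreal_measure) auto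
  with a show "measure M A < r" by (metis ennreal_less_iff measure_nonneg)
qed

text \<open>\<open>A\<close> is enclosed in an open \<open>U\<close>, and \<open>U\<close> is
  exhausted by a compact open \<open>C\<close>, each up to measure \<open>e\<^sup>2 / 4\<close>. The
  difference of the indicators of \<open>A\<close> and \<open>C\<close> is that of
  \<open>U - C\<close> and \<open>U - A\<close>, two terms of norm below
  \<open>e / 2\<close>.\<close>

lemma approximate_finite_measure:
  assumes A: "A \<in> sets haar" "emeasure haar A < \<infinity>" and e: "e > 0"
  obtains C where "compact_open C" "L2_norm haar (\<lambda>x. indicator A x - indicator C x) < e"
proof -
  have e2: "e\<^sup>2 / 4 > 0" using e by simp
  have "emeasure haar A < emeasure haar A + ennreal (e\<^sup>2 / 4)"
  proof -
    obtain r where "0 \<le> r" "emeasure haar A = ennreal r"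
      using A(2) by (auto simp: less_top_ennreal)
    then show ?thesis using e2 by (simp add: ennreal_plus[symmetric] ennreal_less_iff del: ennreal_plus)
  qed
  then obtain U where U: "openin X U" "A \<subseteq> U" "emeasure haar U < emeasure haar A + ennreal (e\<^sup>2 / 4)"
    using emeasure_haar_outer_regular[OF A(1)] by (auto simp: INF_less_iff)
  note Us = openin_sets_haar[OF U(1)]
  have Ufin: "emeasure haar U < \<infinity>" 
    using U(3) A(2) by (metis ennreal_add_less_top ennreal_less_top infinity_ennreal_def order_less_trans)
  have UA: "measure haar (U - A) < e\<^sup>2 / 4"
  proof -
    have "emeasure haar U = emeasure haar A + emeasure haar (U - A)"
      using plus_emeasure[of A haar "U - A"] A U(2) Us by (simp add: Un_absorb1)
    then have "emeasure haar (U - A) < ennreal (e\<^sup>2 / 4)"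
      using U(3) A(2) by (simp add: ennreal_add_left_cancel_less)
    then show ?thesis by (rule measure_less_ennreal)
  qed
  have "\<exists>C. compact_open C \<and> C \<subseteq> U \<and> emeasure haar U < emeasure haar C + ennreal (e\<^sup>2 / 4)"
  \<comment> \<open>Inner regularity is invoked at a level strictly below the measure of
    \<open>U\<close>, so measure 0 is treated separately.\<close>
  proof (cases "emeasure haar U = 0")
    case True
    then show ?thesis using e2 by (intro exI[of _ "{}"]) auto
  next
    case False
    have "emeasure haar U - ennreal (e\<^sup>2 / 4) < emeasure haar U"
      using False Ufin e2 by (intro ennreal_between) (auto simp: zero_less_iff_neq_zero)
    then obtain C where C: "compact_open C" "C \<subseteq> U" "emeasure haar U - ennreal (e\<^sup>2 / 4) < emeasure haar C"
      using emeasure_haar_inner_regular[OF U(1)] by (auto simp: less_SUP_iff)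
    then show ?thesis
    proof (intro exI[of _ C] conjI C)
      obtain u where u: "0 \<le> u" "emeasure haar U = ennreal u"
        using Ufin by (auto simp: less_top_ennreal)
      have "u - e\<^sup>2 / 4 < content C"
        using C(3) ennreal_leI[of "content C" "u - e\<^sup>2 / 4"] e2
        by (force simp: u(2) emeasure_haar_compact_open[OF C(1)] ennreal_minus)
      then show "emeasure haar U < emeasure haar C + ennreal (e\<^sup>2 / 4)"
        using e2 u(1) by (simp add: u(2) emeasure_haar_compact_open[OF C(1)] ennreal_plus[symmetric] ennreal_less_iff
          del: ennreal_plus)
    qed
  qed
  then obtain C where C: "compact_open C" "C \<subseteq> U" "emeasure haar U < emeasure haar C + ennreal (e\<^sup>2 / 4)" by blast
  note Cs = compact_open_sets_haar[OF C(1)]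
  have UC: "measure haar (U - C) < e\<^sup>2 / 4"
  proof -
    have "emeasure haar U = emeasure haar C + emeasure haar (U - C)"
      using plus_emeasure[of C haar "U - C"] C(2) Us Cs by (simp add: Un_absorb1)
    then have "emeasure haar (U - C) < ennreal (e\<^sup>2 / 4)"
      using C(3) emeasure_compact_open_finite[OF C(1)] by (simp add: ennreal_add_left_cancel_less)
    then show ?thesis by (rule measure_less_ennreal)
  qed
  have fin: "emeasure haar (U - A) < \<infinity>" "emeasure haar (U - C) < \<infinity>"
    using Ufin emeasure_mono[of _ U haar] Us by (metis Diff_subset order_le_less_trans)+
  have "L2_norm haar (\<lambda>x. indicator A x - indicator C x) = 
      L2_norm haar (\<lambda>x. indicator (U - C) x - indicator (U - A) x)"
    using U(2) C(2) by (intro arg_cong[where f = "L2_norm haar"] ext) (auto simp: indicator_def)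
  also have "\<dots> \<le> L2_norm haar (indicator (U - C)) + L2_norm haar (\<lambda>x. (-1) * indicator (U - A) x)"
    using L2_norm_triangle[of "indicator (U - C)" haar "\<lambda>x. (-1) * indicator (U - A) x"] fin Us Cs A(1)
    by (simp add: L2_space_indicator L2_space_scale[of _ haar "-1", simplified])
  also have "\<dots> = sqrt (measure haar (U - C)) + sqrt (measure haar (U - A))"
    unfolding L2_norm_scale using fin Us Cs A(1) by (simp add: L2_norm_indicator)
  also have "\<dots> < sqrt (e\<^sup>2 / 4) + sqrt (e\<^sup>2 / 4)"
    using UA UC by (intro add_strict_mono real_sqrt_less_mono)
  also have "\<dots> = e" using e by (simp add: real_sqrt_divide)
  finally show thesis using that C(1) by blast
qed

text \<open>Regularity passes from compact open sets to all sets of finite measure, linearity to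
  simple functions, and dominated convergence to all of L2.\<close>

lemma L2_induct [consumes 1, case_names indicator add scale limit]:
  assumes f: "f \<in> L2_space haar"
    and ind: "\<And>C. compact_open C \<Longrightarrow> P (indicator C)"
    and add: "\<And>f g. f \<in> L2_space haar \<Longrightarrow> g \<in> L2_space haar \<Longrightarrow> P f \<Longrightarrow> P g \<Longrightarrow> P (\<lambda>x. f x + g x)"
    and scale: "\<And>c f. f \<in> L2_space haar \<Longrightarrow> P f \<Longrightarrow> P (\<lambda>x. c * f x)"
    and limit: "\<And>f. f \<in> L2_space haar \<Longrightarrow> 
      (\<And>e. e > 0 \<Longrightarrow> \<exists>h\<in>L2_space haar. P h \<and> L2_norm haar (\<lambda>x. f x - h x) < e) \<Longrightarrow> P f"
  shows "P f"
proof -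
  have P_ind: "P (indicator A)" if A: "A \<in> sets haar" "emeasure haar A < \<infinity>" for A
    using approximate_finite_measure[OF A] ind L2_space_indicator_compact_open
    by (intro limit L2_space_indicator A) metis
  have P_sum: "P (\<lambda>x. \<Sum>i\<in>I. c i * indicator (A i) x)"
    if "finite I" "\<And>i. i \<in> I \<Longrightarrow> A i \<in> sets haar \<and> emeasure haar (A i) < \<infinity>" 
    for I and c :: "complex \<Rightarrow> complex" and A
    using that
  proof (induction I rule: finite_induct)
    case empty
    then show ?case using scale[OF L2_space_indicator_compact_open ind, of "{}" 0] by simp
  next
    case (insert i I)
    have "P (\<lambda>x. c i * indicator (A i) x + (\<Sum>i\<in>I. c i * indicator (A i) x))"
      using insert by (intro add scale P_ind L2_space_scale L2_space_indicator L2_space_sum insert.IH) auto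
    moreover have "(\<lambda>x. \<Sum>i\<in>insert i I. c i * indicator (A i) x) = 
        (\<lambda>x. c i * indicator (A i) x + (\<Sum>i\<in>I. c i * indicator (A i) x))"
      by (intro ext sum.insert insert)
    ultimately show ?case by simp
  qed
  obtain F where F: "\<And>i. simple_function haar (F i)" 
      "\<And>x. x \<in> space haar \<Longrightarrow> (\<lambda>i. F i x) \<longlonglongrightarrow> f x"
      "\<And>i x. x \<in> space haar \<Longrightarrow> dist (F i x) 0 \<le> 2 * dist (f x) 0"
    using borel_measurable_implies_sequence_metric[OF L2_spaceD(1)[OF f], of 0] by blast
  have FM: "F i \<in> borel_measurable haar" for i using F(1) by (rule borel_measurable_simple_function)
  have FL: "F i \<in> L2_space haar" for i
  proof (rule L2_space_bound[OF FM])
    \<comment> \<open>The approximants satisfy \<open>cmod (F i x) \<le> 2 * cmod (f x)\<close>,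
      whence the 4; the 9 in the dominated convergence below is the square of 1 + 2.\<close>
    show "integrable haar (\<lambda>x. 4 * (cmod (f x))\<^sup>2)" using L2_spaceD(2)[OF f] by simp
    fix x assume "x \<in> space haar"
    then have "(cmod (F i x))\<^sup>2 \<le> (2 * cmod (f x))\<^sup>2" using F(3) by (intro power_mono) auto
    then show "(cmod (F i x))\<^sup>2 \<le> 4 * (cmod (f x))\<^sup>2" by (simp add: power_mult_distrib)
  qed
  \<comment> \<open>The value 0 is left out because its level set may have infinite measure.\<close>
  have PF: "P (\<lambda>x. \<Sum>y\<in>F i ` space haar - {0}. y * indicator (F i -` {y} \<inter> space haar) x)" for i
  proof (rule P_sum)
    show "finite (F i ` space haar - {0})" using simple_functionD(1)[OF F(1)] by simp
    fix y assume y: "y \<in> F i ` space haar - {0}"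
    let ?A = "F i -` {y} \<inter> space haar"
    have A: "?A \<in> sets haar" using F(1) by (rule simple_functionD(2))
    have "ennreal ((cmod y)\<^sup>2) * emeasure haar ?A = (\<integral>\<^sup>+x. ennreal ((cmod y)\<^sup>2) * indicator ?A x \<partial>haar)"
      using A by (simp add: nn_integral_cmult_indicator)
    also have "\<dots> \<le> (\<integral>\<^sup>+x. ennreal ((cmod (F i x))\<^sup>2) \<partial>haar)"
      by (intro nn_integral_mono) (auto split: split_indicator)
    also have "\<dots> < \<infinity>" using L2_spaceD(2)[OF FL] by (simp add: integrable_iff_bounded)
    finally have "emeasure haar ?A < \<infinity>" using y by (auto simp: ennreal_mult_less_top)
    then show "?A \<in> sets haar \<and> emeasure haar ?A < \<infinity>" using A by simp
  qed
  have eq: "(\<Sum>y\<in>F i ` space haar - {0}. y * indicator (F i -` {y} \<inter> space haar) x) = F i x" 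
    if x: "x \<in> space haar" for i x
  proof (cases "F i x = 0")
    case False
    have "(\<Sum>y\<in>F i ` space haar - {0}. y * indicator (F i -` {y} \<inter> space haar) x) = 
      (\<Sum>y\<in>F i ` space haar - {0}. if y = F i x then F i x else 0)"
      using x by (intro sum.cong) (auto simp: indicator_def)
    also have "\<dots> = F i x" using simple_functionD(1)[OF F(1)] False x by (subst sum.delta) auto
    finally show ?thesis .
  next
    case True
    have "(\<Sum>y\<in>F i ` space haar - {0}. y * indicator (F i -` {y} \<inter> space haar) x) = 0"
      by (intro sum.neutral ballI) (use True in \<open>auto simp: indicator_def\<close>)
    then show ?thesis using True by (simp only:)
  qed
  have "(\<lambda>i. LINT x|haar. (cmod (f x - F i x))\<^sup>2) \<longlonglongrightarrow> (LINT x|haar. 0)"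
  proof (rule integral_dominated_convergence)
    show "integrable haar (\<lambda>x. 9 * (cmod (f x))\<^sup>2)" using L2_spaceD(2)[OF f] by simp
    show "AE x in haar. (\<lambda>i. (cmod (f x - F i x))\<^sup>2) \<longlonglongrightarrow> 0"
    proof (rule AE_I2)
      fix x assume "x \<in> space haar"
      then have "(\<lambda>i. (cmod (f x - F i x))\<^sup>2) \<longlonglongrightarrow> (cmod (f x - f x))\<^sup>2"
        using F(2) by (intro tendsto_intros)
      then show "(\<lambda>i. (cmod (f x - F i x))\<^sup>2) \<longlonglongrightarrow> 0" by simp
    qed
    show "AE x in haar. norm ((cmod (f x - F i x))\<^sup>2) \<le> 9 * (cmod (f x))\<^sup>2" for i
    proof (rule AE_I2)
      fix x assume "x \<in> space haar"
      then have "cmod (f x - F i x) \<le> 3 * cmod (f x)"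
        using F(3)[of x i] norm_triangle_ineq4[of "f x" "F i x"] by simp
      then have "(cmod (f x - F i x))\<^sup>2 \<le> (3 * cmod (f x))\<^sup>2" by (intro power_mono) auto
      then show "norm ((cmod (f x - F i x))\<^sup>2) \<le> 9 * (cmod (f x))\<^sup>2" by (simp add: power_mult_distrib)
    qed
  qed (use FM L2_spaceD(1)[OF f] in auto)
  then have "(\<lambda>i. sqrt (LINT x|haar. (cmod (f x - F i x))\<^sup>2)) \<longlonglongrightarrow> sqrt 0"
    by (intro tendsto_real_sqrt) simp
  then have lim: "(\<lambda>i. L2_norm haar (\<lambda>x. f x - F i x)) \<longlonglongrightarrow> 0" by (simp add: L2_norm_def)
  show "P f"
  proof (rule limit[OF f])
    fix e :: real assume "e > 0"
    then have "eventually (\<lambda>i. L2_norm haar (\<lambda>x. f x - F i x) < e) sequentially"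
      using lim by (rule order_tendstoD(2)[rotated])
    then obtain i where i: "L2_norm haar (\<lambda>x. f x - F i x) < e" by (auto simp: eventually_sequentially)
    let ?s = "\<lambda>x. \<Sum>y\<in>F i ` space haar - {0}. y * indicator (F i -` {y} \<inter> space haar) x"
    have "?s \<in> L2_space haar" using FL[of i] L2_space_cong[of haar ?s "F i"] eq by blast
    moreover have "L2_norm haar (\<lambda>x. f x - ?s x) = L2_norm haar (\<lambda>x. f x - F i x)"
      by (rule L2_norm_cong) (simp only: eq)
    ultimately show "\<exists>h\<in>L2_space haar. P h \<and> L2_norm haar (\<lambda>x. f x - h x) < e"
      using PF[of i] i by (intro bexI[of _ ?s]) auto
  qed
qed

lemma operator_zero_if_zero_on_indicators:
  assumes T: "T \<in> bounded_operators haar" 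
    and zero: "\<And>C. compact_open C \<Longrightarrow> AE x in haar. T (indicator C) x = 0"
    and f: "f \<in> L2_space haar"
  shows "AE x in haar. T f x = 0"
  using f
proof (induction rule: L2_induct)
  case (add f g)
  show ?case using bounded_operatorsD(2)[OF T add(1,2)] add(3,4) by eventually_elim simp
next
  case (scale c f)
  show ?case using bounded_operatorsD(3)[OF T scale(1), of c] scale(2) by eventually_elim simp
next
  case (limit f)
  have "L2_norm haar (T f) \<le> 0"
  proof (rule field_le_epsilon)
    fix e :: real assume e: "e > 0"
    have n: "op_norm haar T \<ge> 0" by (rule op_norm_nonneg[OF T])
    \<comment> \<open>The added 1 keeps the denominator positive when the operator norm is
      0.\<close>
    obtain h where h: "h \<in> L2_space haar" "AE x in haar. T h x = 0" 
        "L2_norm haar (\<lambda>x. f x - h x) < e / (op_norm haar T + 1)"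
      using limit(2)[of "e / (op_norm haar T + 1)"] e n by auto
    have d: "(\<lambda>x. f x - h x) \<in> L2_space haar" by (rule L2_space_diff[OF limit(1) h(1)])
    have "AE x in haar. T (\<lambda>y. h y + (f y - h y)) x = T h x + T (\<lambda>y. f y - h y) x"
      by (rule bounded_operatorsD(2)[OF T h(1) d])
    then have "AE x in haar. T f x = T (\<lambda>y. f y - h y) x" using h(2) by eventually_elim simp
    then have "L2_norm haar (T f) = L2_norm haar (T (\<lambda>y. f y - h y))"
      by (intro L2_norm_cong_AE bounded_operatorsD(1)[OF T] d limit(1))
    also have "\<dots> \<le> op_norm haar T * L2_norm haar (\<lambda>x. f x - h x)" by (rule L2_norm_le_op_norm[OF T d])
    also have "\<dots> \<le> op_norm haar T * (e / (op_norm haar T + 1))" using h(3) n by (intro mult_left_mono) auto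
    also have "\<dots> \<le> e" using e n by (simp add: field_simps)
    finally show "L2_norm haar (T f) \<le> 0 + e" by simp
  qed
  then show ?case using L2_norm_eq_0_iff[OF bounded_operatorsD(1)[OF T limit(1)]] by (simp add: antisym)
qed (rule zero)

text \<open>By \<open>L2_induct\<close> the vanishing extends from indicators to all
  square-integrable test functions, and testing against the conjugate of \<open>h\<close> yields its
  squared norm.\<close>

lemma function_zero_if_zero_on_compact_open:
  assumes h: "h \<in> L2_space haar" 
    and zero: "\<And>C. compact_open C \<Longrightarrow> (LINT x|haar. indicator C x * h x) = 0"
  shows "AE x in haar. h x = 0"
proof -
  have *: "(LINT x|haar. f x * h x) = 0" if "f \<in> L2_space haar" for f
    using that
  proof (induction rule: L2_induct)
    case (add f g)
    then show ?case using L2_mult_integrable[OF _ h] by (simp add: distrib_right)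
  next
    case (scale c f)
    have "(LINT x|haar. c * f x * h x) = (LINT x|haar. c * (f x * h x))" by (simp add: mult.assoc)
    then show ?case using scale by simp
  next
    case (limit f)
    have "cmod (LINT x|haar. f x * h x) \<le> 0"
    proof (rule field_le_epsilon)
      fix e :: real assume e: "e > 0"
      have n: "L2_norm haar h \<ge> 0" by simp
      have pos: "0 < e / (L2_norm haar h + 1)" using e n by (intro divide_pos_pos) linarith+
      obtain k where k: "k \<in> L2_space haar" "(LINT x|haar. k x * h x) = 0" 
          "L2_norm haar (\<lambda>x. f x - k x) < e / (L2_norm haar h + 1)"
        using limit(2)[OF pos] by auto
      have d: "(\<lambda>x. f x - k x) \<in> L2_space haar" by (rule L2_space_diff[OF limit(1) k(1)])
      have "(LINT x|haar. f x * h x) = (LINT x|haar. (f x - k x) * h x)"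
        using k(2) L2_mult_integrable[OF limit(1) h] L2_mult_integrable[OF k(1) h] 
        by (simp add: left_diff_distrib)
      then have "cmod (LINT x|haar. f x * h x) \<le> L2_norm haar (\<lambda>x. f x - k x) * L2_norm haar h"
        using Cauchy_Schwarz[OF d h] by simp
      also have "\<dots> \<le> e / (L2_norm haar h + 1) * L2_norm haar h"
        using k(3) by (intro mult_right_mono) auto
      also have "\<dots> \<le> e"
      proof -
        have "e / (r + 1) * r \<le> e" if "r \<ge> 0" for r :: real using that e by (simp add: field_simps)
        then show ?thesis using n by blast
      qed
      finally show "cmod (LINT x|haar. f x * h x) \<le> 0 + e" by simp
    qed
    then show ?case by simp
  qed (rule zero)
  have c: "(\<lambda>x. cnj (h x)) \<in> L2_space haar"
    using L2_spaceD[OF h] measurable_compose[OF _ borel_measurable_continuous_onI[OF continuous_on_cnj[OF continuous_on_id]]]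
    by (simp add: L2_space_def)
  have "complex_of_real (LINT x|haar. (cmod (h x))\<^sup>2) = (LINT x|haar. complex_of_real ((cmod (h x))\<^sup>2))"
    by (rule integral_complex_of_real[symmetric])
  also have "\<dots> = (LINT x|haar. cnj (h x) * h x)"
    unfolding complex_norm_square by (simp only: mult.commute)
  finally have "complex_of_real (LINT x|haar. (cmod (h x))\<^sup>2) = 0" using *[OF c] by simp
  then have "L2_norm haar h = 0" by (simp add: L2_norm_def)
  then show ?thesis using L2_norm_eq_0_iff[OF h] by simp
qed

end

section \<open>Ideals and averaging\<close>

lemma L2_norm_indicator_mult_le:
  assumes "f \<in> L2_space M" "A \<in> sets M"
  shows "L2_norm M (\<lambda>x. indicator A x * f x) \<le> L2_norm M f"
  using L2_space_indicator_mult[OF assms] assms(1)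
  by (intro L2_norm_mono) (auto simp: L2_spaceD norm_mult split: split_indicator)

lemma ideal_finite_sum:
  assumes I: "closed_two_sided_ideal M \<A> I" and "finite J" "\<And>j. j \<in> J \<Longrightarrow> T j \<in> I"
  shows "(\<lambda>f x. \<Sum>j\<in>J. T j f x) \<in> I"
  using assms(2,3)
proof (induction J rule: finite_induct)
  case empty
  obtain S where "S \<in> I" using I by (auto simp: closed_two_sided_ideal_def)
  then have "op_scale 0 S \<in> I" using I by (auto simp: closed_two_sided_ideal_def)
  then show ?case by (simp add: op_scale_def)
next
  case (insert j J)
  then have "op_add (T j) (\<lambda>f x. \<Sum>j\<in>J. T j f x) \<in> I"
    using I by (auto simp: closed_two_sided_ideal_def)
  moreover have "op_add (T j) (\<lambda>f x. \<Sum>j\<in>J. T j f x) = (\<lambda>f x. \<Sum>j\<in>insert j J. T j f x)"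
    using insert by (auto simp: op_add_def)
  ultimately show ?case by simp
qed

text \<open>The approximation is phrased vector by vector, as the later estimates provide it.
  Halving \<open>e\<close> turns the weak bound into the strict one of
  \<open>op_closure\<close>.\<close>

lemma ideal_limit:
  assumes I: "closed_two_sided_ideal M \<A> I" "\<A> \<subseteq> bounded_operators M" and T: "T \<in> \<A>"
    and lim: "\<And>e. e > 0 \<Longrightarrow> \<exists>S\<in>I. \<forall>g\<in>L2_space M. L2_norm M (\<lambda>x. T g x - S g x) \<le> e * L2_norm M g"
  shows "T \<in> I"
proof -
  have "\<exists>S\<in>I. op_norm M (op_diff T S) < e" if e: "e > 0" for e
  proof -
    obtain S where S: "S \<in> I" "\<And>g. g \<in> L2_space M \<Longrightarrow> L2_norm M (\<lambda>x. T g x - S g x) \<le> e / 2 * L2_norm M g"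
      using lim[of "e / 2"] e by auto
    have "op_norm M (op_diff T S) \<le> e / 2"
      using S(2) e by (intro op_norm_le) (auto simp: op_diff_apply)
    then show ?thesis using S(1) e by (intro bexI[of _ S]) auto
  qed
  then have "T \<in> op_closure M I" using T I(2) by (auto simp: op_closure_def)
  then show ?thesis using I(1) T by (auto simp: closed_two_sided_ideal_def)
qed

context td_group
begin

abbreviation reduced :: "'a operator set" where
  "reduced \<equiv> reduced_cstar_algebra G X haar"

lemma compactly_supportedI:
  assumes f: "continuous_map X euclidean f" and C: "compact_open C" and zero: "\<And>y. y \<in> carrier G \<Longrightarrow> y \<notin> C \<Longrightarrow> f y = 0"
  shows "f \<in> compactly_supported X"
proof -
  have "X closure_of {x \<in> topspace X. f x \<noteq> 0} \<subseteq> C"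
    using zero by (intro closure_of_minimal compact_open_imp_closed[OF C]) auto
  then have "compactin X (X closure_of {x \<in> topspace X. f x \<noteq> 0})"
    using C closed_compactin closedin_closure_of unfolding compact_open_def by blast
  with f show ?thesis by (simp add: compactly_supported_def)
qed

lemma compactly_supported_continuous: "f \<in> compactly_supported X \<Longrightarrow> continuous_map X euclidean f"
  by (simp add: compactly_supported_def)

lemma continuous_map_complex_mult:
  fixes f g :: "'a \<Rightarrow> complex"
  assumes "continuous_map X euclidean f" "continuous_map X euclidean g"
  shows "continuous_map X euclidean (\<lambda>y. f y * g y)"
  using assms by (simp add: continuous_map_atin tendsto_mult)

lemma compactly_supported_scale:
  assumes "f \<in> compactly_supported X" shows "(\<lambda>y. c * f y) \<in> compactly_supported X"
proof -
  obtain C B where C: "compact_open C" "dominated C B f" using compactly_supported_dominated[OF assms] .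
  show ?thesis
    using dominatedD(4)[OF C(2)] 
    by (intro compactly_supportedI[OF continuous_map_complex_mult C(1)] compactly_supported_continuous[OF assms]) auto
qed

lemma step_function_compactly_supported:
  assumes C: "compact_open C" and L: "compact_open_subgroup L" "right_invariant L C"
  shows "step_function L C f \<in> compactly_supported X"
proof (rule compactly_supportedI[OF _ C])
  have "continuous_map X euclidean (\<lambda>y. f (representative A) * indicator A y)" if "A \<in> left_cosets L C" for A
    using indicator_compactly_supported[OF left_cosets_compact_open[OF compact_open_subset[OF C] L(1) that]]
    by (intro continuous_map_complex_mult[OF _ compactly_supported_continuous]) auto
  then show "continuous_map X euclidean (step_function L C f)"
    unfolding step_function_def[abs_def] using C finite_left_cosets[OF _ L(1)]
    by (intro continuous_map_sum) (auto simp: compact_open_def)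
qed (rule step_function_outside[OF C L])

lemma reduced_bounded: "reduced \<subseteq> bounded_operators haar"
  by (auto simp: reduced_cstar_algebra_def op_closure_def)

lemma conv_reduced:
  assumes f: "f \<in> compactly_supported X" shows "conv f \<in> reduced"
proof -
  have "op_norm haar (op_diff (conv f) (conv f)) \<le> 0"
    by (rule op_norm_le) (auto simp: op_diff_apply)
  then show ?thesis
    using f conv_bounded_operator[OF f] 
    by (auto simp: reduced_cstar_algebra_def op_closure_def intro!: exI[of _ f] intro: order_le_less_trans)
qed

lemma reduced_approximation:
  assumes T: "T \<in> reduced" and e: "e > 0"
  obtains f where "f \<in> compactly_supported X" 
    "\<And>g. g \<in> L2_space haar \<Longrightarrow> L2_norm haar (\<lambda>x. T g x - conv f g x) \<le> e * L2_norm haar g"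
proof -
  obtain f where f: "f \<in> compactly_supported X" "op_norm haar (op_diff T (conv f)) < e"
    using T e by (auto simp: reduced_cstar_algebra_def op_closure_def)
  have b: "op_diff T (conv f) \<in> bounded_operators haar"
    using T reduced_bounded conv_bounded_operator[OF f(1)] by (intro bounded_operators_op_diff) auto
  have "L2_norm haar (\<lambda>x. T g x - conv f g x) \<le> e * L2_norm haar g" if g: "g \<in> L2_space haar" for g
  proof -
    have "L2_norm haar (\<lambda>x. T g x - conv f g x) \<le> op_norm haar (op_diff T (conv f)) * L2_norm haar g"
      using L2_norm_le_op_norm[OF b g] by (simp add: op_diff_apply)
    also have "\<dots> \<le> e * L2_norm haar g" using f(2) by (intro mult_right_mono) auto
    finally show ?thesis .
  qed
  with f(1) that show thesis by blast
qed

lemma conv_cong: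
  assumes "\<And>z. z \<in> carrier G \<Longrightarrow> g z = h z" "x \<in> carrier G"
  shows "conv f g x = conv f h x"
  unfolding convolution_operator_def using assms by (intro Bochner_Integration.integral_cong) auto

lemma conv_diff_right:
  assumes f: "f \<in> compactly_supported X" and g: "g \<in> L2_space haar" "h \<in> L2_space haar" and x: "x \<in> carrier G"
  shows "conv f (\<lambda>y. g y - h y) x = conv f g x - conv f h x"
  using integrable_conv_compactly_supported[OF f g(1) x] integrable_conv_compactly_supported[OF f g(2) x]
  by (simp add: convolution_operator_def right_diff_distrib)

lemma conv_sum_right:
  assumes f: "f \<in> compactly_supported X" and g: "\<And>i. i \<in> I \<Longrightarrow> g i \<in> L2_space haar" and x: "x \<in> carrier G"
  shows "conv f (\<lambda>y. \<Sum>i\<in>I. g i y) x = (\<Sum>i\<in>I. conv f (g i) x)"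
  using integrable_conv_compactly_supported[OF f g x]
  by (simp add: convolution_operator_def sum_distrib_left)

text \<open>For invariant \<open>h\<close> the factor \<open>h (inv y \<otimes> z)\<close> is
  constant over \<open>K\<close> and leaves the integral. The resulting scalar is what survives the
  averaging below.\<close>

lemma conv_left_invariant:
  fixes h :: "'a \<Rightarrow> complex"
  assumes "\<And>k. k \<in> K \<Longrightarrow> h (inv k \<otimes> z) = h z"
  shows "conv (\<lambda>y. indicator K y * f y) h z = (LINT y|haar. indicator K y * f y) * h z"
proof -
  have "conv (\<lambda>y. indicator K y * f y) h z = (LINT y|haar. (indicator K y * f y) * h z)"
    unfolding convolution_operator_def using assms
    by (intro Bochner_Integration.integral_cong) (auto split: split_indicator)
  then show ?thesis by simp
qed

lemma integral_indicator_compact_open: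
  assumes "compact_open C" shows "(LINT y|haar. indicator C y) = complex_of_real (content C)"
proof -
  have "(LINT y|haar. (indicator C y :: complex)) = (LINT y|haar. complex_of_real (indicator C y))"
    by (intro Bochner_Integration.integral_cong) (auto split: split_indicator)
  also have "\<dots> = complex_of_real (LINT y|haar. indicator C y)" by (rule integral_complex_of_real)
  also have "(LINT y|haar. indicator C y) = content C"
    using compact_open_subset[OF assms] by (simp add: measure_haar_compact_open[OF assms] Int_absorb2)
  finally show ?thesis .
qed

lemma average_left_invariant_function:
  fixes h :: "'a \<Rightarrow> complex"
  assumes K: "compact_open_subgroup K" and "\<And>k. k \<in> K \<Longrightarrow> h (inv k \<otimes> z) = h z"
  shows "conv (indicator K) h z = content K * h z"
  using conv_left_invariant[of K h z "\<lambda>y. 1"] assms(2) 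
  by (simp add: integral_indicator_compact_open[OF compact_open_subgroupD(2)[OF K]])

text \<open>The combinatorial condition behind Powers averaging, relative to \<open>K\<close>.
  Commuting with \<open>K\<close> makes translation by \<open>t i\<close> preserve the
  \<open>K\<close>-invariant functions, being an involution lets one operator stand on both sides of
  a conjugate, and openness makes \<open>D i\<close> measurable.\<close>

definition averaging_family :: "'a set \<Rightarrow> 'a set \<Rightarrow> nat \<Rightarrow> (nat \<Rightarrow> 'a) \<Rightarrow> (nat \<Rightarrow> 'a set) \<Rightarrow> bool" where
  "averaging_family K S m t D \<longleftrightarrow>
     (\<forall>i<m. t i \<in> carrier G \<and> t i \<otimes> t i = \<one> \<and> (\<forall>k\<in>K. t i \<otimes> k = k \<otimes> t i) \<and> openin X (D i)) \<and>
     (\<forall>i<m. \<forall>j<m. i \<noteq> j \<longrightarrow> D i \<inter> D j = {}) \<and>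
     (\<forall>i<m. \<forall>y\<in>S. \<forall>x\<in>carrier G - D i. t i \<otimes> (y \<otimes> (t i \<otimes> x)) \<in> D i)"

text \<open>\<open>S\<close> has to avoid \<open>K\<close>, whose elements commute with the
  \<open>t i\<close> and are left in place by conjugation. Arbitrary \<open>m\<close> is asked for
  because the averages decay like \<open>1 / sqrt m\<close>.\<close>

definition powers_subgroup :: "'a set \<Rightarrow> bool" where
  "powers_subgroup K \<longleftrightarrow> compact_open_subgroup K \<and>
     (\<forall>S m. compactin X S \<and> S \<inter> K = {} \<longrightarrow> (\<exists>t D. averaging_family K S m t D))"

text \<open>
  Compressing the conjugate of \<open>conv f\<close> by \<open>t i\<close> to functions vanishing on \<open>D i\<close> gives \<open>0\<close>.  So each
  conjugate is the sum of an operator with range in the functions supported on \<open>D i\<close> and one that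
  only depends on the restriction to \<open>D i\<close>; as the \<open>D i\<close> are disjoint, both families are orthogonal.
\<close>

lemma norm_sum_conjugates_le:
  assumes f: "f \<in> compactly_supported X" 
    and C: "\<And>h. h \<in> L2_space haar \<Longrightarrow> L2_norm haar (conv f h) \<le> C * L2_norm haar h" "C \<ge> 0"
    and av: "averaging_family K S m t D" and supp: "\<And>y. y \<in> carrier G \<Longrightarrow> f y \<noteq> 0 \<Longrightarrow> inv y \<in> S"
    and w: "w \<in> L2_space haar"
  shows "L2_norm haar (\<lambda>x. \<Sum>i<m. conv f (\<lambda>z. w (t i \<otimes> z)) (t i \<otimes> x)) \<le> 2 * C * sqrt m * L2_norm haar w"
proof -
  define a where "a i h = (\<lambda>x. conv f (\<lambda>z. h (t i \<otimes> z)) (t i \<otimes> x))" for i h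
  define q where "q i h = (\<lambda>x. indicator (D i) x * h x)" for i and h :: "'a \<Rightarrow> complex"
  define r where "r i = (\<lambda>x. indicator (space haar - D i) x * a i (q i w) x)" for i
  have t: "t i \<in> carrier G" "openin X (D i)" if "i < m" for i using av that by (auto simp: averaging_family_def)
  have disj: "D i \<inter> D j = {}" if "i < m" "j < m" "i \<noteq> j" for i j using av that by (auto simp: averaging_family_def)
  have Ds: "D i \<in> sets haar" if "i < m" for i using openin_sets_haar[OF t(2)[OF that]] .
  have aL: "a i h \<in> L2_space haar" "L2_norm haar (a i h) \<le> C * L2_norm haar h" 
    if i: "i < m" and h: "h \<in> L2_space haar" for i h
  proof -
    note 1 = L2_left_translation[OF t(1)[OF i] h]
    note 2 = L2_left_translation[OF t(1)[OF i] bounded_operatorsD(1)[OF conv_bounded_operator[OF f] 1(1)]]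
    show "a i h \<in> L2_space haar" unfolding a_def by (rule 2(1))
    show "L2_norm haar (a i h) \<le> C * L2_norm haar h" unfolding a_def 2(2) using C(1)[OF 1(1)] 1(2) by simp
  qed
  have qL: "q i h \<in> L2_space haar" "L2_norm haar (q i h) \<le> L2_norm haar h" if "i < m" "h \<in> L2_space haar" for i h
    unfolding q_def using that Ds by (auto intro: L2_space_indicator_mult L2_norm_indicator_mult_le)
  have rL: "r i \<in> L2_space haar" "L2_norm haar (r i) \<le> C * L2_norm haar (q i w)" if i: "i < m" for i
  proof -
    note A = aL[OF i qL(1)[OF i w]] and s = sets.compl_sets[OF Ds[OF i]]
    show "r i \<in> L2_space haar" unfolding r_def by (rule L2_space_indicator_mult[OF A(1) s])
    show "L2_norm haar (r i) \<le> C * L2_norm haar (q i w)"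
      unfolding r_def by (rule order_trans[OF L2_norm_indicator_mult_le[OF A(1) s] A(2)])
  qed
  \<comment> \<open>At \<open>x\<close> outside \<open>D i\<close> the integral sees
    \<open>w\<close> only at the points
    \<open>t i \<otimes> (inv y \<otimes> (t i \<otimes> x))\<close> with
    \<open>f y \<noteq> 0\<close>. These lie in \<open>D i\<close>, so \<open>w\<close> may be
    replaced by \<open>q i w\<close>.\<close>
  have split: "a i w x = q i (a i w) x + r i x" if i: "i < m" and x: "x \<in> carrier G" for i x
  proof (cases "x \<in> D i")
    case False
    have "a i w x = a i (q i w) x"
      unfolding a_def convolution_operator_def
    proof (rule Bochner_Integration.integral_cong[OF refl])
      fix y assume "y \<in> space haar"
      then have y: "y \<in> carrier G" by simp
      have "t i \<otimes> (inv y \<otimes> (t i \<otimes> x)) \<in> D i" if "f y \<noteq> 0"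
        using av i x False supp[OF y that] by (auto simp: averaging_family_def)
      then show "f y * w (t i \<otimes> (inv y \<otimes> (t i \<otimes> x))) = f y * q i w (t i \<otimes> (inv y \<otimes> (t i \<otimes> x)))"
        by (auto simp: q_def)
    qed
    then show ?thesis using False x by (simp add: q_def r_def)
  qed (simp add: q_def r_def)
  have disjoint_sum: "(L2_norm haar (\<lambda>x. \<Sum>i<m. q i (h i) x))\<^sup>2 = (\<Sum>i<m. (L2_norm haar (q i (h i)))\<^sup>2)" 
    if "\<And>i. i < m \<Longrightarrow> h i \<in> L2_space haar" for h
    using qL(1) that disj by (intro L2_norm_sum_disjoint_squared) (auto simp: q_def indicator_def disjoint_iff)
  \<comment> \<open>Here the outputs have disjoint supports, so squared norms add and
    \<open>m\<close> terms cost only \<open>sqrt m\<close>.\<close>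
  have n1: "L2_norm haar (\<lambda>x. \<Sum>i<m. q i (a i w) x) \<le> C * sqrt m * L2_norm haar w"
  proof (rule power2_le_imp_le)
    have "(L2_norm haar (\<lambda>x. \<Sum>i<m. q i (a i w) x))\<^sup>2 = (\<Sum>i<m. (L2_norm haar (q i (a i w)))\<^sup>2)"
      using aL(1) w by (intro disjoint_sum)
    also have "\<dots> \<le> (\<Sum>i<m. (C * L2_norm haar w)\<^sup>2)"
      using order_trans[OF qL(2)[OF _ aL(1)[OF _ w]] aL(2)[OF _ w]] by (intro sum_mono power_mono) auto
    also have "\<dots> = (C * sqrt m * L2_norm haar w)\<^sup>2" by (simp add: power_mult_distrib)
    finally show "(L2_norm haar (\<lambda>x. \<Sum>i<m. q i (a i w) x))\<^sup>2 \<le> (C * sqrt m * L2_norm haar w)\<^sup>2" .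
  qed (use C(2) in simp)
  \<comment> \<open>The functions \<open>r i\<close> may overlap, but their inputs
    \<open>q i w\<close> have disjoint supports; Cauchy-Schwarz for finite sums yields the same
    factor \<open>sqrt m\<close>.\<close>
  have "(\<Sum>i<m. L2_norm haar (q i w)) \<le> sqrt m * L2_norm haar w"
  proof (rule power2_le_imp_le)
    have sq: "(\<Sum>i<m. L2_norm haar (q i w))\<^sup>2 \<le> (\<Sum>i<m. (L2_norm haar (q i w))\<^sup>2) * card {..<m}"
      by (rule sum_squared_le_sum_of_squares)
    have "(\<Sum>i<m. (L2_norm haar (q i w))\<^sup>2) = (L2_norm haar (\<lambda>x. \<Sum>i<m. q i w x))\<^sup>2"
      using disjoint_sum[of "\<lambda>i. w"] w by simp
    also have "\<dots> \<le> (L2_norm haar w)\<^sup>2"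
    proof (intro power_mono L2_norm_mono)
      show "AE x in haar. cmod (\<Sum>i<m. q i w x) \<le> cmod (w x)"
      proof (rule AE_I2)
        fix x
        show "cmod (\<Sum>i<m. q i w x) \<le> cmod (w x)"
        proof (cases "\<exists>j<m. x \<in> D j")
          case True
          then obtain j where j: "j < m" "x \<in> D j" by auto
          have "(\<Sum>i<m. q i w x) = (\<Sum>i<m. if i = j then w x else 0)"
            using j disj by (intro sum.cong) (auto simp: q_def indicator_def)
          then show ?thesis using j by simp
        qed (simp add: q_def)
      qed
    qed (use qL(1) w in \<open>auto intro!: L2_spaceD L2_space_sum\<close>)
    finally have "(\<Sum>i<m. (L2_norm haar (q i w))\<^sup>2) * card {..<m} \<le> (L2_norm haar w)\<^sup>2 * card {..<m}"
      by (rule mult_right_mono) simp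
    with sq show "(\<Sum>i<m. L2_norm haar (q i w))\<^sup>2 \<le> (sqrt m * L2_norm haar w)\<^sup>2"
      by (simp add: power_mult_distrib mult.commute)
  qed simp
  then have "C * (\<Sum>i<m. L2_norm haar (q i w)) \<le> C * (sqrt m * L2_norm haar w)" using C(2) by (rule mult_left_mono)
  moreover have "L2_norm haar (\<lambda>x. \<Sum>i<m. r i x) \<le> (\<Sum>i<m. L2_norm haar (r i))"
    using rL(1) by (intro L2_norm_sum_le) auto
  moreover have "(\<Sum>i<m. L2_norm haar (r i)) \<le> (\<Sum>i<m. C * L2_norm haar (q i w))"
    using rL(2) by (intro sum_mono) auto
  ultimately have n2: "L2_norm haar (\<lambda>x. \<Sum>i<m. r i x) \<le> C * sqrt m * L2_norm haar w"
    by (simp add: sum_distrib_left mult.assoc)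
  have "L2_norm haar (\<lambda>x. \<Sum>i<m. a i w x) = L2_norm haar (\<lambda>x. (\<Sum>i<m. q i (a i w) x) + (\<Sum>i<m. r i x))"
    using split by (intro L2_norm_cong) (simp add: sum.distrib[symmetric])
  also have "\<dots> \<le> L2_norm haar (\<lambda>x. \<Sum>i<m. q i (a i w) x) + L2_norm haar (\<lambda>x. \<Sum>i<m. r i x)"
    using qL(1) aL(1) rL(1) w by (intro L2_norm_triangle L2_space_sum) auto
  finally show ?thesis using n1 n2 unfolding a_def by simp
qed

lemma conv_commuting_translation:
  fixes h :: "'a \<Rightarrow> complex"
  assumes K: "compact_open_subgroup K" and t: "t \<in> carrier G" "\<And>k. k \<in> K \<Longrightarrow> t \<otimes> k = k \<otimes> t" and x: "x \<in> carrier G"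
  shows "conv (indicator K) (\<lambda>z. h (t \<otimes> z)) x = conv (indicator K) h (t \<otimes> x)"
  unfolding convolution_operator_def
proof (rule Bochner_Integration.integral_cong[OF refl])
  fix y assume "y \<in> space haar"
  then have y: "y \<in> carrier G" by simp
  have "t \<otimes> (inv y \<otimes> x) = inv y \<otimes> (t \<otimes> x)" if "y \<in> K"
    using t(2)[OF compact_open_subgroupD(8)[OF K that]] t(1) x y by (simp add: m_assoc[symmetric])
  then show "indicator K y * h (t \<otimes> (inv y \<otimes> x)) = indicator K y * h (inv y \<otimes> (t \<otimes> x))"
    by (simp add: indicator_def)
qed

text \<open>With \<open>u i\<close> the average over \<open>K\<close> followed by translation by
  \<open>t i\<close>, the averages of \<open>u i \<circ> T \<circ> u i\<close> lie in the ideal and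
  converge to \<open>c * \<kappa>\<close> times \<open>p\<close>. Taking \<open>u i\<close> instead
  of the bare translation keeps every factor in the reduced algebra. The coefficient
  \<open>c\<close> is nonzero and is divided out at the end.\<close>

lemma ideal_contains_indicator:
  assumes P: "powers_subgroup K" and I: "closed_two_sided_ideal haar reduced I" and T: "T \<in> I"
    and nz: "(LINT x|haar. indicator K x * T (indicator K) x) \<noteq> 0"
  shows "conv (indicator K) \<in> I"
proof -
  have K: "compact_open_subgroup K" using P by (simp add: powers_subgroup_def)
  note KD = compact_open_subgroupD[OF K]
  note ideal = I[unfolded closed_two_sided_ideal_def]
  have IA: "I \<subseteq> reduced" using ideal by simp
  have ideal_scale: "op_scale b S \<in> I" if "S \<in> I" for b S using ideal that by simp
  have Tb: "T \<in> bounded_operators haar" using T IA reduced_bounded by auto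
  define \<kappa> where "\<kappa> = content K"
  define p where "p = conv (indicator K)"
  define c where "c = (LINT x|haar. indicator K x * T (indicator K) x) / complex_of_real \<kappa>"
  have \<kappa>: "\<kappa> > 0" unfolding \<kappa>_def using KD(2,6) by (intro content_pos) auto
  have indK: "indicator K \<in> compactly_supported X" by (rule indicator_compactly_supported[OF KD(2)])
  have indL: "indicator K \<in> L2_space haar" by (rule L2_space_indicator_compact_open[OF KD(2)])
  have pb: "p \<in> bounded_operators haar" unfolding p_def by (rule conv_bounded_operator[OF indK])
  have pn: "L2_norm haar (p g) \<le> \<kappa> * L2_norm haar g" if "g \<in> L2_space haar" for g
    unfolding p_def \<kappa>_def using L2_norm_conv_indicator[OF KD(2) that] .
  have scale_red: "op_scale b p \<in> reduced" for b
  proof -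
    have "op_scale b p = conv (\<lambda>y. b * indicator K y)"
      by (intro ext) (simp add: op_scale_def p_def convolution_operator_def mult.assoc)
    then show ?thesis using conv_reduced[OF compactly_supported_scale[OF indK]] by simp
  qed
  \<comment> \<open>Since \<open>p\<close> is \<open>\<kappa>\<close> times a projection, applying
    \<open>u i\<close> twice gives \<open>\<kappa>\<close> times \<open>p\<close>; this accounts for
    the extra factor.\<close>
  have "op_scale (c * \<kappa>) p \<in> I"
  proof (rule ideal_limit[OF I reduced_bounded scale_red])
    fix e :: real assume e: "e > 0"
    \<comment> \<open>Replacing \<open>T\<close> by \<open>conv f\<close> costs
      \<open>\<delta> * \<kappa>\<^sup>2\<close> twice, once for the operator and once for the
      coefficient, together \<open>e / 2\<close>. The other half is left for the averaging.\<close>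
    define \<delta> where "\<delta> = e / (4 * \<kappa>\<^sup>2)"
    have \<delta>: "\<delta> > 0" using e \<kappa> by (simp add: \<delta>_def)
    have "T \<in> reduced" using T IA by auto
    then obtain f where f: "f \<in> compactly_supported X" 
        "\<And>g. g \<in> L2_space haar \<Longrightarrow> L2_norm haar (\<lambda>x. T g x - conv f g x) \<le> \<delta> * L2_norm haar g"
      using reduced_approximation \<delta> by blast
    obtain E B where EB: "compact_open E" "dominated E B f" using compactly_supported_dominated[OF f(1)] .
    \<comment> \<open>Cutting along \<open>K\<close>, which is open and closed, preserves
      continuity: \<open>f0\<close> yields the scalar, and \<open>f1\<close>, supported off
      \<open>K\<close>, averages to zero.\<close>
    define f0 where "f0 = (\<lambda>y. indicator K y * f y)"
    define f1 where "f1 = (\<lambda>y. f y - f0 y)"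
    have f0: "f0 \<in> compactly_supported X"
      unfolding f0_def using f(1) indK
      by (intro compactly_supportedI[OF continuous_map_complex_mult KD(2)] compactly_supported_continuous) auto
    have f1: "f1 \<in> compactly_supported X"
      unfolding f1_def using f(1) f0 dominatedD(4)[OF EB(2)]
      by (intro compactly_supportedI[OF continuous_map_diff EB(1)] compactly_supported_continuous) (auto simp: f0_def)
    obtain C where C: "C \<ge> 0" "\<And>h. h \<in> L2_space haar \<Longrightarrow> L2_norm haar (conv f1 h) \<le> C * L2_norm haar h"
      using bounded_operators_bound[OF conv_bounded_operator[OF f1]] by blast
    \<comment> \<open>Inverses appear because convolution evaluates at
      \<open>inv y \<otimes> x\<close>, and the averaging family acts by the elements of
      \<open>S\<close> themselves.\<close>
    define S where "S = (\<lambda>y. inv y) ` (E - K)"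
    have Sc: "compactin X S"
      using compact_open_inv_image[OF compact_open_Diff[OF EB(1) KD(2)]] by (simp add: S_def compact_open_def)
    have SK: "S \<inter> K = {}"
    proof (rule ccontr)
      assume "S \<inter> K \<noteq> {}"
      then obtain y where y: "y \<in> E" "y \<notin> K" "inv y \<in> K" by (auto simp: S_def)
      then have "inv (inv y) \<in> K" using KD(8) by blast
      then show False using y compact_open_subset[OF EB(1)] by auto
    qed
    have supp: "inv y \<in> S" if "y \<in> carrier G" "f1 y \<noteq> 0" for y
      using that dominatedD(4)[OF EB(2) that(1)] by (cases "y \<in> K") (auto simp: f1_def f0_def S_def)
    \<comment> \<open>Chosen so that the averaging error
      \<open>\<kappa>\<^sup>2 * (2 * C / sqrt m)\<close> is at most \<open>e / 2\<close>.\<close>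
    obtain m :: nat where m: "(4 * C * \<kappa>\<^sup>2 / e)\<^sup>2 < real m" using reals_Archimedean2 by blast
    have m0: "real m > 0" using m by (metis order_le_less_trans zero_le_power2)
    have mC: "\<kappa>\<^sup>2 * (2 * C / sqrt m) \<le> e / 2"
    proof -
      have "4 * C * \<kappa>\<^sup>2 / e \<le> sqrt m" using m real_le_rsqrt by fastforce
      then show ?thesis using e m0 by (simp add: field_simps)
    qed
    obtain t D where av: "averaging_family K S m t D" using P Sc SK unfolding powers_subgroup_def by blast
    have t: "t i \<in> carrier G" "t i \<otimes> t i = \<one>" "\<And>k. k \<in> K \<Longrightarrow> t i \<otimes> k = k \<otimes> t i" if "i < m" for i
      using av that by (auto simp: averaging_family_def)
    have inv_t: "inv (t i) = t i" if "i < m" for i using t[OF that] by (simp add: inv_equality)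
    have tt: "t i \<otimes> (t i \<otimes> x) = x" if "i < m" "x \<in> carrier G" for i x
      using t[OF that(1)] that(2) by (simp add: m_assoc[symmetric])
    define u where "u i = conv (indicator ((\<lambda>k. t i \<otimes> k) ` K))" for i
    have tK: "compact_open ((\<lambda>k. t i \<otimes> k) ` K)" if "i < m" for i by (rule left_coset_compact_open[OF t(1)[OF that] K])
    have uC: "indicator ((\<lambda>k. t i \<otimes> k) ` K) \<in> compactly_supported X" if "i < m" for i
      by (rule indicator_compactly_supported[OF tK[OF that]])
    have ub: "u i \<in> bounded_operators haar" if "i < m" for i 
      unfolding u_def by (rule conv_bounded_operator[OF uC[OF that]])
    have un: "L2_norm haar (u i g) \<le> \<kappa> * L2_norm haar g" if "i < m" "g \<in> L2_space haar" for i g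
      using L2_norm_conv_indicator[OF tK[OF that(1)] that(2)] content_left_translation[OF t(1)[OF that(1)] KD(2)]
      by (simp add: u_def \<kappa>_def)
    have ux: "u i g x = p g (t i \<otimes> x)" if "i < m" "g \<in> L2_space haar" "x \<in> carrier G" for i g x
      unfolding u_def p_def using conv_left_coset[OF t(1)[OF that(1)] that(3) K that(2)] inv_t[OF that(1)] by simp
    define Av where "Av = op_scale (1 / of_nat m) (\<lambda>g x. \<Sum>i<m. (u i \<circ> T \<circ> u i) g x)"
    have "u i \<circ> T \<circ> u i \<in> I" if "i < m" for i
    proof -
      have "u i \<in> reduced" unfolding u_def by (rule conv_reduced[OF uC[OF that]])
      then show ?thesis using ideal T by metis
    qed
    then have "(\<lambda>g x. \<Sum>i<m. (u i \<circ> T \<circ> u i) g x) \<in> I" 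
      using ideal_finite_sum[OF I, of "{..<m}" "\<lambda>i. u i \<circ> T \<circ> u i"] by auto
    then have AvI: "Av \<in> I" unfolding Av_def by (rule ideal_scale)
    define cf where "cf = (LINT y|haar. f0 y)"
    \<comment> \<open>On \<open>K\<close> the function \<open>conv f (indicator K)\<close> equals
      the constant \<open>cf\<close>, so \<open>cf\<close> is the coefficient of
      \<open>conv f\<close>, normalised like \<open>c\<close>. The difference is the approximation
      error of \<open>T\<close> tested on the indicator of \<open>K\<close>.\<close>
    have c_cf: "cmod (cf - c) \<le> \<delta>"
    proof -
      have cf1: "conv f (indicator K) x = cf" if x: "x \<in> K" for x
        unfolding convolution_operator_def cf_def f0_def
      proof (rule Bochner_Integration.integral_cong[OF refl])
        fix y assume "y \<in> space haar"
        then have y: "y \<in> carrier G" by simp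
        have "inv y \<otimes> x \<in> K \<longleftrightarrow> y \<in> K"
        proof
          assume "inv y \<otimes> x \<in> K"
          then have "x \<otimes> inv (inv y \<otimes> x) \<in> K" by (rule KD(7)[OF x KD(8)])
          moreover have "x \<otimes> inv (inv y \<otimes> x) = y" using y KD(9)[OF x] by (simp add: inv_mult_group)
          ultimately show "y \<in> K" by simp
        qed (rule KD(7)[OF KD(8) x])
        then show "f y * indicator K (inv y \<otimes> x) = indicator K y * f y" by (simp add: indicator_def)
      qed
      have d: "(\<lambda>x. T (indicator K) x - conv f (indicator K) x) \<in> L2_space haar"
        by (intro L2_space_diff bounded_operatorsD(1)[OF Tb indL] bounded_operatorsD(1)[OF conv_bounded_operator[OF f(1)] indL])
      have Ti: "integrable haar (\<lambda>x. indicator K x * T (indicator K) x)"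
        by (rule L2_mult_integrable[OF indL bounded_operatorsD(1)[OF Tb indL]])
      have Fi: "integrable haar (\<lambda>x. indicator K x * conv f (indicator K) x)"
        by (rule L2_mult_integrable[OF indL bounded_operatorsD(1)[OF conv_bounded_operator[OF f(1)] indL]])
      have "(LINT x|haar. indicator K x * conv f (indicator K) x) = (LINT x|haar. indicator K x * cf)"
        using cf1 by (intro Bochner_Integration.integral_cong) (auto split: split_indicator)
      also have "\<dots> = \<kappa> * cf" by (simp add: integral_indicator_compact_open[OF KD(2)] \<kappa>_def)
      finally have "\<kappa> * (c - cf) = (LINT x|haar. indicator K x * (T (indicator K) x - conv f (indicator K) x))"
        using \<kappa> Ti Fi by (simp add: c_def right_diff_distrib)
      then have "cmod (\<kappa> * (c - cf)) \<le> L2_norm haar (indicator K) * L2_norm haar (\<lambda>x. T (indicator K) x - conv f (indicator K) x)"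
        using Cauchy_Schwarz[OF indL d] by simp
      also have "\<dots> \<le> L2_norm haar (indicator K) * (\<delta> * L2_norm haar (indicator K))"
        by (intro mult_left_mono f(2)[OF indL]) simp
      also have "\<dots> = \<delta> * (L2_norm haar (indicator K))\<^sup>2" by (simp add: power2_eq_square)
      also have "(L2_norm haar (indicator K))\<^sup>2 = \<kappa>"
        using L2_norm_indicator[OF compact_open_sets_haar[OF KD(2)] emeasure_compact_open_finite[OF KD(2)]] \<kappa>
        by (simp add: measure_haar_compact_open[OF KD(2)] \<kappa>_def)
      finally show ?thesis using \<kappa> by (simp add: norm_mult norm_minus_commute)
    qed
    have "L2_norm haar (\<lambda>x. op_scale (c * \<kappa>) p g x - Av g x) \<le> e * L2_norm haar g" if g: "g \<in> L2_space haar" for g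
    proof -
      define w where "w = p g"
      have w: "w \<in> L2_space haar" "L2_norm haar w \<le> \<kappa> * L2_norm haar g"
        unfolding w_def using bounded_operatorsD(1)[OF pb g] pn[OF g] by auto
      have w_inv: "w (k \<otimes> x) = w x" if "k \<in> K" "x \<in> carrier G" for k x
        unfolding w_def p_def by (rule average_left_invariant[OF that(2) K g that(1)])
      define d where "d i = (\<lambda>x. T (u i g) x - conv f (u i g) x)" for i
      have uL: "u i g \<in> L2_space haar" if "i < m" for i by (rule bounded_operatorsD(1)[OF ub[OF that] g])
      have TL: "T (u i g) \<in> L2_space haar" if "i < m" for i by (rule bounded_operatorsD(1)[OF Tb uL[OF that]])
      have fL: "conv f' (u i g) \<in> L2_space haar" if "i < m" "f' \<in> compactly_supported X" for i f'
        by (rule bounded_operatorsD(1)[OF conv_bounded_operator[OF that(2)] uL[OF that(1)]])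
      have dL: "d i \<in> L2_space haar" "L2_norm haar (d i) \<le> \<delta> * (\<kappa> * L2_norm haar g)" if i: "i < m" for i
      proof -
        show "d i \<in> L2_space haar" unfolding d_def by (rule L2_space_diff[OF TL[OF i] fL[OF i f(1)]])
        show "L2_norm haar (d i) \<le> \<delta> * (\<kappa> * L2_norm haar g)"
          unfolding d_def using \<delta> by (intro order_trans[OF f(2)[OF uL[OF i]]] mult_left_mono un[OF i g]) simp
      qed
      define a where "a i = (\<lambda>x. conv f1 (\<lambda>z. w (t i \<otimes> z)) (t i \<otimes> x))" for i
      have aL: "a i \<in> L2_space haar" if i: "i < m" for i
        unfolding a_def
        by (intro L2_left_translation(1) t(1)[OF i] bounded_operatorsD(1)[OF conv_bounded_operator[OF f1]] w(1))
      let ?A = "\<lambda>x. \<Sum>i<m. a i x"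
      have AL: "?A \<in> L2_space haar" using aL by (intro L2_space_sum) auto
      \<comment> \<open>Passing from \<open>T\<close> to \<open>conv f\<close> leaves
        \<open>d i\<close>. On the invariant vector \<open>u i g\<close> the part \<open>f0\<close>
        acts as \<open>cf\<close>, and \<open>f1\<close> contributes the conjugate
        \<open>a i\<close> after \<open>t i\<close> has been moved past the average
        \<open>p\<close>.\<close>
      have summand: "u i (T (u i g)) x = u i (d i) x + (cf * \<kappa> * w x + p (a i) x)" if i: "i < m" and x: "x \<in> carrier G" for i x
      proof -
        have uw: "u i g z = w (t i \<otimes> z)" if "z \<in> carrier G" for z unfolding w_def by (rule ux[OF i g that])
        have u_inv: "u i g (inv k \<otimes> z) = u i g z" if k: "k \<in> K" and z: "z \<in> carrier G" for k z
        proof -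
          have "t i \<otimes> (inv k \<otimes> z) = inv k \<otimes> (t i \<otimes> z)"
            using t(1)[OF i] t(3)[OF i KD(8)[OF k]] KD(9)[OF k] z by (simp add: m_assoc[symmetric])
          then show ?thesis using w_inv[OF KD(8)[OF k]] uw KD(9)[OF k] z t(1)[OF i] by simp
        qed
        have split: "conv f (u i g) z = cf * u i g z + conv f1 (u i g) z" if z: "z \<in> carrier G" for z
        proof -
          have "conv f (u i g) z = conv f0 (u i g) z + conv f1 (u i g) z"
            using integrable_conv_compactly_supported[OF f0 uL[OF i] z] 
              integrable_conv_compactly_supported[OF f1 uL[OF i] z]
            by (simp add: convolution_operator_def f1_def left_diff_distrib Bochner_Integration.integral_add[symmetric])
          moreover have "conv f0 (u i g) z = cf * u i g z"
            unfolding f0_def cf_def using u_inv z by (intro conv_left_invariant) auto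
          ultimately show ?thesis by simp
        qed
        have "u i (T (u i g)) x - u i (conv f (u i g)) x = u i (d i) x"
          unfolding d_def u_def by (rule conv_diff_right[OF uC[OF i] _ _ x, symmetric])
            (use TL[OF i] fL[OF i f(1)] in \<open>simp_all add: u_def\<close>)
        moreover have "u i (conv f (u i g)) x = u i (\<lambda>z. cf * u i g z + conv f1 (u i g) z) x"
          using conv_cong[OF split x] unfolding u_def .
        moreover have "\<dots> = u i (\<lambda>z. cf * u i g z) x + u i (conv f1 (u i g)) x"
          unfolding u_def by (rule conv_add[OF uC[OF i] _ _ x])
            (use uL[OF i] fL[OF i f1] in \<open>simp_all add: u_def L2_space_scale\<close>)
        moreover have "u i (\<lambda>z. cf * u i g z) x = cf * u i (u i g) x"
          unfolding u_def by (rule conv_scale)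
        moreover have "u i (u i g) x = \<kappa> * w x"
        proof -
          have "u i (u i g) x = p (u i g) (t i \<otimes> x)" by (rule ux[OF i uL[OF i] x])
          also have "\<dots> = \<kappa> * u i g (t i \<otimes> x)"
          proof -
            have "u i g (inv k \<otimes> (t i \<otimes> x)) = u i g (t i \<otimes> x)" if "k \<in> K" for k
              using u_inv[OF that] x t(1)[OF i] by simp
            then show ?thesis
              unfolding p_def \<kappa>_def by (rule average_left_invariant_function[OF K, of "u i g" "t i \<otimes> x"])
          qed
          also have "u i g (t i \<otimes> x) = w x" using uw[of "t i \<otimes> x"] tt[OF i x] x t(1)[OF i] by simp
          finally show ?thesis .
        qed
        moreover have "u i (conv f1 (u i g)) x = p (a i) x"
        proof -
          have "u i (conv f1 (u i g)) x = p (conv f1 (u i g)) (t i \<otimes> x)" by (rule ux[OF i fL[OF i f1] x])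
          also have "\<dots> = p (\<lambda>z. conv f1 (u i g) (t i \<otimes> z)) x"
            unfolding p_def by (rule conv_commuting_translation[OF K t(1)[OF i] t(3)[OF i] x, symmetric])
          also have "\<dots> = p (a i) x"
            unfolding p_def a_def using t(1)[OF i] by (intro conv_cong conv_cong uw x) auto
          finally show ?thesis .
        qed
        ultimately show ?thesis by (simp add: algebra_simps)
      qed
      have Av_eq: "op_scale (c * \<kappa>) p g x - Av g x = 
          (-1 / of_nat m) * (\<Sum>i<m. u i (d i) x) + ((-1 / of_nat m) * p ?A x + (c - cf) * \<kappa> * w x)" 
        if "x \<in> space haar" for x
      proof -
        have x: "x \<in> carrier G" using that by simp
        have "p ?A x = (\<Sum>i<m. p (a i) x)"
          unfolding p_def using aL by (intro conv_sum_right[OF indK _ x]) auto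
        moreover have "(\<Sum>i<m. u i (T (u i g)) x) = (\<Sum>i<m. u i (d i) x) + (of_nat m * (cf * \<kappa> * w x) + (\<Sum>i<m. p (a i) x))"
          using summand[OF _ x] by (simp add: sum.distrib)
        ultimately show ?thesis
          using m0 by (simp add: Av_def op_scale_def w_def field_simps)
      qed
      have dsL: "(\<lambda>x. \<Sum>i<m. u i (d i) x) \<in> L2_space haar"
        using bounded_operatorsD(1)[OF ub dL(1)] by (intro L2_space_sum) auto
      have n1: "L2_norm haar (\<lambda>x. (-1 / of_nat m) * (\<Sum>i<m. u i (d i) x)) \<le> \<delta> * \<kappa>\<^sup>2 * L2_norm haar g"
      proof -
        have "L2_norm haar (\<lambda>x. \<Sum>i<m. u i (d i) x) \<le> (\<Sum>i<m. L2_norm haar (u i (d i)))"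
          using bounded_operatorsD(1)[OF ub dL(1)] by (intro L2_norm_sum_le) auto
        also have "\<dots> \<le> (\<Sum>i<m. \<kappa> * (\<delta> * (\<kappa> * L2_norm haar g)))"
        proof (rule sum_mono)
          fix i assume "i \<in> {..<m}"
          then have i: "i < m" by simp
          show "L2_norm haar (u i (d i)) \<le> \<kappa> * (\<delta> * (\<kappa> * L2_norm haar g))"
            using \<kappa> by (intro order_trans[OF un[OF i dL(1)[OF i]]] mult_left_mono dL(2)[OF i]) simp
        qed
        finally have "L2_norm haar (\<lambda>x. \<Sum>i<m. u i (d i) x) \<le> m * (\<delta> * \<kappa>\<^sup>2 * L2_norm haar g)"
          by (simp add: power2_eq_square mult_ac)
        then show ?thesis using m0 unfolding L2_norm_scale by (simp add: norm_divide field_simps)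
      qed
      have n2: "L2_norm haar (\<lambda>x. (-1 / of_nat m) * p ?A x) \<le> \<kappa>\<^sup>2 * (2 * C / sqrt m) * L2_norm haar g"
      proof -
        have "L2_norm haar (p ?A) \<le> \<kappa> * L2_norm haar ?A" by (rule pn[OF AL])
        also have "\<dots> \<le> \<kappa> * (2 * C * sqrt m * L2_norm haar w)"
          unfolding a_def using \<kappa> by (intro mult_left_mono norm_sum_conjugates_le[OF f1 C(2,1) av supp w(1)]) auto
        also have "\<dots> \<le> \<kappa> * (2 * C * sqrt m * (\<kappa> * L2_norm haar g))"
          using \<kappa> C(1) by (intro mult_left_mono w(2)) auto
        finally have "L2_norm haar (p ?A) / m \<le> \<kappa> * (2 * C * sqrt m * (\<kappa> * L2_norm haar g)) / m"
          by (rule divide_right_mono) simp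
        also have "\<dots> = \<kappa>\<^sup>2 * (2 * C * (sqrt m / m)) * L2_norm haar g" by (simp add: power2_eq_square)
        also have "sqrt m / m = 1 / sqrt m" using m0 by (simp add: field_simps)
        finally show ?thesis unfolding L2_norm_scale by (simp add: norm_divide)
      qed
      have n3: "L2_norm haar (\<lambda>x. (c - cf) * \<kappa> * w x) \<le> \<delta> * \<kappa>\<^sup>2 * L2_norm haar g"
      proof -
        have "L2_norm haar (\<lambda>x. (c - cf) * \<kappa> * w x) = cmod (cf - c) * \<kappa> * L2_norm haar w"
          unfolding L2_norm_scale using \<kappa> by (simp add: norm_mult norm_minus_commute)
        also have "\<dots> \<le> \<delta> * \<kappa> * (\<kappa> * L2_norm haar g)"
          using c_cf w(2) \<kappa> \<delta> by (intro mult_mono) auto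
        finally show ?thesis by (simp add: power2_eq_square mult_ac)
      qed
      have "L2_norm haar (\<lambda>x. op_scale (c * \<kappa>) p g x - Av g x) = 
          L2_norm haar (\<lambda>x. (-1 / of_nat m) * (\<Sum>i<m. u i (d i) x) + ((-1 / of_nat m) * p ?A x + (c - cf) * \<kappa> * w x))"
        by (rule L2_norm_cong[OF Av_eq])
      also have "\<dots> \<le> L2_norm haar (\<lambda>x. (-1 / of_nat m) * (\<Sum>i<m. u i (d i) x)) + 
          L2_norm haar (\<lambda>x. (-1 / of_nat m) * p ?A x + (c - cf) * \<kappa> * w x)"
        by (intro L2_norm_triangle L2_space_add L2_space_scale dsL w(1) bounded_operatorsD(1)[OF pb AL])
      also have "L2_norm haar (\<lambda>x. (-1 / of_nat m) * p ?A x + (c - cf) * \<kappa> * w x) \<le> 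
          L2_norm haar (\<lambda>x. (-1 / of_nat m) * p ?A x) + L2_norm haar (\<lambda>x. (c - cf) * \<kappa> * w x)"
        by (intro L2_norm_triangle L2_space_scale w(1) bounded_operatorsD(1)[OF pb AL])
      finally have "L2_norm haar (\<lambda>x. op_scale (c * \<kappa>) p g x - Av g x) \<le> 
          (2 * (\<delta> * \<kappa>\<^sup>2) + \<kappa>\<^sup>2 * (2 * C / sqrt m)) * L2_norm haar g"
        using n1 n2 n3 by (simp add: distrib_right)
      also have "\<dots> \<le> (2 * (\<delta> * \<kappa>\<^sup>2) + e / 2) * L2_norm haar g"
        using mC by (intro mult_right_mono add_left_mono) auto
      also have "2 * (\<delta> * \<kappa>\<^sup>2) + e / 2 = e" using \<kappa> by (simp add: \<delta>_def)
      finally show ?thesis .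
    qed
    then show "\<exists>S\<in>I. \<forall>g\<in>L2_space haar. L2_norm haar (\<lambda>x. op_scale (c * \<kappa>) p g x - S g x) \<le> e * L2_norm haar g"
      using AvI by blast
  qed
  then have "op_scale (1 / (c * \<kappa>)) (op_scale (c * \<kappa>) p) \<in> I" by (rule ideal_scale)
  moreover have "op_scale (1 / (c * \<kappa>)) (op_scale (c * \<kappa>) p) = p"
    using nz \<kappa> by (intro ext) (simp add: op_scale_def c_def)
  ultimately show ?thesis by (simp add: p_def)
qed

end

section \<open>A criterion for C*-simplicity\<close>

context td_group
begin

lemma conjugate_compact_open_subgroup:
  assumes K: "compact_open_subgroup K" and h: "h \<in> carrier G"
  shows "compact_open_subgroup ((\<lambda>k. h \<otimes> k \<otimes> inv h) ` K)"
  unfolding compact_open_subgroup_def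
proof
  note KD = compact_open_subgroupD[OF K]
  show "subgroup ((\<lambda>k. h \<otimes> k \<otimes> inv h) ` K) G"
  proof (rule subgroupI)
    fix a assume "a \<in> (\<lambda>k. h \<otimes> k \<otimes> inv h) ` K"
    then obtain k where k: "k \<in> K" "a = h \<otimes> k \<otimes> inv h" by auto
    then have "inv a = h \<otimes> inv k \<otimes> inv h" using h KD(9) by (simp add: inv_mult_group m_assoc)
    then show "inv a \<in> (\<lambda>k. h \<otimes> k \<otimes> inv h) ` K" using KD(8)[OF k(1)] by blast
    fix b assume "b \<in> (\<lambda>k. h \<otimes> k \<otimes> inv h) ` K"
    then obtain l where l: "l \<in> K" "b = h \<otimes> l \<otimes> inv h" by auto
    then have "a \<otimes> b = h \<otimes> (k \<otimes> l) \<otimes> inv h" using k h KD(9) by (simp add: m_assoc)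
    then show "a \<otimes> b \<in> (\<lambda>k. h \<otimes> k \<otimes> inv h) ` K" using KD(7)[OF k(1) l(1)] by blast
  qed (use h KD(6,9) in auto)
  have "compact_open ((\<lambda>x. x \<otimes> inv h) ` (\<lambda>k. h \<otimes> k) ` K)"
    using h by (intro compact_open_right_translation compact_open_left_translation KD(2)) auto
  then show "compact_open ((\<lambda>k. h \<otimes> k \<otimes> inv h) ` K)" by (simp add: image_image)
qed

text \<open>Right invariance makes \<open>y \<in> C\<close> with
  \<open>inv y \<otimes> x \<in> K\<close> equivalent to \<open>x \<in> C\<close> with
  \<open>y\<close> in the left coset of \<open>x\<close>, so for \<open>x\<close> in
  \<open>C\<close> the integral is the content of that coset.\<close>

lemma conv_indicator_indicator:
  assumes K: "compact_open_subgroup K" and C: "compact_open C" "right_invariant K C" and x: "x \<in> carrier G"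
  shows "conv (indicator C) (indicator K) x = complex_of_real (content K) * indicator C x"
proof -
  note KD = compact_open_subgroupD[OF K]
  have "conv (indicator C) (indicator K) x = (LINT y|haar. indicator C x * indicator ((\<lambda>k. x \<otimes> k) ` K) y)"
    unfolding convolution_operator_def
  proof (rule Bochner_Integration.integral_cong[OF refl])
    fix y assume "y \<in> space haar"
    then have y: "y \<in> carrier G" by simp
    have "y \<in> C \<and> inv y \<otimes> x \<in> K \<longleftrightarrow> x \<in> C \<and> y \<in> (\<lambda>k. x \<otimes> k) ` K"
    proof
      assume a: "y \<in> C \<and> inv y \<otimes> x \<in> K"
      then have "y \<otimes> (inv y \<otimes> x) \<in> C" using C(2) unfolding right_invariant_def by blast
      moreover have "y = x \<otimes> inv (inv y \<otimes> x)" using x y by (simp add: inv_mult_group)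
      ultimately show "x \<in> C \<and> y \<in> (\<lambda>k. x \<otimes> k) ` K" using x y KD(8)[of "inv y \<otimes> x"] a by auto
    next
      assume a: "x \<in> C \<and> y \<in> (\<lambda>k. x \<otimes> k) ` K"
      then obtain k where k: "k \<in> K" "y = x \<otimes> k" by auto
      then have "inv y \<otimes> x = inv k" using x KD(9) by (simp add: inv_mult_group m_assoc)
      then show "y \<in> C \<and> inv y \<otimes> x \<in> K" using a k C(2) KD(8) unfolding right_invariant_def by auto
    qed
    then show "indicator C y * indicator K (inv y \<otimes> x) = (indicator C x * indicator ((\<lambda>k. x \<otimes> k) ` K) y :: complex)"
      by (auto simp: indicator_def)
  qed
  also have "\<dots> = indicator C x * complex_of_real (content K)"
    using content_left_translation[OF x KD(2)]
    by (simp add: integral_indicator_compact_open[OF left_coset_compact_open[OF x K]])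
  finally show ?thesis by (simp add: mult.commute)
qed

text \<open>The right coset of \<open>inv h\<close> is a left translate of the conjugate
  \<open>?L\<close> of \<open>K\<close>. Averaging over \<open>?L\<close> gives the same value at
  \<open>h \<otimes> x\<close> as at \<open>h\<close>, and the substitution turns it into an
  integral over the left coset of \<open>h\<close>. A nonzero integral over a distant coset is
  thereby carried back to \<open>K\<close>.\<close>

lemma conv_translated_average:
  assumes K: "compact_open_subgroup K" and h: "h \<in> carrier G" and g: "g \<in> L2_space haar" and x: "x \<in> K"
  shows "conv (indicator (right_coset K (inv h))) g x = 
    (LINT z|haar. indicator ((\<lambda>k. h \<otimes> k) ` K) z * g z) / modular h"
proof -
  note KD = compact_open_subgroupD[OF K]
  let ?L = "(\<lambda>k. h \<otimes> k \<otimes> inv h) ` K"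
  have L: "compact_open_subgroup ?L" by (rule conjugate_compact_open_subgroup[OF K h])
  have xG: "x \<in> carrier G" using KD(9)[OF x] .
  have "right_coset K (inv h) = (\<lambda>l. inv h \<otimes> l) ` ?L"
    using h KD(9) by (auto simp: right_coset_def image_image m_assoc cong: image_cong_simp)
  then have "conv (indicator (right_coset K (inv h))) g x = conv (indicator ?L) g (h \<otimes> x)"
    using conv_left_coset[OF _ xG L g, of "inv h"] h by simp
  also have "h \<otimes> x = (h \<otimes> x \<otimes> inv h) \<otimes> h" using h xG by simp
  also have "conv (indicator ?L) g \<dots> = conv (indicator ?L) g h"
    using x by (intro average_left_invariant[OF h L g]) auto
  also have "\<dots> = (LINT y|haar. (indicator ?L y :: real) *\<^sub>R g (inv y \<otimes> h))"
    by (simp add: convolution_operator_def complex_indicator_scaleR)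
  also have "\<dots> = (LINT z|haar. (indicator (right_coset ?L h) z :: real) *\<^sub>R g z) /\<^sub>R modular h"
    by (rule integral_inverse_translation[OF h L L2_spaceD(1)[OF g]])
  also have "right_coset ?L h = (\<lambda>k. h \<otimes> k) ` K"
    using h KD(9) by (auto simp: right_coset_def image_image cong: image_cong_simp)
  finally show ?thesis
    unfolding complex_indicator_scaleR[symmetric]
    by (simp add: divide_inverse scaleR_conv_of_real[of "inverse _"] mult.commute)
qed

text \<open>A nonzero operator of the ideal sends some indicator to a function with nonzero integral
  over a left coset of a small \<open>K\<close>; multiplication from both sides moves this integral
  to the coefficient at the indicator of \<open>K\<close>. The averages over smaller and smaller
  subgroups then act as right approximate units.\<close>

theorem cstar_simple_if_powers_subgroups:
  assumes base: "\<And>U. openin X U \<Longrightarrow> \<one> \<in> U \<Longrightarrow> \<exists>K. powers_subgroup K \<and> K \<subseteq> U"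
  shows "cstar_simple G X"
  unfolding cstar_simple_def simple_operator_algebra_def
proof (intro exI[of _ haar] conjI left_haar_measure_haar allI impI)
  fix I assume I: "closed_two_sided_ideal haar reduced I"
  note ideal = I[unfolded closed_two_sided_ideal_def]
  have IA: "I \<subseteq> reduced" and comp: "\<And>S T. S \<in> reduced \<Longrightarrow> T \<in> I \<Longrightarrow> S \<circ> T \<in> I \<and> T \<circ> S \<in> I"
    and scale: "\<And>c T. T \<in> I \<Longrightarrow> op_scale c T \<in> I" using ideal by auto
  have Ib: "T \<in> bounded_operators haar" if "T \<in> I" for T using that IA reduced_bounded by auto
  have powers: "\<exists>K. powers_subgroup K \<and> compact_open_subgroup K \<and> K \<subseteq> L" if "compact_open_subgroup L" for L
    using base[OF compact_open_subgroupD(4,6)[OF that]] by (auto simp: powers_subgroup_def)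
  show "I = zero_operators haar \<or> I = reduced"
  proof (cases "\<forall>T\<in>I. \<forall>f\<in>L2_space haar. AE x in haar. T f x = 0")
    case True
    \<comment> \<open>The zero ideal is the whole set of operators vanishing almost everywhere, so
      each of them has to be shown to lie in \<open>I\<close>; norm closedness provides
      this.\<close>
    have "Z \<in> I" if Z: "Z \<in> zero_operators haar" for Z
    proof (rule ideal_limit[OF I reduced_bounded])
      have Zb: "Z \<in> bounded_operators haar" and Z0: "\<And>f. f \<in> L2_space haar \<Longrightarrow> AE x in haar. Z f x = 0"
        using Z by (auto simp: zero_operators_def)
      have "op_norm haar (op_diff Z (conv (indicator {}))) \<le> 0"
      proof (rule op_norm_le)
        fix f assume f: "f \<in> L2_space haar"
        have "op_diff Z (conv (indicator {})) f = Z f"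
          by (simp add: op_diff_apply convolution_operator_def)
        then show "L2_norm haar (op_diff Z (conv (indicator {})) f) \<le> 0 * L2_norm haar f"
          using L2_norm_eq_0_iff[OF bounded_operatorsD(1)[OF Zb f]] Z0[OF f] by simp
      qed simp
      then show "Z \<in> reduced"
        using Zb indicator_compactly_supported[OF compact_open_empty]
        by (auto simp: reduced_cstar_algebra_def op_closure_def intro!: bexI[of _ "indicator {}"] 
            intro: order_le_less_trans)
      fix e :: real assume e: "e > 0"
      obtain T where T: "T \<in> I" using ideal by auto
      have "L2_norm haar (\<lambda>x. Z g x - T g x) \<le> e * L2_norm haar g" if g: "g \<in> L2_space haar" for g
      proof -
        have "AE x in haar. Z g x - T g x = 0"
          using Z0[OF g] True[rule_format, OF T g] by eventually_elim simp
        then have "L2_norm haar (\<lambda>x. Z g x - T g x) = 0"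
          using L2_norm_eq_0_iff[OF L2_space_diff[OF bounded_operatorsD(1)[OF Zb g] bounded_operatorsD(1)[OF Ib[OF T] g]]]
          by simp
        then show ?thesis using e by simp
      qed
      then show "\<exists>S\<in>I. \<forall>g\<in>L2_space haar. L2_norm haar (\<lambda>x. Z g x - S g x) \<le> e * L2_norm haar g"
        using T by blast
    qed
    moreover have "I \<subseteq> zero_operators haar" using True Ib by (auto simp: zero_operators_def)
    ultimately show ?thesis by blast
  next
    case False
    then obtain T f where T: "T \<in> I" "f \<in> L2_space haar" "\<not> (AE x in haar. T f x = 0)" by blast
    then obtain C where C: "compact_open C" "\<not> (AE x in haar. T (indicator C) x = 0)"
      using operator_zero_if_zero_on_indicators[OF Ib[OF T(1)]] by blast
    define \<xi> where "\<xi> = T (indicator C)"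
    have indC: "indicator C \<in> L2_space haar" by (rule L2_space_indicator_compact_open[OF C(1)])
    have \<xi>: "\<xi> \<in> L2_space haar" unfolding \<xi>_def by (rule bounded_operatorsD(1)[OF Ib[OF T(1)] indC])
    obtain E where E: "compact_open E" "(LINT x|haar. indicator E x * \<xi> x) \<noteq> 0"
      using function_zero_if_zero_on_compact_open[OF \<xi>] C(2) by (auto simp: \<xi>_def)
    \<comment> \<open>\<open>K\<close> will be adapted to \<open>C\<close>, so that convolution by
      the indicator of \<open>C\<close> recovers this indicator from that of \<open>K\<close>, and
      to \<open>E\<close>, so that the integral over \<open>E\<close> splits into left cosets of
      \<open>K\<close>.\<close>
    obtain L1 where L1: "compact_open_subgroup L1" "right_invariant L1 C"
      using exists_adapted_subgroup[OF C(1) base_subgroup] by blast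
    obtain L2 where L2: "compact_open_subgroup L2" "right_invariant L2 E" "L2 \<subseteq> L1"
      using exists_adapted_subgroup[OF E(1) L1(1)] by blast
    obtain K where K: "powers_subgroup K" "compact_open_subgroup K" "K \<subseteq> L2" using powers[OF L2(1)] by blast
    have KC: "right_invariant K C" and KE: "right_invariant K E"
      using L1 L2 K(3) by (auto simp: right_invariant_def)
    note KD = compact_open_subgroupD[OF K(2)]
    have EG: "E \<subseteq> carrier G" by (rule compact_open_subset[OF E(1)])
    have \<kappa>: "content K > 0" using KD(2,6) by (intro content_pos) auto
    have indK: "indicator K \<in> L2_space haar" by (rule L2_space_indicator_compact_open[OF KD(2)])
    have "\<exists>A\<in>left_cosets K E. (LINT x|haar. indicator A x * \<xi> x) \<noteq> 0"
    proof (rule ccontr)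
      assume z: "\<not> ?thesis"
      have "(LINT x|haar. indicator E x * \<xi> x) = (LINT x|haar. (\<Sum>A\<in>left_cosets K E. indicator A x * \<xi> x))"
        by (subst step_function_indicator[OF E(1) K(2) KE, symmetric])
          (simp add: step_function_def sum_distrib_right)
      also have "\<dots> = (\<Sum>A\<in>left_cosets K E. LINT x|haar. indicator A x * \<xi> x)"
        using left_cosets_compact_open[OF EG K(2)]
        by (intro Bochner_Integration.integral_sum L2_mult_integrable \<xi> L2_space_indicator_compact_open)
      also have "\<dots> = 0" using z by simp
      finally show False using E(2) by simp
    qed
    then obtain A where A: "A \<in> left_cosets K E" "(LINT x|haar. indicator A x * \<xi> x) \<noteq> 0" by blast
    define h where "h = representative A"
    have h: "h \<in> carrier G" "(\<lambda>k. h \<otimes> k) ` K = A"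
      using representative_left_coset[OF EG K(2) A(1)] by (auto simp: h_def)
    have Bco: "compact_open (right_coset K (inv h))" using right_coset_compact_open[OF _ K(2)] h(1) by simp
    define b where "b = conv (indicator (right_coset K (inv h)))"
    have bC: "indicator (right_coset K (inv h)) \<in> compactly_supported X"
      by (rule indicator_compactly_supported[OF Bco])
    have bb: "b \<in> bounded_operators haar" unfolding b_def by (rule conv_bounded_operator[OF bC])
    let ?c = "conv (indicator C)"
    have cC: "indicator C \<in> compactly_supported X" by (rule indicator_compactly_supported[OF C(1)])
    have cK: "?c (indicator K) \<in> L2_space haar" by (rule L2_conv_indicator[OF C(1) indK])
    have sK: "(\<lambda>x. complex_of_real (content K) * indicator C x) \<in> L2_space haar" by (rule L2_space_scale[OF indC])
    have s\<xi>: "(\<lambda>x. complex_of_real (content K) * \<xi> x) \<in> L2_space haar" by (rule L2_space_scale[OF \<xi>])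
    have "AE x in haar. T (?c (indicator K)) x = T (\<lambda>x. complex_of_real (content K) * indicator C x) x"
      using conv_indicator_indicator[OF K(2) C(1) KC]
      by (intro bounded_operator_cong_AE[OF Ib[OF T(1)] cK sK] AE_I2) simp
    moreover have "AE x in haar. T (\<lambda>x. complex_of_real (content K) * indicator C x) x = complex_of_real (content K) * \<xi> x"
      unfolding \<xi>_def by (rule bounded_operatorsD(3)[OF Ib[OF T(1)] indC])
    ultimately have "AE x in haar. T (?c (indicator K)) x = complex_of_real (content K) * \<xi> x"
      by eventually_elim simp
    then have ae: "AE x in haar. b (T (?c (indicator K))) x = b (\<lambda>x. complex_of_real (content K) * \<xi> x) x"
      by (rule bounded_operator_cong_AE[OF bb bounded_operatorsD(1)[OF Ib[OF T(1)] cK] s\<xi>])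
    \<comment> \<open>On the right, \<open>?c\<close> creates a multiple of the indicator of
      \<open>C\<close> out of that of \<open>K\<close>; on the left, \<open>b\<close> brings the
      integral over \<open>A\<close> back to \<open>K\<close>.\<close>
    define T' where "T' = b \<circ> (T \<circ> ?c)"
    have T': "T' \<in> I" unfolding T'_def b_def using comp conv_reduced[OF bC] conv_reduced[OF cC] T(1) by blast
    have "(LINT x|haar. indicator K x * T' (indicator K) x) = 
        (LINT x|haar. indicator K x * b (\<lambda>x. complex_of_real (content K) * \<xi> x) x)"
    proof (rule integral_cong_AE)
      show "AE x in haar. indicator K x * T' (indicator K) x = indicator K x * b (\<lambda>x. complex_of_real (content K) * \<xi> x) x"
        using ae by eventually_elim (simp add: T'_def)
      show "(\<lambda>x. indicator K x * T' (indicator K) x) \<in> borel_measurable haar"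
        using bounded_operatorsD(1)[OF Ib[OF T'] indK] compact_open_sets_haar[OF KD(2)] 
        by (intro borel_measurable_times borel_measurable_indicator) (auto simp: L2_spaceD)
      show "(\<lambda>x. indicator K x * b (\<lambda>x. complex_of_real (content K) * \<xi> x) x) \<in> borel_measurable haar"
        using bounded_operatorsD(1)[OF bb s\<xi>] compact_open_sets_haar[OF KD(2)] 
        by (intro borel_measurable_times borel_measurable_indicator) (auto simp: L2_spaceD)
    qed
    also have "\<dots> = (LINT x|haar. indicator K x * (content K * ((LINT z|haar. indicator A z * \<xi> z) / modular h)))"
    proof (rule Bochner_Integration.integral_cong[OF refl])
      fix x
      show "indicator K x * b (\<lambda>x. complex_of_real (content K) * \<xi> x) x = 
         indicator K x * (content K * ((LINT z|haar. indicator A z * \<xi> z) / modular h))"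
      proof (cases "x \<in> K")
        case True
        have "b (\<lambda>x. complex_of_real (content K) * \<xi> x) x = content K * b \<xi> x" unfolding b_def by (rule conv_scale)
        then show ?thesis using conv_translated_average[OF K(2) h(1) \<xi> True] h(2) by (simp add: b_def)
      qed simp
    qed
    also have "\<dots> = content K * (content K * ((LINT z|haar. indicator A z * \<xi> z) / modular h))"
      by (simp add: integral_indicator_compact_open[OF KD(2)])
    also have "\<dots> \<noteq> 0" using \<kappa> modular_pos[OF h(1)] A(2) by simp
    finally have pK: "conv (indicator K) \<in> I" by (rule ideal_contains_indicator[OF K(1) I T'])
    \<comment> \<open>The coefficient to be checked is here the square of
      \<open>content J\<close>.\<close>
    have p_small: "conv (indicator J) \<in> I" if J: "powers_subgroup J" "compact_open_subgroup J" "J \<subseteq> K" for J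
    proof (rule ideal_contains_indicator[OF J(1) I pK])
      note JD = compact_open_subgroupD[OF J(2)]
      have "right_invariant J K" using J(3) KD(7) by (auto simp: right_invariant_def)
      then have "(LINT x|haar. indicator J x * conv (indicator K) (indicator J) x) = 
          (LINT x|haar. indicator J x * complex_of_real (content J))"
        using conv_indicator_indicator[OF J(2) KD(2)] J(3)
        by (intro Bochner_Integration.integral_cong) (auto split: split_indicator)
      also have "\<dots> = complex_of_real (content J) * complex_of_real (content J)"
        by (simp add: integral_indicator_compact_open[OF JD(2)])
      also have "\<dots> \<noteq> 0" using content_pos[OF JD(2)] JD(6) by force
      finally show "(LINT x|haar. indicator J x * conv (indicator K) (indicator J) x) \<noteq> 0" .
    qed
    have "R \<in> I" if R: "R \<in> reduced" for R
    proof (rule ideal_limit[OF I reduced_bounded R])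
      fix e :: real assume e: "e > 0"
      obtain f where f: "f \<in> compactly_supported X" 
          "\<And>g. g \<in> L2_space haar \<Longrightarrow> L2_norm haar (\<lambda>x. R g x - conv f g x) \<le> e / 2 * L2_norm haar g"
        using reduced_approximation[OF R, of "e / 2"] e by auto
      obtain F B where F: "compact_open F" "dominated F B f" using compactly_supported_dominated[OF f(1)] .
      \<comment> \<open>The added 1 keeps the denominator positive when \<open>F\<close> is
        empty.\<close>
      define d where "d = e / (2 * (content F + 1))"
      have cF: "content F \<ge> 0" by simp
      have d: "d > 0" unfolding d_def using e cF by (intro divide_pos_pos mult_pos_pos add_nonneg_pos) auto
      have dF: "d * content F \<le> e / 2" 
      proof -
        have "e / (2 * (r + 1)) * r \<le> e / 2" if "r \<ge> 0" for r :: real using that e by (simp add: field_simps)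
        then show ?thesis unfolding d_def using cF by blast
      qed
      obtain L where L: "compact_open_subgroup L" "L \<subseteq> K" "right_invariant L F"
          "\<And>J. compact_open_subgroup J \<Longrightarrow> J \<subseteq> L \<Longrightarrow> dominated F d (\<lambda>y. f y - step_function J F f y)"
        using step_function_approximation[OF f(1) F d K(2)] by blast
      obtain J where J: "powers_subgroup J" "compact_open_subgroup J" "J \<subseteq> L" using powers[OF L(1)] by blast
      note JD = compact_open_subgroupD[OF J(2)]
      have JF: "right_invariant J F" using L(3) J(3) by (auto simp: right_invariant_def)
      have J0: "content J > 0" using JD(2,6) by (intro content_pos) auto
      define s where "s = step_function J F f"
      have s: "s \<in> compactly_supported X" unfolding s_def by (rule step_function_compactly_supported[OF F(1) J(2) JF])
      have ds: "dominated F d (\<lambda>y. f y - s y)" unfolding s_def by (rule L(4)[OF J(2,3)])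
      have fs: "(\<lambda>y. f y - s y) \<in> compactly_supported X"
        using dominatedD(4)[OF ds] 
        by (intro compactly_supportedI[OF continuous_map_diff F(1)] compactly_supported_continuous f(1) s)
      \<comment> \<open>As \<open>s\<close> is constant on left cosets of \<open>J\<close>,
        convolution by \<open>s\<close> absorbs the average over \<open>J\<close> up to the factor
        \<open>content J\<close>.\<close>
      define S where "S = op_scale (1 / complex_of_real (content J)) (conv s \<circ> conv (indicator J))"
      have S: "S \<in> I" unfolding S_def using p_small[OF J(1,2)] J(3) L(2) comp conv_reduced[OF s] by (intro scale) blast
      have "L2_norm haar (\<lambda>x. R g x - S g x) \<le> e * L2_norm haar g" if g: "g \<in> L2_space haar" for g
      proof -
        let ?w = "conv (indicator J) g"
        have w: "?w \<in> L2_space haar" by (rule L2_average[OF J(2) g])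
        have FG: "F \<subseteq> carrier G" by (rule compact_open_subset[OF F(1)])
        have Sx: "S g x = conv s g x" if x: "x \<in> carrier G" for x
        proof -
          have "conv (indicator J) ?w z = complex_of_real (content J) * ?w z" if z: "z \<in> carrier G" for z
            using average_left_invariant[OF z J(2) g] JD(8) 
            by (intro average_left_invariant_function[OF J(2)]) auto
          then have "conv s ?w x = (\<Sum>A\<in>left_cosets J F. f (representative A) * 
              (complex_of_real (content J) * ?w (inv (representative A) \<otimes> x)))"
            unfolding s_def conv_step_function[OF F(1) J(2) JF x w]
            using representative_left_coset(2)[OF FG J(2)] x by (intro sum.cong) auto
          also have "\<dots> = complex_of_real (content J) * conv s g x"
            unfolding s_def conv_step_function[OF F(1) J(2) JF x g] sum_distrib_left by (simp add: mult.left_commute)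
          finally show ?thesis using J0 by (simp add: S_def op_scale_def)
        qed
        have Rg: "R g \<in> L2_space haar" using R reduced_bounded bounded_operatorsD(1) g by blast
        have fg: "conv f g \<in> L2_space haar" "conv s g \<in> L2_space haar"
          using bounded_operatorsD(1)[OF conv_bounded_operator g] f(1) s by blast+
        have "L2_norm haar (\<lambda>x. R g x - S g x) = L2_norm haar (\<lambda>x. R g x - conv s g x)"
          using Sx by (intro L2_norm_cong) simp
        also have "\<dots> \<le> L2_norm haar (\<lambda>x. R g x - conv f g x) + L2_norm haar (\<lambda>x. conv f g x - conv s g x)"
          by (rule L2_norm_triangle_diff[OF Rg fg])
        also have "L2_norm haar (\<lambda>x. conv f g x - conv s g x) = L2_norm haar (conv (\<lambda>y. f y - s y) g)"
          using conv_step_function_close[OF F J(2) JF ds[unfolded s_def] g] 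
          by (intro L2_norm_cong) (simp add: s_def)
        also have "\<dots> \<le> d * content F * L2_norm haar g"
          by (rule L2_norm_conv_dominated[OF F(1) ds g conv_measurable[OF fs g]])
        also have "\<dots> \<le> e / 2 * L2_norm haar g" using dF by (intro mult_right_mono) auto
        finally show ?thesis using f(2)[OF g] by simp
      qed
      then show "\<exists>S\<in>I. \<forall>g\<in>L2_space haar. L2_norm haar (\<lambda>x. R g x - S g x) \<le> e * L2_norm haar g"
        using S by blast
    qed
    then show ?thesis using IA by blast
  qed
qed

end

section \<open>Free products of groups of order two\<close>

text \<open>
  Elements of the free product of groups of order two indexed by the letters are represented by
  words without equal neighbours.
\<close>

definition push :: "'s \<Rightarrow> 's list \<Rightarrow> 's list" where
  "push s w = (case w of [] \<Rightarrow> [s] | x # xs \<Rightarrow> if x = s then xs else s # w)"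

text \<open>The letters of \<open>u\<close> act in turn on the reduced word \<open>v\<close>. As in
  van der Waerden's treatment of free products, associativity follows from each letter acting as an
  involution.\<close>

definition word_mult :: "'s list \<Rightarrow> 's list \<Rightarrow> 's list" where
  "word_mult u v = foldr push u v"

lemma push_simps [simp]:
  "push s [] = [s]" "push s (x # xs) = (if x = s then xs else s # x # xs)"
  by (auto simp: push_def)

lemma word_mult_simps [simp]:
  "word_mult [] v = v" "word_mult (s # u) v = push s (word_mult u v)"
  by (auto simp: word_mult_def)

lemma distinct_adj_push: "distinct_adj w \<Longrightarrow> distinct_adj (push s w)"
  by (cases w) (auto simp: distinct_adj_Cons)

text \<open>Reducedness makes a letter an involution: pushing \<open>s\<close> twice onto
  \<open>[s, s]\<close> would give the empty word.\<close>

lemma push_push: "distinct_adj w \<Longrightarrow> push s (push s w) = w"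
  by (cases w; cases "tl w") (auto simp: distinct_adj_Cons)

lemma distinct_adj_word_mult: "distinct_adj v \<Longrightarrow> distinct_adj (word_mult u v)"
  by (induction u) (auto intro: distinct_adj_push)

lemma word_mult_push:
  assumes "distinct_adj v" shows "word_mult (push s u) v = push s (word_mult u v)"
  using push_push[OF distinct_adj_word_mult[OF assms]] by (cases u) auto

lemma word_mult_assoc:
  "distinct_adj w \<Longrightarrow> word_mult (word_mult u v) w = word_mult u (word_mult v w)"
  by (induction u) (auto simp: word_mult_push)

lemma word_mult_append: "distinct_adj (u @ v) \<Longrightarrow> word_mult u v = u @ v"
proof (induction u)
  case (Cons s u)
  then have "distinct_adj (u @ v)" by (auto simp: distinct_adj_Cons)
  then show ?case using Cons by (cases "u @ v") (auto simp: distinct_adj_Cons)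
qed simp

lemma word_mult_rev: "word_mult (rev u) u = []"
proof (induction u)
  case (Cons s u)
  have "word_mult (rev (s # u)) (s # u) = word_mult (rev u) (push s (s # u))"
    by (simp add: word_mult_def)
  then show ?case using Cons by simp
qed simp

lemma set_push: "set (push s w) \<subseteq> insert s (set w)"
  by (cases w) auto

lemma set_word_mult: "set (word_mult u v) \<subseteq> set u \<union> set v"
  using set_push by (induction u) fastforce+

lemma map_push:
  assumes "inj_on f (insert s (set w))" shows "map f (push s w) = push (f s) (map f w)"
proof (cases w)
  case (Cons x xs)
  then have "f x = f s \<longleftrightarrow> x = s" using assms by (auto simp: inj_on_def)
  then show ?thesis using Cons by simp
qed simp

lemma map_word_mult:
  assumes "inj_on f (set u \<union> set v)" shows "map f (word_mult u v) = word_mult (map f u) (map f v)"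
  using assms
proof (induction u)
  case (Cons s u)
  have "inj_on f (insert s (set (word_mult u v)))"
    by (rule inj_on_subset[OF Cons.prems]) (use set_word_mult[of u v] in auto)
  then have "map f (push s (word_mult u v)) = push (f s) (map f (word_mult u v))" by (rule map_push)
  moreover have "inj_on f (set u \<union> set v)" by (rule inj_on_subset[OF Cons.prems]) auto
  ultimately show ?case using Cons.IH by simp
qed simp

lemma continuous_map_discreteI:
  assumes "\<And>x. x \<in> topspace Z \<Longrightarrow> f x \<in> S"
    and "\<And>x. x \<in> topspace Z \<Longrightarrow> \<exists>U. openin Z U \<and> x \<in> U \<and> (\<forall>y\<in>U. f y = f x)"
  shows "continuous_map Z (discrete_topology S) f"
  unfolding continuous_map_def
proof (intro conjI allI impI)
  show "f \<in> topspace Z \<rightarrow> topspace (discrete_topology S)" using assms(1) by auto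
  fix V
  show "openin Z {x \<in> topspace Z. f x \<in> V}"
  proof (subst openin_subopen, intro ballI)
    fix x assume x: "x \<in> {x \<in> topspace Z. f x \<in> V}"
    then obtain U where U: "openin Z U" "x \<in> U" "\<forall>y\<in>U. f y = f x" using assms(2)[of x] by blast
    have "U \<subseteq> {x \<in> topspace Z. f x \<in> V}"
    proof
      fix y assume y: "y \<in> U"
      then have "f y \<in> V" using bspec[OF U(3) y] x by simp
      then show "y \<in> {x \<in> topspace Z. f x \<in> V}" using openin_subset[OF U(1)] y by blast
    qed
    with U show "\<exists>T. openin Z T \<and> x \<in> T \<and> T \<subseteq> {x \<in> topspace Z. f x \<in> V}"
      by blast
  qed
qed

section \<open>The semidirect product\<close>

context td_group
begin

text \<open>Every compact open subgroup occurs, with itself as stabiliser, and translates of letters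
  are letters. Openness of the stabiliser makes the action on the discrete set of words
  continuous.\<close>

definition letters :: "('a set \<times> nat) set" where
  "letters = {(C, n). C \<subseteq> carrier G \<and> openin X {g \<in> carrier G. (\<lambda>x. g \<otimes> x) ` C = C}}"

definition act :: "'a \<Rightarrow> 'a set \<times> nat \<Rightarrow> 'a set \<times> nat" where
  "act g s = ((\<lambda>x. g \<otimes> x) ` fst s, snd s)"

definition words :: "('a set \<times> nat) list set" where
  "words = {w. set w \<subseteq> letters \<and> distinct_adj w}"

definition overgroup :: "'a overgroup_element monoid" where
  "overgroup = \<lparr>carrier = words \<times> carrier G, 
     mult = (\<lambda>(u, g) (v, h). (word_mult u (map (act g) v), g \<otimes> h)), one = ([], \<one>)\<rparr>"

definition overgroup_topology :: "'a overgroup_element topology" where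
  "overgroup_topology = prod_topology (discrete_topology words) X"

abbreviation embedded :: "'a set \<Rightarrow> 'a overgroup_element set" where
  "embedded A \<equiv> {[]} \<times> A"

lemma image_mult_assoc:
  assumes "g \<in> carrier G" "h \<in> carrier G" "C \<subseteq> carrier G"
  shows "(\<lambda>x. g \<otimes> x) ` (\<lambda>x. h \<otimes> x) ` C = (\<lambda>x. g \<otimes> h \<otimes> x) ` C"
  unfolding image_image using assms by (intro image_cong refl) (auto simp: m_assoc)

lemma image_one: "C \<subseteq> carrier G \<Longrightarrow> (\<lambda>x. \<one> \<otimes> x) ` C = C"
  by (force simp: image_iff)

lemma act_mult: "g \<in> carrier G \<Longrightarrow> h \<in> carrier G \<Longrightarrow> s \<in> letters \<Longrightarrow> act g (act h s) = act (g \<otimes> h) s"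
  by (cases s) (simp add: act_def letters_def image_mult_assoc)

lemma act_one: "s \<in> letters \<Longrightarrow> act \<one> s = s"
  by (cases s) (simp add: act_def letters_def image_one)

text \<open>The transporter is the left translate by \<open>g\<close> of the stabiliser of
  \<open>s\<close>, realised as a preimage under left translation by \<open>inv g\<close>.\<close>

lemma openin_transporter:
  assumes g: "g \<in> carrier G" and s: "s \<in> letters"
  shows "openin X {h \<in> carrier G. act h s = act g s}"
proof -
  obtain C n where C: "s = (C, n)" "C \<subseteq> carrier G" "openin X {g \<in> carrier G. (\<lambda>x. g \<otimes> x) ` C = C}"
    using s by (auto simp: letters_def)
  have "openin X {h \<in> topspace X. inv g \<otimes> h \<in> {g \<in> carrier G. (\<lambda>x. g \<otimes> x) ` C = C}}"
    using g by (intro openin_continuous_map_preimage[OF continuous_map_left_translation C(3)]) auto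
  moreover have "(\<lambda>x. inv g \<otimes> h \<otimes> x) ` C = C \<longleftrightarrow> (\<lambda>x. h \<otimes> x) ` C = (\<lambda>x. g \<otimes> x) ` C" if h: "h \<in> carrier G" for h
  proof
    assume "(\<lambda>x. inv g \<otimes> h \<otimes> x) ` C = C"
    then have "(\<lambda>x. g \<otimes> x) ` C = (\<lambda>x. g \<otimes> x) ` (\<lambda>x. inv g \<otimes> h \<otimes> x) ` C" by simp
    also have "\<dots> = (\<lambda>x. g \<otimes> (inv g \<otimes> h) \<otimes> x) ` C" using g h C(2) by (intro image_mult_assoc) auto
    finally show "(\<lambda>x. h \<otimes> x) ` C = (\<lambda>x. g \<otimes> x) ` C" using g h by simp
  next
    assume a: "(\<lambda>x. h \<otimes> x) ` C = (\<lambda>x. g \<otimes> x) ` C"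
    have "(\<lambda>x. inv g \<otimes> h \<otimes> x) ` C = (\<lambda>x. inv g \<otimes> x) ` (\<lambda>x. h \<otimes> x) ` C"
      using g h C(2) by (intro image_mult_assoc[symmetric]) auto
    also have "\<dots> = (\<lambda>x. inv g \<otimes> g \<otimes> x) ` C" 
      unfolding a using g C(2) by (intro image_mult_assoc) auto
    finally show "(\<lambda>x. inv g \<otimes> h \<otimes> x) ` C = C" using g C(2) by (simp add: image_one)
  qed
  then have "{h \<in> topspace X. inv g \<otimes> h \<in> {g \<in> carrier G. (\<lambda>x. g \<otimes> x) ` C = C}} = {h \<in> carrier G. act h s = act g s}"
    using g by (intro Collect_cong) (simp add: act_def C(1) cong: conj_cong)
  ultimately show ?thesis by simp
qed

text \<open>The stabiliser of the translated letter is the preimage, under right translation by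
  \<open>g\<close>, of the transporter from \<open>s\<close> to \<open>act g s\<close>.\<close>

lemma act_letters:
  assumes g: "g \<in> carrier G" and s: "s \<in> letters" shows "act g s \<in> letters"
proof -
  obtain C n where C: "s = (C, n)" "C \<subseteq> carrier G" using s by (auto simp: letters_def)
  have "openin X {h \<in> topspace X. h \<otimes> g \<in> {h \<in> carrier G. act h s = act g s}}"
    by (rule openin_continuous_map_preimage[OF continuous_map_right_translation[OF g] openin_transporter[OF g s]])
  moreover have "{h \<in> topspace X. h \<otimes> g \<in> {h \<in> carrier G. act h s = act g s}} = 
      {h \<in> carrier G. (\<lambda>x. h \<otimes> x) ` (\<lambda>x. g \<otimes> x) ` C = (\<lambda>x. g \<otimes> x) ` C}"
    using g C image_mult_assoc[OF _ g C(2)] by (intro Collect_cong) (simp add: act_def cong: conj_cong)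
  moreover have "(\<lambda>x. g \<otimes> x) ` C \<subseteq> carrier G" using g C(2) by auto
  ultimately show ?thesis using C(1) by (simp add: letters_def act_def)
qed

lemma inj_on_act: 
  assumes g: "g \<in> carrier G" shows "inj_on (act g) letters"
proof (rule inj_on_inverseI)
  fix s assume "s \<in> letters"
  then show "act (inv g) (act g s) = s" using g by (simp add: act_mult act_one)
qed

lemma map_act_words: "g \<in> carrier G \<Longrightarrow> w \<in> words \<Longrightarrow> map (act g) w \<in> words"
  using act_letters inj_on_subset[OF inj_on_act[of g]] by (auto simp: words_def distinct_adj_map_iff subset_iff)

lemma word_mult_words: "u \<in> words \<Longrightarrow> v \<in> words \<Longrightarrow> word_mult u v \<in> words"
  using set_word_mult[of u v] distinct_adj_word_mult[of v u] by (auto simp: words_def)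

lemma map_act_mult: "g \<in> carrier G \<Longrightarrow> h \<in> carrier G \<Longrightarrow> w \<in> words \<Longrightarrow> map (act g) (map (act h) w) = map (act (g \<otimes> h)) w"
  by (auto simp: words_def act_mult subset_iff)

lemma map_act_one: "w \<in> words \<Longrightarrow> map (act \<one>) w = w"
  by (auto simp: words_def act_one subset_iff intro!: map_idI)

lemma map_act_word_mult: 
  "g \<in> carrier G \<Longrightarrow> u \<in> words \<Longrightarrow> v \<in> words \<Longrightarrow> map (act g) (word_mult u v) = word_mult (map (act g) u) (map (act g) v)"
  by (intro map_word_mult inj_on_subset[OF inj_on_act]) (auto simp: words_def)

lemma rev_words: "w \<in> words \<Longrightarrow> rev w \<in> words"
  by (auto simp: words_def)

lemma Nil_words [simp]: "[] \<in> words"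
  by (simp add: words_def)

lemma overgroup_simps [simp]:
  "carrier overgroup = words \<times> carrier G" "\<one>\<^bsub>overgroup\<^esub> = ([], \<one>)"
  "(u, g) \<otimes>\<^bsub>overgroup\<^esub> (v, h) = (word_mult u (map (act g) v), g \<otimes> h)"
  by (auto simp: overgroup_def)

lemma overgroup_left_inverse:
  assumes "w \<in> words" "g \<in> carrier G"
  shows "(map (act (inv g)) (rev w), inv g) \<otimes>\<^bsub>overgroup\<^esub> (w, g) = \<one>\<^bsub>overgroup\<^esub>"
proof -
  have "word_mult (map (act (inv g)) (rev w)) (map (act (inv g)) w) = map (act (inv g)) (word_mult (rev w) w)"
    using assms by (simp only: map_act_word_mult rev_words inv_closed)
  then show ?thesis using assms by (simp add: word_mult_rev)
qed

lemma group_overgroup: "group overgroup"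
proof (rule groupI)
  fix x y z
  assume "x \<in> carrier overgroup" "y \<in> carrier overgroup" "z \<in> carrier overgroup"
  then obtain u g v h w k where *: "x = (u, g)" "y = (v, h)" "z = (w, k)" "u \<in> words" "v \<in> words" "w \<in> words"
    "g \<in> carrier G" "h \<in> carrier G" "k \<in> carrier G" by auto
  have "map (act (g \<otimes> h)) w \<in> words" using * by (simp add: map_act_words)
  then have 1: "word_mult (word_mult u (map (act g) v)) (map (act (g \<otimes> h)) w) = 
      word_mult u (word_mult (map (act g) v) (map (act (g \<otimes> h)) w))"
    by (intro word_mult_assoc) (simp add: words_def)
  have 2: "map (act (g \<otimes> h)) w = map (act g) (map (act h) w)" using * by (simp only: map_act_mult)
  have 3: "word_mult (map (act g) v) (map (act g) (map (act h) w)) = map (act g) (word_mult v (map (act h) w))"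
    using * by (intro map_act_word_mult[symmetric] map_act_words)
  from 1 have "word_mult (word_mult u (map (act g) v)) (map (act (g \<otimes> h)) w) = 
      word_mult u (map (act g) (word_mult v (map (act h) w)))"
    unfolding 2 3 .
  then show "x \<otimes>\<^bsub>overgroup\<^esub> y \<otimes>\<^bsub>overgroup\<^esub> z = x \<otimes>\<^bsub>overgroup\<^esub> (y \<otimes>\<^bsub>overgroup\<^esub> z)"
    using * by (simp add: m_assoc)
next
  fix x y
  assume "x \<in> carrier overgroup" "y \<in> carrier overgroup"
  then show "x \<otimes>\<^bsub>overgroup\<^esub> y \<in> carrier overgroup"
    by (cases x; cases y) (simp add: word_mult_words map_act_words)
next
  fix x assume x: "x \<in> carrier overgroup"
  then show "\<one>\<^bsub>overgroup\<^esub> \<otimes>\<^bsub>overgroup\<^esub> x = x" by (auto simp: map_act_one)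
  obtain w g where "x = (w, g)" "w \<in> words" "g \<in> carrier G" using x by auto
  then show "\<exists>y\<in>carrier overgroup. y \<otimes>\<^bsub>overgroup\<^esub> x = \<one>\<^bsub>overgroup\<^esub>"
    using overgroup_left_inverse by (intro bexI[of _ "(map (act (inv g)) (rev w), inv g)"]) (auto intro: map_act_words rev_words)
qed simp

lemma inv_overgroup:
  assumes "w \<in> words" "g \<in> carrier G"
  shows "inv\<^bsub>overgroup\<^esub> (w, g) = (map (act (inv g)) (rev w), inv g)"
  using assms
  by (intro group.inv_equality[OF group_overgroup overgroup_left_inverse]) (auto intro: map_act_words rev_words)

lemma openin_word_transporter:
  assumes g: "g \<in> carrier G" and w: "w \<in> words"
  shows "openin X {h \<in> carrier G. map (act h) w = map (act g) w}"
proof -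
  have "set w \<subseteq> letters" using w by (simp add: words_def)
  then show ?thesis
  proof (induction w)
    case Nil
    then show ?case using openin_topspace[of X] by simp
  next
    case (Cons s w)
    have "{h \<in> carrier G. map (act h) (s # w) = map (act g) (s # w)} = 
        {h \<in> carrier G. act h s = act g s} \<inter> {h \<in> carrier G. map (act h) w = map (act g) w}" by auto
    then show ?case using Cons openin_transporter[OF g, of s] by (simp add: openin_Int)
  qed
qed

section \<open>The topology of the semidirect product\<close>

lemma topspace_overgroup_topology [simp]: "topspace overgroup_topology = words \<times> carrier G"
  by (simp add: overgroup_topology_def)

lemma openin_overgroup_Times: 
  "A \<subseteq> words \<Longrightarrow> openin X U \<Longrightarrow> openin overgroup_topology (A \<times> U)"
  by (simp add: overgroup_topology_def openin_prod_Times_iff)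

lemma continuous_map_overgroup_snd: "continuous_map overgroup_topology X snd"
  unfolding overgroup_topology_def by (rule continuous_map_snd)

text \<open>Near a given group element the action on a fixed word does not change, by
  \<open>openin_word_transporter\<close>. Hence the word components of product and inverse are
  locally constant, while the components in \<open>G\<close> are those of \<open>G\<close>.\<close>

lemma topological_group_overgroup: "topological_group overgroup overgroup_topology"
  unfolding topological_group_def
proof (intro conjI group_overgroup)
  let ?Y = overgroup_topology and ?H = overgroup
  let ?Z = "prod_topology ?Y ?Y"
  show "topspace ?Y = carrier ?H" by simp
  have fst: "continuous_map ?Z X (\<lambda>z. snd (fst z))" and snd: "continuous_map ?Z X (\<lambda>z. snd (snd z))"
    using continuous_map_compose[OF continuous_map_fst continuous_map_overgroup_snd, of ?Y]
      continuous_map_compose[OF continuous_map_snd continuous_map_overgroup_snd, of ?Y] by (auto simp: o_def)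
  have "continuous_map ?Z (discrete_topology words) (\<lambda>z. word_mult (fst (fst z)) (map (act (snd (fst z))) (fst (snd z))))"
  proof (rule continuous_map_discreteI)
    fix z assume "z \<in> topspace ?Z"
    then obtain u g v h where z: "z = ((u, g), (v, h))" "u \<in> words" "v \<in> words" "g \<in> carrier G" "h \<in> carrier G" by auto
    show "word_mult (fst (fst z)) (map (act (snd (fst z))) (fst (snd z))) \<in> words"
      using z by (simp add: word_mult_words map_act_words)
    let ?U = "({u} \<times> {k \<in> carrier G. map (act k) v = map (act g) v}) \<times> ({v} \<times> carrier G)"
    have "openin ?Z ?U"
      using openin_word_transporter[OF z(4,3)] z openin_topspace[of X]
      by (simp add: openin_prod_Times_iff openin_overgroup_Times)
    then show "\<exists>U. openin ?Z U \<and> z \<in> U \<and> (\<forall>y\<in>U. word_mult (fst (fst y)) (map (act (snd (fst y))) (fst (snd y))) =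
        word_mult (fst (fst z)) (map (act (snd (fst z))) (fst (snd z))))"
      using z by (intro exI[of _ ?U]) (auto simp del: map_eq_conv)
  qed
  then have "continuous_map ?Z ?Y (\<lambda>z. (word_mult (fst (fst z)) (map (act (snd (fst z))) (fst (snd z))), 
      snd (fst z) \<otimes> snd (snd z)))"
    unfolding overgroup_topology_def using continuous_map_mult[OF fst snd]
    by (intro continuous_map_pairedI) (auto simp: overgroup_topology_def)
  moreover have "(\<lambda>(x, y). x \<otimes>\<^bsub>?H\<^esub> y) = (\<lambda>z. (word_mult (fst (fst z)) (map (act (snd (fst z))) (fst (snd z))), 
      snd (fst z) \<otimes> snd (snd z)))"
    by auto
  ultimately show "continuous_map ?Z ?Y (\<lambda>(x, y). x \<otimes>\<^bsub>?H\<^esub> y)" by simp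
  have "continuous_map ?Y (discrete_topology words) (\<lambda>z. map (act (inv (snd z))) (rev (fst z)))"
  proof (rule continuous_map_discreteI)
    fix z assume "z \<in> topspace ?Y"
    then obtain w g where z: "z = (w, g)" "w \<in> words" "g \<in> carrier G" by auto
    show "map (act (inv (snd z))) (rev (fst z)) \<in> words" using z by (simp only: fst_conv snd_conv map_act_words rev_words inv_closed)
    let ?N = "{k \<in> topspace X. inv k \<in> {k \<in> carrier G. map (act k) (rev w) = map (act (inv g)) (rev w)}}"
    have "openin X ?N"
      using z by (intro openin_continuous_map_preimage[OF continuous_map_inv[OF continuous_map_id[unfolded id_def]]]
        openin_word_transporter rev_words) auto
    then have "openin ?Y ({w} \<times> ?N)" using z by (intro openin_overgroup_Times) auto
    then show "\<exists>U. openin ?Y U \<and> z \<in> U \<and> (\<forall>y\<in>U. map (act (inv (snd y))) (rev (fst y)) = map (act (inv (snd z))) (rev (fst z)))"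
      using z by (intro exI[of _ "{w} \<times> ?N"]) (auto simp del: map_eq_conv)
  qed
  then have "continuous_map ?Y ?Y (\<lambda>z. (map (act (inv (snd z))) (rev (fst z)), inv (snd z)))"
    unfolding overgroup_topology_def using continuous_map_inv[OF continuous_map_overgroup_snd]
    by (intro continuous_map_pairedI) (auto simp: overgroup_topology_def)
  then show "continuous_map ?Y ?Y (\<lambda>x. inv\<^bsub>?H\<^esub> x)"
    by (rule continuous_map_eq) (auto simp: inv_overgroup)
qed

lemma Hausdorff_overgroup: "Hausdorff_space overgroup_topology"
  unfolding overgroup_topology_def by (simp add: Hausdorff_space_prod_topology Hausdorff)

lemma top_group_overgroup: "top_group overgroup overgroup_topology"
  by (intro top_group.intro top_group_axioms.intro group_overgroup topological_group_overgroup Hausdorff_overgroup)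

lemma compact_open_subgroup_overgroup:
  assumes K: "compact_open_subgroup K"
  shows "top_group.compact_open_subgroup overgroup overgroup_topology (embedded K)"
proof -
  interpret H: top_group overgroup overgroup_topology by (rule top_group_overgroup)
  note KD = compact_open_subgroupD[OF K]
  show ?thesis
    unfolding H.compact_open_subgroup_def H.compact_open_def
  proof (intro conjI)
    show "subgroup (embedded K) overgroup"
    proof (rule H.subgroupI)
      fix a assume a: "a \<in> embedded K"
      then show "inv\<^bsub>overgroup\<^esub> a \<in> embedded K" using KD(8,9) by (auto simp: inv_overgroup)
      fix b assume "b \<in> embedded K"
      then show "a \<otimes>\<^bsub>overgroup\<^esub> b \<in> embedded K" using a KD(7) by auto
    qed (use KD(3,6) in auto)
    show "compactin overgroup_topology (embedded K)"
      using KD(5) by (simp add: overgroup_topology_def compactin_Times)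
    show "openin overgroup_topology (embedded K)"
      using KD(4) by (intro openin_overgroup_Times) auto
  qed
qed

lemma small_subgroup_overgroup:
  assumes U: "openin overgroup_topology U" "\<one>\<^bsub>overgroup\<^esub> \<in> U"
  obtains K where "compact_open_subgroup K" "embedded K \<subseteq> U"
proof -
  obtain V W where VW: "openin X W" "[] \<in> V" "\<one> \<in> W" "V \<times> W \<subseteq> U"
  proof -
    have "([], \<one>) \<in> U" using U(2) by simp
    from U(1)[unfolded overgroup_topology_def openin_prod_topology_alt, rule_format, OF this]
    show thesis using that by blast
  qed
  obtain K where "compact_open_subgroup K" "K \<subseteq> W" using small_subgroup[OF VW(1,3)] by blast
  then show thesis using VW by (intro that[of K]) auto
qed

lemma td_group_overgroup: "td_group overgroup overgroup_topology"
proof (intro td_group.intro top_group_overgroup td_group_axioms.intro)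
  fix U assume "openin overgroup_topology U" "\<one>\<^bsub>overgroup\<^esub> \<in> U"
  then obtain K where "compact_open_subgroup K" "embedded K \<subseteq> U" by (rule small_subgroup_overgroup)
  then show "\<exists>K. top_group.compact_open_subgroup overgroup overgroup_topology K \<and> K \<subseteq> U"
    using compact_open_subgroup_overgroup by blast
qed

text \<open>One direction makes the letters \<open>(K, n)\<close> commute with \<open>K\<close>; the
  other ensures that elements outside \<open>K\<close> move them.\<close>

lemma image_compact_open_subgroup_iff:
  assumes K: "compact_open_subgroup K" and g: "g \<in> carrier G"
  shows "(\<lambda>x. g \<otimes> x) ` K = K \<longleftrightarrow> g \<in> K"
proof
  note KD = compact_open_subgroupD[OF K]
  show "g \<in> K" if "(\<lambda>x. g \<otimes> x) ` K = K"
    using that mem_left_coset_self[OF KD(1) g] by blast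
  show "(\<lambda>x. g \<otimes> x) ` K = K" if "g \<in> K"
    using left_coset_eq[OF KD(1) one_closed, of g] that KD(3) image_one[OF KD(3)] by auto
qed

text \<open>
  A letter \<open>(K, n)\<close> commutes with \<open>K\<close>.  If \<open>n\<close> is not an index of a letter of \<open>w\<close>, then no
  cancellation can occur when \<open>(w, g)\<close> is multiplied by words starting with \<open>(K, n)\<close>.
\<close>

lemma powers_subgroup_overgroup:
  assumes K: "compact_open_subgroup K"
  shows "td_group.powers_subgroup overgroup overgroup_topology (embedded K)"
proof -
  interpret H: td_group overgroup overgroup_topology by (rule td_group_overgroup)
  note KD = compact_open_subgroupD[OF K]
  have letter: "(K, n) \<in> letters" for n
  proof -
    have "{g \<in> carrier G. (\<lambda>x. g \<otimes> x) ` K = K} = K" using image_compact_open_subgroup_iff[OF K] KD(9) by auto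
    then show ?thesis using KD(3,4) by (simp add: letters_def)
  qed
  show ?thesis
    unfolding H.powers_subgroup_def
  proof (intro conjI allI impI compact_open_subgroup_overgroup[OF K])
    fix S and m :: nat
    assume "compactin overgroup_topology S \<and> S \<inter> embedded K = {}"
    then have S: "compactin overgroup_topology S" "S \<inter> embedded K = {}" by auto
    have SH: "S \<subseteq> words \<times> carrier G" using compactin_subset_topspace[OF S(1)] by simp
    \<comment> \<open>A compact set in a discrete space is finite, so \<open>S\<close> involves
      finitely many words, and all their indices lie below some \<open>b\<close>.\<close>
    have "compactin (discrete_topology words) (fst ` S)"
      using S(1) unfolding overgroup_topology_def by (rule image_compactin[OF _ continuous_map_fst])
    then have "finite (fst ` S)" by (simp add: compactin_discrete_topology)
    then have "finite (\<Union>w\<in>fst ` S. snd ` set w)" by (rule finite_UN_I) simp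
    then obtain b where b: "\<And>n. n \<in> (\<Union>w\<in>fst ` S. snd ` set w) \<Longrightarrow> n < b"
      by (meson finite_nat_set_iff_bounded)
    define t where "t i = ([(K, b + i)], \<one>)" for i
    \<comment> \<open>The ping-pong domains: reduced words beginning with the letter of
      \<open>t i\<close>, disjoint for distinct \<open>i\<close>.\<close>
    define D where "D i = {w \<in> words. w \<noteq> [] \<and> hd w = (K, b + i)} \<times> carrier G" for i
    have tw: "[(K, n)] \<in> words" for n using letter by (simp add: words_def)
    have "t i \<otimes>\<^bsub>overgroup\<^esub> (y \<otimes>\<^bsub>overgroup\<^esub> (t i \<otimes>\<^bsub>overgroup\<^esub> x)) \<in> D i" 
      if y: "y \<in> S" and x: "x \<in> carrier overgroup - D i" for i x y
    proof -
      obtain w g where wg: "y = (w, g)" "w \<in> words" "g \<in> carrier G" using y SH by auto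
      obtain v h where vh: "x = (v, h)" "v \<in> words" "h \<in> carrier G" using x by auto
      let ?s = "(K, b + i)"
      \<comment> \<open>As \<open>x\<close> lies outside \<open>D i\<close>, the letter can be put
        in front of \<open>v\<close> without cancellation.\<close>
      have v: "v = [] \<or> hd v \<noteq> ?s" using x vh by (auto simp: D_def)
      then have sv: "?s # v \<in> words" using vh letter by (auto simp: words_def distinct_adj_Cons)
      have tx: "t i \<otimes>\<^bsub>overgroup\<^esub> x = (?s # v, h)"
      proof -
        have "push ?s v = ?s # v" using v by (cases v) auto
        then show ?thesis using vh(3) by (simp add: t_def vh(1) map_act_one[OF vh(2)])
      qed
      let ?z = "map (act g) (?s # v)"
      have z: "?z \<in> words" by (rule map_act_words[OF wg(3) sv])
      \<comment> \<open>The action preserves indices, so the last letter of \<open>w\<close>, of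
        index below \<open>b\<close>, cannot cancel the first letter of \<open>?z\<close>, of index
        \<open>b + i\<close>.\<close>
      have idx: "snd r \<noteq> b + i" if "r \<in> set w" for r
        using b[of "snd r"] y wg that by force
      have "distinct_adj (w @ ?z)"
      proof -
        have "last w \<noteq> hd ?z" if "w \<noteq> []" using idx[OF last_in_set[OF that]] by (auto simp: act_def)
        then show ?thesis using wg(2) z unfolding words_def distinct_adj_append_iff by blast
      qed
      then have wz: "word_mult w ?z = w @ ?z" by (rule word_mult_append)
      \<comment> \<open>If \<open>w\<close> is empty, then \<open>g\<close> is outside
        \<open>K\<close> because \<open>S\<close> avoids \<open>K\<close>, and the translated letter
        differs from \<open>?s\<close> in its set although the indices agree.\<close>
      have hd: "hd (w @ ?z) \<noteq> ?s"
      proof (cases w)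
        case Nil
        then have "g \<notin> K" using S(2) y wg by auto
        then show ?thesis using Nil image_compact_open_subgroup_iff[OF K wg(3)] by (simp add: act_def)
      next
        case (Cons r w')
        then show ?thesis using idx[of r] by auto
      qed
      have "w @ ?z \<in> words" using word_mult_words[OF wg(2) z] wz by simp
      then have "w @ ?z \<in> words" "?s # w @ ?z \<in> words" 
        using hd letter by (cases "w @ ?z"; auto simp: words_def distinct_adj_Cons)+
      moreover have "t i \<otimes>\<^bsub>overgroup\<^esub> (y \<otimes>\<^bsub>overgroup\<^esub> (t i \<otimes>\<^bsub>overgroup\<^esub> x)) = (?s # w @ ?z, g \<otimes> h)"
      proof -
        have "y \<otimes>\<^bsub>overgroup\<^esub> (t i \<otimes>\<^bsub>overgroup\<^esub> x) = (w @ ?z, g \<otimes> h)"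
          using wz by (simp add: tx wg(1))
        moreover have "push ?s (w @ ?z) = ?s # w @ ?z" using hd by (cases "w @ ?z") auto
        ultimately show ?thesis 
          using \<open>w @ ?z \<in> words\<close> wg vh map_act_one[OF \<open>w @ ?z \<in> words\<close>] by (simp add: t_def del: map_append list.map)
      qed
      ultimately show ?thesis using wg vh by (simp add: D_def)
    qed
    moreover have "t i \<otimes>\<^bsub>overgroup\<^esub> k = k \<otimes>\<^bsub>overgroup\<^esub> t i" if k: "k \<in> embedded K" for i k
    proof -
      obtain l where l: "k = ([], l)" "l \<in> K" using k by auto
      have "act l (K, b + i) = (K, b + i)" 
        using image_compact_open_subgroup_iff[OF K KD(9)[OF l(2)]] l(2) by (simp add: act_def)
      then show ?thesis using l KD(9) by (simp add: t_def)
    qed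
    moreover have "openin overgroup_topology (D i)" for i
      unfolding D_def using openin_topspace[of X] by (intro openin_overgroup_Times) auto
    moreover have "t i \<otimes>\<^bsub>overgroup\<^esub> t i = \<one>\<^bsub>overgroup\<^esub>" for i
      using map_act_one[OF tw[of "b + i"]] by (simp add: t_def)
    moreover have "t i \<in> carrier overgroup" for i using tw by (simp add: t_def)
    moreover have "D i \<inter> D j = {}" if "i \<noteq> j" for i j using that by (auto simp: D_def)
    ultimately have "H.averaging_family (embedded K) S m t D"
      unfolding H.averaging_family_def by blast
    then show "\<exists>t D. H.averaging_family (embedded K) S m t D" by blast
  qed
qed

lemma cstar_simple_overgroup: "cstar_simple overgroup overgroup_topology"
proof -
  interpret H: td_group overgroup overgroup_topology by (rule td_group_overgroup)
  show ?thesis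
  proof (rule H.cstar_simple_if_powers_subgroups)
    fix U assume "openin overgroup_topology U" "\<one>\<^bsub>overgroup\<^esub> \<in> U"
    then obtain K where "compact_open_subgroup K" "embedded K \<subseteq> U" by (rule small_subgroup_overgroup)
    then show "\<exists>K. H.powers_subgroup K \<and> K \<subseteq> U" using powers_subgroup_overgroup by blast
  qed
qed

lemma isomorphic_to_open_subgroup_overgroup:
  "isomorphic_to_open_subgroup G X overgroup overgroup_topology"
  unfolding isomorphic_to_open_subgroup_def
proof (intro exI conjI)
  let ?U = "embedded (carrier G)" and ?\<phi> = "\<lambda>g. ([] :: ('a set \<times> nat) list, g)"
  interpret H: td_group overgroup overgroup_topology by (rule td_group_overgroup)
  show "subgroup ?U overgroup"
  proof (rule H.subgroupI)
    fix a assume a: "a \<in> ?U"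
    then show "inv\<^bsub>overgroup\<^esub> a \<in> ?U" by (auto simp: inv_overgroup)
    fix b assume "b \<in> ?U"
    then show "a \<otimes>\<^bsub>overgroup\<^esub> b \<in> ?U" using a by auto
  qed auto
  show "openin overgroup_topology ?U"
    using openin_topspace[of X] by (intro openin_overgroup_Times) auto
  show "?\<phi> \<in> iso G (overgroup\<lparr>carrier := ?U\<rparr>)"
    by (auto simp: iso_def hom_def bij_betw_def inj_on_def)
  have "homeomorphic_maps X (subtopology overgroup_topology ?U) ?\<phi> snd"
    unfolding homeomorphic_maps_def
  proof (intro conjI)
    have "continuous_map X overgroup_topology ?\<phi>"
      unfolding overgroup_topology_def by (intro continuous_map_pairedI) auto
    then show "continuous_map X (subtopology overgroup_topology ?U) ?\<phi>"
      by (simp add: continuous_map_in_subtopology Pi_iff image_subset_iff)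
    show "continuous_map (subtopology overgroup_topology ?U) X snd"
      by (rule continuous_map_from_subtopology[OF continuous_map_overgroup_snd])
  qed auto
  then show "homeomorphic_map X (subtopology overgroup_topology ?U) ?\<phi>"
    by (auto simp: homeomorphic_map_maps)
qed

lemma locally_compact_group_overgroup:
  assumes "locally_compact_space X"
  shows "locally_compact_group overgroup overgroup_topology"
  unfolding locally_compact_group_def
  using topological_group_overgroup Hausdorff_overgroup assms
  by (simp add: overgroup_topology_def locally_compact_space_prod_topology locally_compact_space_discrete_topology)

end

theorem mainTheorem2:
  fixes G :: "'a monoid" and X :: "'a topology"
  assumes "tdlc_group G X"
  shows "\<exists>(H :: 'a overgroup_element monoid) (Y :: 'a overgroup_element topology).
           locally_compact_group H Y \<and> cstar_simple H Y \<and> isomorphic_to_open_subgroup G X H Y"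
proof -
  interpret td_group G X by (rule tdlc_group_imp_td_group[OF assms])
  have "locally_compact_space X" using assms by (simp add: tdlc_group_def locally_compact_group_def)
  then show ?thesis
    using locally_compact_group_overgroup cstar_simple_overgroup isomorphic_to_open_subgroup_overgroup by blast
qed

end
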